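(* Let $(E,\tau)$ be a metrisable topological space, $F$ a reflexive separable Banach space with weak topology $\sigma_F$, and let $(\mathcal{X},\mathcal{S})$, $(\mathcal{Y},\mathcal{T})$ be topological spaces with $\mathcal{X}\subset L_0(\Omega,E)$ and $\mathcal{Y}\subset L_0(\Omega,F)$ such that: every sequence $\mathcal{S}$-converging to an element $x$ of $\mathcal{X}$ converges to $x$ in local measure; and every sequence $\mathcal{T}$-converging to an element $y$ of $\mathcal{Y}$ converges to $y$ in the Biting sense. Let $(x,y)\in\mathcal{X}\times\mathcal{Y}$ and let $f:\Omega\times E\times F\to\overline{\mathbb{R}}$ be a $\mathbb{T}\otimes\mathcal{B}(E\times F)$-measurable integrand satisfying for almost every $\omega\in\Omega$: (i) the function $f_\omega$ is sequentially $\tau\times\sigma_F$-lower semicontinuous at each point of $\{x(\omega)\}\times F$; (j) $f^{**}_\omega(x(\omega),y(\omega))=f_\omega(x(\omega),y(\omega))$. Then, whenever the integral functional $I_f$ satisfies the Ioffe's criterion at $(x,y)$, it is $\mathcal{S}\times\mathcal{T}$-sequentially lower semicontinuous at $(x,y)$. Conversely, suppose that the measure $\mu$ is atomless, that $I_f(x,y)\ne-\infty$, that $\mathcal{X}$ and $\mathcal{Y}$ are decomposable, and that the following holds: whenever $(A_n)_n$ is a sequence of measurable sets with $\lim_n\mu(A\cap A_n)=0$ for every measurable set $A$ of finite measure, and $((x_n,y_n))_n$ is a sequence of $\mathcal{X}\times\mathcal{Y}$ which $\mathcal{S}\times\mathcal{T}$-converges to an element $(x',y')$ of $\mathcal{X}\times\mathcal{Y}$,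 the sequence $(w_n)_n$ with $w_n=(x',y')$ on $A_n^c$ and $w_n=(x_n,y_n)$ on $A_n$ $\mathcal{S}\times\mathcal{T}$-converges to $(x',y')$. Then the Ioffe's criterion at $(x,y)$ is necessary for the $\mathcal{S}\times\mathcal{T}$-sequential lower semicontinuity of $I_f$ at $(x,y)$.
   Context: $(\Omega,\mathbb{T},\mu)$ is a measure space with $\mu$ a $\sigma$-finite positive measure and $\mathbb{T}$ $\mu$-complete. $L_0(\Omega,E)$ is the space of classes (a.e. equality) of Borel measurable functions $\Omega\to E$. $f_\omega=f(\omega,\cdot,\cdot)$; $f(x,y)$ is the function $\omega\mapsto f(\omega,x(\omega),y(\omega))$; $I_f(x,y)=\int^*_\Omega f(x,y)\,d\mu$ with $\int^*_\Omega v\,d\mu=\inf\{\int_\Omega u\,d\mu: u\in L_1(\Omega,\mathbb{R}),\ u\ge v\text{ a.e.}\}$; $v^-=\max(-v,0)$. Convergence in local measure is convergence in measure (for a distance defining $\tau$) on each measurable set of finite measure. $f^{**}$ is the partial Fenchel–Moreau biconjugate: $f^{**}_\omega(e,e')=(f_\omega(e,\cdot))^{**}(e')$, where for $k:F\to\overline{\mathbb{R}}$, $k^*(f^* )=\sup_{e'\in F}(\langle f^*,e'\rangle-k(e'))$ and $k^{**}(e')=\sup_{f^*\in F^*}(\langle f^*,e'\rangle-k^*(f^* ))$. Biting convergence: $(y_n)_n$ converges to $y$ in the Biting sense if there is an increasing covering (up to a negligible set) $(\Omega_k)_k$ of $\Omega$ by measurable sets such that, for all $k$, $y_n|_{\Omega_k}\to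 y|_{\Omega_k}$ for $\sigma(L_1(\Omega_k,F),L_1(\Omega_k,F)^* )$. A set $X$ of measurable functions is decomposable if for all $u,v\in X$ and every measurable $A$, the function equal to $u$ on $A$ and to $v$ on $A^c$ belongs to $X$. A subset $X$ of $L_1(\Omega,\mathbb{R})$ is uniformly integrable if it is bounded in $L_1$ and for every $\epsilon>0$ there are $\eta>0$ and a measurable $K$ of finite measure with $\sup_{u\in X}\|u1_A\|_1<\epsilon$ whenever $\mu(A)\le\eta$, and $\sup_{u\in X}\|u1_{K^c}\|_1<\epsilon$. Ioffe's criterion at $(x,y)$: for every sequence $((x_n,y_n))_n$ of $\mathcal{X}\times\mathcal{Y}$ $\mathcal{S}\times\mathcal{T}$-converging to $(x,y)$ such that $(I_f(x_n,y_n))_n$ is bounded above, the sequence $(f^-(x_n,y_n))_n$ is eventually uniformly integrable, i.e. there is $n_0$ such that $(f^-(x_n,y_n))_{n\ge n_0}$ is a uniformly integrable family in $L_1(\Omega,\mathbb{R})$. *)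

theory Defs
  imports "HOL-Analysis.Analysis"
begin

section \<open>Classes of measurable functions\<close>

definition ae_rel :: "'w measure \<Rightarrow> (('w \<Rightarrow> 'a::topological_space) \<times> ('w \<Rightarrow> 'a)) set" where
  "ae_rel M = {(u, v). u \<in> borel_measurable M \<and> v \<in> borel_measurable M \<and> (AE \<omega> in M. u \<omega> = v \<omega>)}"

lemma equiv_ae_rel: "equiv (borel_measurable M) (ae_rel M)"
proof (rule equivI)
  show "ae_rel M \<subseteq> borel_measurable M \<times> borel_measurable M" by (auto simp: ae_rel_def)
  show "refl_on (borel_measurable M) (ae_rel M)" by (auto simp: ae_rel_def refl_on_def)
  show "sym (ae_rel M)" by (auto simp: ae_rel_def sym_def elim: eventually_mono)
  show "trans (ae_rel M)"
    by (auto simp: ae_rel_def trans_def elim: eventually_elim2)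
qed

definition L0 :: "'w measure \<Rightarrow> ('w \<Rightarrow> 'a::topological_space) set set" where
  "L0 M = borel_measurable M // ae_rel M"

definition cls :: "'w measure \<Rightarrow> ('w \<Rightarrow> 'a::topological_space) \<Rightarrow> ('w \<Rightarrow> 'a) set" where
  "cls M u = ae_rel M `` {u}"

text \<open>An arbitrary representative; every notion below is invariant under almost everywhere
  equality, so the choice does not matter.\<close>

definition rep :: "('w \<Rightarrow> 'a) set \<Rightarrow> 'w \<Rightarrow> 'a" where
  "rep c = (SOME u. u \<in> c)"

text \<open>The class that is \<open>u\<close> on \<open>A\<close> and \<open>v\<close> on the complement of \<open>A\<close>.\<close>

definition glue :: "'w measure \<Rightarrow> 'w set \<Rightarrow> ('w \<Rightarrow> 'a::topological_space) set \<Rightarrow> ('w \<Rightarrow> 'a) set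
    \<Rightarrow> ('w \<Rightarrow> 'a) set" where
  "glue M A u v = cls M (\<lambda>\<omega>. if \<omega> \<in> A then rep u \<omega> else rep v \<omega>)"

definition decomposable :: "'w measure \<Rightarrow> ('w \<Rightarrow> 'a::topological_space) set set \<Rightarrow> bool" where
  "decomposable M X \<longleftrightarrow> (\<forall>u\<in>X. \<forall>v\<in>X. \<forall>A\<in>sets M. glue M A u v \<in> X)"

section \<open>Measure-theoretic notions\<close>

definition atomless :: "'w measure \<Rightarrow> bool" where
  "atomless M \<longleftrightarrow> \<not> (\<exists>A\<in>sets M. emeasure M A > 0 \<and>
     (\<forall>B\<in>sets M. B \<subseteq> A \<longrightarrow> emeasure M B = 0 \<or> emeasure M (A - B) = 0))"

text \<open>The outer measure is used because, when the target space is not separable, the distance of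
  two Borel functions need not be measurable, and \<^const>\<open>emeasure\<close> would give such sets the value
  \<open>0\<close>. On measurable sets the two agree.\<close>

definition tendsto_local_measure ::
  "'w measure \<Rightarrow> (nat \<Rightarrow> 'w \<Rightarrow> 'a::metric_space) \<Rightarrow> ('w \<Rightarrow> 'a) \<Rightarrow> bool" where
  "tendsto_local_measure M s u \<longleftrightarrow>
     (\<forall>A\<in>sets M. emeasure M A < \<infinity> \<longrightarrow>
       (\<forall>\<epsilon>>0. (\<lambda>n. outer_measure_of M {\<omega>\<in>A. dist (s n \<omega>) (u \<omega>) > \<epsilon>}) \<longlonglongrightarrow> 0))"

text \<open>Continuous linear functionals on the Bochner space of integrable functions. The functionals
  are given on functions instead of classes; the bound forces them to respect almost everywhere
  equality. Their values at non-integrable functions are irrelevant.\<close>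

definition L1_dual ::
  "'w measure \<Rightarrow> (('w \<Rightarrow> 'b::{banach, second_countable_topology}) \<Rightarrow> real) set" where
  "L1_dual N = {\<Lambda>.
     (\<forall>u v. integrable N u \<longrightarrow> integrable N v \<longrightarrow> \<Lambda> (\<lambda>\<omega>. u \<omega> + v \<omega>) = \<Lambda> u + \<Lambda> v) \<and>
     (\<forall>c u. integrable N u \<longrightarrow> \<Lambda> (\<lambda>\<omega>. c *\<^sub>R u \<omega>) = c * \<Lambda> u) \<and>
     (\<exists>C. \<forall>u. integrable N u \<longrightarrow> \<bar>\<Lambda> u\<bar> \<le> C * (LINT \<omega>|N. norm (u \<omega>)))}"

definition tendsto_weak_L1 ::
  "'w measure \<Rightarrow> (nat \<Rightarrow> 'w \<Rightarrow> 'b::{banach, second_countable_topology}) \<Rightarrow> ('w \<Rightarrow> 'b) \<Rightarrow> bool" where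
  "tendsto_weak_L1 N s u \<longleftrightarrow>
     (\<forall>n. integrable N (s n)) \<and> integrable N u \<and> (\<forall>\<Lambda>\<in>L1_dual N. (\<lambda>n. \<Lambda> (s n)) \<longlonglongrightarrow> \<Lambda> u)"

definition tendsto_biting ::
  "'w measure \<Rightarrow> (nat \<Rightarrow> 'w \<Rightarrow> 'b::{banach, second_countable_topology}) \<Rightarrow> ('w \<Rightarrow> 'b) \<Rightarrow> bool" where
  "tendsto_biting M s u \<longleftrightarrow>
     (\<exists>\<Omega> :: nat \<Rightarrow> 'w set. incseq \<Omega> \<and> range \<Omega> \<subseteq> sets M \<and> (AE \<omega> in M. \<omega> \<in> (\<Union>k. \<Omega> k)) \<and>
       (\<forall>k. tendsto_weak_L1 (restrict_space M (\<Omega> k)) s u))"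

definition unif_integrable :: "'w measure \<Rightarrow> ('w \<Rightarrow> real) set \<Rightarrow> bool" where
  "unif_integrable M X \<longleftrightarrow>
     (\<forall>u\<in>X. integrable M u) \<and>
     (SUP u\<in>X. \<integral>\<^sup>+\<omega>. ennreal \<bar>u \<omega>\<bar> \<partial>M) < \<infinity> \<and>
     (\<forall>\<epsilon>>0. \<exists>\<eta>>0. \<exists>K\<in>sets M. emeasure M K < \<infinity> \<and>
        (\<forall>A\<in>sets M. emeasure M A \<le> ennreal \<eta> \<longrightarrow>
           (SUP u\<in>X. \<integral>\<^sup>+\<omega>\<in>A. ennreal \<bar>u \<omega>\<bar> \<partial>M) < ennreal \<epsilon>) \<and>
        (SUP u\<in>X. \<integral>\<^sup>+\<omega>\<in>(space M - K). ennreal \<bar>u \<omega>\<bar> \<partial>M) < ennreal \<epsilon>)"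

section \<open>Functional analysis\<close>

text \<open>Surjectivity of the canonical embedding into the bidual.\<close>

definition reflexive_space :: "'b::real_normed_vector itself \<Rightarrow> bool" where
  "reflexive_space _ \<longleftrightarrow>
     (\<forall>\<Phi> :: ('b \<Rightarrow>\<^sub>L real) \<Rightarrow>\<^sub>L real. \<exists>e :: 'b. \<forall>\<phi>. blinfun_apply \<Phi> \<phi> = blinfun_apply \<phi> e)"

definition weak_topology :: "'b::real_normed_vector topology" where
  "weak_topology =
     topology_generated_by {blinfun_apply \<phi> -` U |(\<phi> :: 'b \<Rightarrow>\<^sub>L real) U. open U}"

definition fenchel_conj :: "('b::real_normed_vector \<Rightarrow> ereal) \<Rightarrow> ('b \<Rightarrow>\<^sub>L real) \<Rightarrow> ereal" where
  "fenchel_conj k \<phi> = (SUP e. ereal (blinfun_apply \<phi> e) - k e)"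

definition fenchel_biconj :: "('b::real_normed_vector \<Rightarrow> ereal) \<Rightarrow> 'b \<Rightarrow> ereal" where
  "fenchel_biconj k e = (SUP \<phi>. ereal (blinfun_apply \<phi> e) - fenchel_conj k \<phi>)"

definition partial_biconj ::
  "('w \<Rightarrow> 'e \<times> 'b::real_normed_vector \<Rightarrow> ereal) \<Rightarrow> 'w \<Rightarrow> 'e \<times> 'b \<Rightarrow> ereal" where
  "partial_biconj f \<omega> = (\<lambda>(e, e'). fenchel_biconj (\<lambda>b. f \<omega> (e, b)) e')"

definition seq_lsc_at :: "'a topology \<Rightarrow> ('a \<Rightarrow> ereal) \<Rightarrow> 'a \<Rightarrow> bool" where
  "seq_lsc_at T h p \<longleftrightarrow>
     (\<forall>s. (\<forall>n. s n \<in> topspace T) \<and> limitin T s p sequentially \<longrightarrow> h p \<le> liminf (\<lambda>n. h (s n)))"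

section \<open>Integral functionals\<close>

text \<open>The infimum is \<open>\<infinity>\<close> if there is no integrable majorant.\<close>

definition upper_integral :: "'w measure \<Rightarrow> ('w \<Rightarrow> ereal) \<Rightarrow> ereal" where
  "upper_integral M v =
     (INF u \<in> {u :: 'w \<Rightarrow> real. integrable M u \<and> (AE \<omega> in M. v \<omega> \<le> ereal (u \<omega>))}.
        ereal (LINT \<omega>|M. u \<omega>))"

definition superpos ::
  "('w \<Rightarrow> 'e \<times> 'b \<Rightarrow> ereal) \<Rightarrow> ('w \<Rightarrow> 'e) set \<times> ('w \<Rightarrow> 'b) set \<Rightarrow> 'w \<Rightarrow> ereal" where
  "superpos f = (\<lambda>(x, y) \<omega>. f \<omega> (rep x \<omega>, rep y \<omega>))"

definition int_functional ::
  "'w measure \<Rightarrow> ('w \<Rightarrow> 'e \<times> 'b \<Rightarrow> ereal) \<Rightarrow> ('w \<Rightarrow> 'e) set \<times> ('w \<Rightarrow> 'b) set \<Rightarrow> ereal" where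
  "int_functional M f p = upper_integral M (superpos f p)"

text \<open>The functions \<open>g n\<close> are finite versions of the negative parts: an extended real function
  belongs to the space of integrable real functions if it agrees almost everywhere with an
  integrable real function.\<close>

definition ioffe_criterion ::
  "'w measure \<Rightarrow> ('w \<Rightarrow> 'e) set topology \<Rightarrow> ('w \<Rightarrow> 'b) set topology \<Rightarrow>
     ('w \<Rightarrow> 'e \<times> 'b \<Rightarrow> ereal) \<Rightarrow> ('w \<Rightarrow> 'e) set \<times> ('w \<Rightarrow> 'b) set \<Rightarrow> bool" where
  "ioffe_criterion M S T f p \<longleftrightarrow>
     (\<forall>s. (\<forall>n. s n \<in> topspace S \<times> topspace T) \<and>
          limitin (prod_topology S T) s p sequentially \<and>
          (\<exists>C :: real. \<forall>n. int_functional M f (s n) \<le> ereal C) \<longrightarrow>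
        (\<exists>n0 g. (\<forall>n\<ge>n0. AE \<omega> in M. max (- superpos f (s n) \<omega>) 0 = ereal (g n \<omega>)) \<and>
                unif_integrable M (g ` {n0..})))"

end

theory Submission
  imports Defs "HOL-Complex_Analysis.Great_Picard"
begin

text \<open>
  Sufficiency of Ioffe's criterion. Suppose that \<open>I (x\<^sub>n, y\<^sub>n) \<le> C < I (x, y)\<close> along a
  subsequence. Along a further one \<open>x\<^sub>n \<rightarrow> x\<close> almost everywhere, \<open>y\<^sub>n \<rightarrow> y\<close> in the biting sense, and
  the negative parts of \<open>v\<^sub>n = f (x\<^sub>n, y\<^sub>n)\<close> are uniformly integrable. The values of the
  biconjugate are suprema of affine functions, so below any \<open>t (\<omega>) < f\<^sub>\<omega> (x (\<omega>), y (\<omega>))\<close> there is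
  an affine minorant \<open>a\<close> of \<open>f\<^sub>\<omega> (x (\<omega>), \<cdot>)\<close> with \<open>t (\<omega>) < a (y (\<omega>))\<close>. The minorant is not
  measurable in \<open>\<omega>\<close> a priori: a conjugate is a supremum over an uncountable set. But it only has
  to be tested on the countably many points \<open>y\<^sub>n (\<omega>)\<close>. Lower semicontinuity and the weak
  sequential compactness of balls show that, after a small perturbation of \<open>a\<close> inside a fixed
  countable family (the dual is separable), \<open>a (y\<^sub>n (\<omega>)) \<le> v\<^sub>n (\<omega>)\<close> holds for all large \<open>n\<close> with
  \<open>norm (y\<^sub>n (\<omega>)) \<le> R\<close> (\<open>eventually_affine_minorants\<close>). All choices are now between countably many
  candidates, so they can be made measurably by taking the first one. This replaces the measurable
  projection theorem and Young measures.

  The minorants are then integrated (\<open>affine_minorants_imp_eventually_set_integral_ge\<close>): a bounded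
  weakly* measurable slope defines a continuous functional on the space of integrable functions,
  so its integral against \<open>y\<^sub>n\<close> converges, and the set where \<open>norm (y\<^sub>n) > R\<close> contributes little,
  because a weakly convergent sequence of integrable functions is bounded and uniformly absolutely
  continuous. Both facts are obtained by gliding hump arguments (\<open>weakly_null_bounded\<close>,
  \<open>weakly_null_uniformly_absolutely_continuous\<close>). Uniform integrability of the negative parts of
  \<open>v\<^sub>n\<close> controls everything off the sets on which the minorants are uniform. Exhausting \<open>\<Omega>\<close> by
  such sets contradicts \<open>I (x\<^sub>n, y\<^sub>n) \<le> C\<close>.

  Necessity. If, along a convergent sequence with bounded functionals, the negative parts are not
  eventually uniformly small on small sets and off sets of finite measure, there are \<open>\<delta> > 0\<close>, a
  subsequence and sets \<open>A\<^sub>n\<close> of locally vanishing measure on which these negative parts have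
  integral larger than \<open>\<delta>\<close> (\<open>not_equi_small_witnesses\<close>). Pasting \<open>(x\<^sub>n, y\<^sub>n)\<close> into \<open>(x, y)\<close> on the
  part of \<open>A\<^sub>n\<close> where \<open>v\<^sub>n < 0\<close> gives a sequence that still converges to \<open>(x, y)\<close> while its
  integrals drop by \<open>\<delta>\<close> in the limit, against lower semicontinuity. So the smallness holds. Since
  the measure has no atoms, sets of finite measure are finite unions of small ones, and
  boundedness in \<open>L\<^sub>1\<close> follows.
\<close>

section \<open>The Hahn--Banach theorem\<close>

definition sublinear :: "('a::real_vector \<Rightarrow> real) \<Rightarrow> bool" where
  "sublinear p \<longleftrightarrow> (\<forall>x y. p (x + y) \<le> p x + p y) \<and> (\<forall>t x. 0 \<le> t \<longrightarrow> p (t *\<^sub>R x) = t * p x)"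

lemma sublinear_add: "sublinear p \<Longrightarrow> p (x + y) \<le> p x + p y"
  and sublinear_scale: "sublinear p \<Longrightarrow> 0 \<le> t \<Longrightarrow> p (t *\<^sub>R x) = t * p x"
  by (auto simp: sublinear_def)

lemma sublinear_zero: "sublinear p \<Longrightarrow> p 0 = 0"
  using sublinear_scale[of p 0 0] by simp

lemma sublinear_minus: "sublinear p \<Longrightarrow> - p (- x) \<le> p x"
  using sublinear_add[of p x "- x"] sublinear_zero[of p] by simp

lemma sublinearI_le:
  fixes p :: "'a::real_vector \<Rightarrow> real"
  assumes add: "\<And>x y. p (x + y) \<le> p x + p y"
    and scale: "\<And>t x. 0 < t \<Longrightarrow> p (t *\<^sub>R x) \<le> t * p x" and zero: "p 0 = 0"
  shows "sublinear p"
  unfolding sublinear_def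
proof (intro conjI allI impI)
  show "p (t *\<^sub>R x) = t * p x" if "0 \<le> t" for t x
  proof (cases "t = 0")
    case False
    with that have t: "0 < t" by simp
    have "p x \<le> (1 / t) * p (t *\<^sub>R x)"
      using scale[of "1 / t" "t *\<^sub>R x"] t by simp
    with t have "t * p x \<le> p (t *\<^sub>R x)" by (simp add: field_simps)
    with scale[OF t, of x] show ?thesis by simp
  qed (simp add: zero)
qed (rule add)

text \<open>This is the largest sublinear functional below \<open>q\<close> whose value at \<open>- y\<close> is at most \<open>- q y\<close>.
  A minimal sublinear functional agrees with all of these, and the last inequality then makes it
  additive.\<close>

lemma sublinear_slide:
  fixes q :: "'a::real_vector \<Rightarrow> real" and y :: 'a
  assumes q: "sublinear q"
  defines "q' \<equiv> \<lambda>x. INF t\<in>{0..}. q (x + t *\<^sub>R y) - t * q y"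
  shows "sublinear q'" and "q' x \<le> q x" and "q' x \<le> q (x + y) - q y"
proof -
  have lower: "- q (- x) \<le> q (x + t *\<^sub>R y) - t * q y" if "0 \<le> t" for x t
    using sublinear_add[OF q, of "x + t *\<^sub>R y" "- x"] sublinear_scale[OF q that, of y] by simp
  have bdd: "bdd_below ((\<lambda>t. q (x + t *\<^sub>R y) - t * q y) ` {0..})" for x
    using lower by (auto intro!: bdd_belowI[where m = "- q (- x)"])
  have le: "q' x \<le> q (x + t *\<^sub>R y) - t * q y" if "0 \<le> t" for x t
    unfolding q'_def by (rule cINF_lower[OF bdd]) (use that in auto)
  have ge: "c \<le> q' x" if "\<And>t. 0 \<le> t \<Longrightarrow> c \<le> q (x + t *\<^sub>R y) - t * q y" for c x
    unfolding q'_def by (rule cINF_greatest) (use that in auto)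
  show le_q: "q' x \<le> q x" for x using le[of 0 x] by simp
  show "q' x \<le> q (x + y) - q y" using le[of 1 x] by simp
  show "sublinear q'"
  proof (rule sublinearI_le)
    show "q' (a + b) \<le> q' a + q' b" for a b
    proof -
      have "q' (a + b) - (q (b + t *\<^sub>R y) - t * q y) \<le> q' a" if t: "0 \<le> t" for t
      proof (rule ge)
        fix s :: real assume s: "0 \<le> s"
        have "q' (a + b) \<le> q ((a + b) + (s + t) *\<^sub>R y) - (s + t) * q y"
          by (rule le) (use s t in simp)
        also have "q ((a + b) + (s + t) *\<^sub>R y) \<le> q (a + s *\<^sub>R y) + q (b + t *\<^sub>R y)"
          using sublinear_add[OF q, of "a + s *\<^sub>R y" "b + t *\<^sub>R y"]
          by (simp add: algebra_simps)
        finally show "q' (a + b) - (q (b + t *\<^sub>R y) - t * q y) \<le> q (a + s *\<^sub>R y) - s * q y"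
          by (simp add: algebra_simps)
      qed
      then have "q' (a + b) - q' a \<le> q' b" by (intro ge) (simp add: algebra_simps)
      then show ?thesis by simp
    qed
    show "q' (r *\<^sub>R a) \<le> r * q' a" if r: "0 < r" for r a
    proof -
      have "q' (r *\<^sub>R a) / r \<le> q' a"
      proof (rule ge)
        fix s :: real assume s: "0 \<le> s"
        have "q' (r *\<^sub>R a) \<le> q (r *\<^sub>R a + (r * s) *\<^sub>R y) - (r * s) * q y"
          by (rule le) (use r s in simp)
        also have "\<dots> = r * (q (a + s *\<^sub>R y) - s * q y)"
          using sublinear_scale[OF q, of r "a + s *\<^sub>R y"] r by (simp add: algebra_simps)
        finally show "q' (r *\<^sub>R a) / r \<le> q (a + s *\<^sub>R y) - s * q y"
          using r by (simp add: field_simps)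
      qed
      then show ?thesis using r by (simp add: field_simps)
    qed
    show "q' 0 = 0"
    proof (rule antisym)
      show "q' 0 \<le> 0" using le_q[of 0] sublinear_zero[OF q] by simp
      show "0 \<le> q' 0" by (rule ge) (use lower[of _ 0] sublinear_zero[OF q] in simp)
    qed
  qed
qed

text \<open>Zorn's lemma applies because the members of a chain below \<open>p\<close> are bounded below at \<open>x\<close> by
  \<open>- p (- x)\<close>, so their pointwise infimum is real; it is sublinear because the chain is directed.\<close>

lemma minimal_sublinear_below:
  fixes p :: "'a::real_vector \<Rightarrow> real"
  assumes p: "sublinear p"
  obtains q where "sublinear q" "\<And>x. q x \<le> p x"
    "\<And>q'. sublinear q' \<Longrightarrow> (\<And>x. q' x \<le> q x) \<Longrightarrow> q' = q"
proof -
  define A where "A = {q. sublinear q \<and> (\<forall>x. q x \<le> p x)}"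
  have "\<exists>m\<in>A. \<forall>a\<in>A. (\<forall>x. a x \<le> m x) \<longrightarrow> a = m"
  proof (rule predicate_Zorn)
    show "partial_order_on A (relation_of (\<lambda>q r. \<forall>x. r x \<le> q x) A)"
    proof (rule partial_order_on_relation_ofI)
      show "q = r" if "\<forall>x. r x \<le> q x" "\<forall>x. q x \<le> r x" for q r :: "'a \<Rightarrow> real"
        using that by (intro ext antisym) auto
    qed (auto intro: order_trans)
    fix C assume "C \<in> Chains (relation_of (\<lambda>q r. \<forall>x. r x \<le> q x) A)"
    then have CA: "C \<subseteq> A"
      and chain: "\<And>q r. q \<in> C \<Longrightarrow> r \<in> C \<Longrightarrow> (\<forall>x. r x \<le> q x) \<or> (\<forall>x. q x \<le> r x)"
      by (auto simp: Chains_def relation_of_def)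
    show "\<exists>u\<in>A. \<forall>a\<in>C. \<forall>x. u x \<le> a x"
    proof (cases "C = {}")
      case True
      then show ?thesis using p by (auto simp: A_def)
    next
      case ne: False
      define u where "u = (\<lambda>x. INF q\<in>C. q x)"
      have sub: "sublinear q" "q x \<le> p x" if "q \<in> C" for q x
        using CA that by (auto simp: A_def)
      have bdd: "bdd_below ((\<lambda>q. q x) ` C)" for x
      proof (rule bdd_belowI2)
        show "- p (- x) \<le> q x" if "q \<in> C" for q
          using sublinear_minus[OF sub(1)[OF that], of x] sub(2)[OF that, of "- x"] by simp
      qed
      have le: "u x \<le> q x" if "q \<in> C" for q x
        unfolding u_def by (rule cINF_lower[OF bdd that])
      have ge: "c \<le> u x" if "\<And>q. q \<in> C \<Longrightarrow> c \<le> q x" for c x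
        unfolding u_def by (rule cINF_greatest[OF ne that])
      have "sublinear u"
      proof (rule sublinearI_le)
        show "u (a + b) \<le> u a + u b" for a b
        proof -
          have "u (a + b) - r b \<le> u a" if r: "r \<in> C" for r
          proof (rule ge)
            fix q assume q: "q \<in> C"
            from chain[OF q r] show "u (a + b) - r b \<le> q a"
              using le[OF q, of "a + b"] le[OF r, of "a + b"]
                sublinear_add[OF sub(1)[OF q], of a b] sublinear_add[OF sub(1)[OF r], of a b]
              by (smt (verit))
          qed
          then have "u (a + b) - u a \<le> u b" by (intro ge) (simp add: algebra_simps)
          then show ?thesis by simp
        qed
        show "u (t *\<^sub>R a) \<le> t * u a" if t: "0 < t" for t a
        proof -
          have "u (t *\<^sub>R a) / t \<le> u a"
          proof (rule ge)
            fix q assume q: "q \<in> C"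
            show "u (t *\<^sub>R a) / t \<le> q a"
              using le[OF q, of "t *\<^sub>R a"] sublinear_scale[OF sub(1)[OF q], of t a] t
              by (simp add: field_simps)
          qed
          then show ?thesis using t by (simp add: field_simps)
        qed
        show "u 0 = 0"
        proof (rule antisym)
          obtain q where q: "q \<in> C" using ne by blast
          show "u 0 \<le> 0" using le[OF q, of 0] sublinear_zero[OF sub(1)[OF q]] by simp
          show "0 \<le> u 0" by (rule ge) (simp add: sublinear_zero[OF sub(1)])
        qed
      qed
      moreover have "u x \<le> p x" for x
        using ne le sub(2) by (metis ex_in_conv order_trans)
      ultimately show ?thesis using le by (auto simp: A_def)
    qed
  qed
  then obtain q where "q \<in> A" and min: "\<And>a. a \<in> A \<Longrightarrow> (\<forall>x. a x \<le> q x) \<Longrightarrow> a = q"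
    by blast
  then have q: "sublinear q" "q x \<le> p x" for x by (auto simp: A_def)
  show ?thesis
  proof (rule that[OF q(1) q(2)])
    fix q' assume "sublinear q'" "\<And>x. q' x \<le> q x"
    then show "q' = q" using q(2) by (intro min) (auto simp: A_def intro: order_trans)
  qed
qed

text \<open>The functional is linear because it is a minimal sublinear one. It attains \<open>p\<close> at \<open>x0\<close>
  because it is chosen below the slide of \<open>p\<close> along \<open>x0\<close>, whose value at \<open>- x0\<close> is at most
  \<open>- p x0\<close>. With \<open>p\<close> the norm this gives norming functionals, with \<open>p\<close> the distance to a subspace
  it gives functionals that vanish there.\<close>

lemma Hahn_Banach_sublinear:
  fixes p :: "'a::real_vector \<Rightarrow> real"
  assumes p: "sublinear p"
  obtains l where "linear l" "\<And>x. l x \<le> p x" "l x0 = p x0"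
proof -
  define p0 where "p0 = (\<lambda>x. INF t\<in>{0..}. p (x + t *\<^sub>R x0) - t * p x0)"
  have p0: "sublinear p0" "p0 x \<le> p x" "p0 x \<le> p (x + x0) - p x0" for x
    unfolding p0_def by (rule sublinear_slide[OF p])+
  obtain q where q: "sublinear q" "\<And>x. q x \<le> p0 x"
    and min: "\<And>q'. sublinear q' \<Longrightarrow> (\<And>x. q' x \<le> q x) \<Longrightarrow> q' = q"
    using minimal_sublinear_below[OF p0(1)] by blast
  have add: "q (x + y) = q x + q y" for x y
  proof -
    have slide: "(\<lambda>x. INF t\<in>{0..}. q (x + t *\<^sub>R y) - t * q y) = q"
      by (rule min[OF sublinear_slide(1)[OF q(1)] sublinear_slide(2)[OF q(1)]])
    have "q x \<le> q (x + y) - q y"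
      using sublinear_slide(3)[where q = q and x = x and y = y, OF q(1)] fun_cong[OF slide, of x]
      by simp
    with sublinear_add[OF q(1), of x y] show ?thesis by simp
  qed
  have neg: "q (- x) = - q x" for x
    using add[of x "- x"] sublinear_zero[OF q(1)] by simp
  have "linear q"
  proof (rule linearI[OF add])
    show "q (t *\<^sub>R x) = t *\<^sub>R q x" for t x
    proof (cases "0 \<le> t")
      case False
      then have "q ((- t) *\<^sub>R x) = - t * q x" by (intro sublinear_scale[OF q(1)]) simp
      then show ?thesis using neg[of "t *\<^sub>R x"] by simp
    qed (simp add: sublinear_scale[OF q(1)])
  qed
  moreover have le: "q x \<le> p x" for x using q(2) p0(2) order_trans by blast
  moreover have "q x0 = p x0"
  proof (rule antisym[OF le])
    have "q (- x0) \<le> - p x0"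
      using q(2)[of "- x0"] p0(3)[of "- x0"] sublinear_zero[OF p] by simp
    then show "p x0 \<le> q x0" by (simp add: neg)
  qed
  ultimately show ?thesis by (rule that)
qed

lemma Hahn_Banach_dominated_by_norm:
  fixes p :: "'a::real_normed_vector \<Rightarrow> real"
  assumes p: "sublinear p" and le: "\<And>x. p x \<le> norm x"
  obtains \<phi> :: "'a \<Rightarrow>\<^sub>L real" where "norm \<phi> \<le> 1" "\<And>x. \<phi> x \<le> p x" "\<phi> x0 = p x0"
proof -
  obtain l where l: "linear l" "\<And>x. l x \<le> p x" "l x0 = p x0"
    using Hahn_Banach_sublinear[OF p] by blast
  have abs: "\<bar>l x\<bar> \<le> norm x" for x
    using l(2)[of x] l(2)[of "- x"] le[of x] le[of "- x"] linear_neg[OF l(1), of x] by simp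
  then have "bounded_linear l"
    by (intro bounded_linear_intro[where K = 1]) (auto simp: linear_add[OF l(1)] linear_scale[OF l(1)])
  then have app: "blinfun_apply (Blinfun l) = l" by (rule bounded_linear_Blinfun_apply)
  show ?thesis
  proof (rule that[of "Blinfun l"])
    show "norm (Blinfun l) \<le> 1" by (rule norm_blinfun_bound) (use abs in \<open>auto simp: app\<close>)
  qed (auto simp: app l)
qed

lemma norming_functional:
  fixes b :: "'a::real_normed_vector"
  obtains \<phi> :: "'a \<Rightarrow>\<^sub>L real" where "norm \<phi> \<le> 1" "\<phi> b = norm b"
proof -
  have "sublinear (norm :: 'a \<Rightarrow> real)" by (simp add: sublinear_def norm_triangle_ineq)
  from Hahn_Banach_dominated_by_norm[OF this order_refl, of b] that show ?thesis by blast
qed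

lemma infdist_subspace_sublinear:
  fixes V :: "'a::real_normed_vector set"
  assumes V: "subspace V"
  shows "sublinear (\<lambda>x. infdist x V)"
proof (rule sublinearI_le)
  have ne: "V \<noteq> {}" using subspace_0[OF V] by auto
  have ge: "c \<le> infdist x V" if "\<And>v. v \<in> V \<Longrightarrow> c \<le> norm (x - v)" for c x
    unfolding infdist_notempty[OF ne] by (rule cINF_greatest[OF ne]) (simp add: dist_norm that)
  have le: "infdist x V \<le> norm (x - v)" if "v \<in> V" for x v
    using infdist_le[OF that, of x] by (simp add: dist_norm)
  show "infdist (a + b) V \<le> infdist a V + infdist b V" for a b
  proof -
    have "infdist (a + b) V - norm (b - w) \<le> infdist a V" if w: "w \<in> V" for w
    proof (rule ge)
      fix v assume v: "v \<in> V"
      have "infdist (a + b) V \<le> norm ((a + b) - (v + w))"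
        by (rule le) (rule subspace_add[OF V v w])
      also have "\<dots> \<le> norm (a - v) + norm (b - w)"
        by (metis add_diff_add norm_triangle_ineq)
      finally show "infdist (a + b) V - norm (b - w) \<le> norm (a - v)" by simp
    qed
    then have "infdist (a + b) V - infdist a V \<le> infdist b V" by (intro ge) (simp add: algebra_simps)
    then show ?thesis by simp
  qed
  show "infdist (t *\<^sub>R a) V \<le> t * infdist a V" if t: "0 < t" for t a
  proof -
    have "infdist (t *\<^sub>R a) V / t \<le> infdist a V"
    proof (rule ge)
      fix v assume v: "v \<in> V"
      have "infdist (t *\<^sub>R a) V \<le> norm (t *\<^sub>R a - t *\<^sub>R v)"
        by (rule le) (rule subspace_scale[OF V v])
      also have "\<dots> = t * norm (a - v)" using t by (simp flip: scaleR_diff_right)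
      finally show "infdist (t *\<^sub>R a) V / t \<le> norm (a - v)" using t by (simp add: field_simps)
    qed
    then show ?thesis using t by (simp add: field_simps)
  qed
  show "infdist 0 V = 0" using subspace_0[OF V] by simp
qed

lemma functional_vanishing_on_subspace:
  fixes V :: "'a::real_normed_vector set"
  assumes V: "subspace V" and x0: "x0 \<notin> closure V"
  obtains \<phi> :: "'a \<Rightarrow>\<^sub>L real" where "\<And>v. v \<in> V \<Longrightarrow> \<phi> v = 0" "\<phi> x0 > 0"
proof -
  have ne: "V \<noteq> {}" using subspace_0[OF V] by auto
  have "infdist x V \<le> norm x" for x using infdist_le[OF subspace_0[OF V], of x] by simp
  then obtain \<phi> :: "'a \<Rightarrow>\<^sub>L real" where \<phi>: "\<And>x. \<phi> x \<le> infdist x V" "\<phi> x0 = infdist x0 V"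
    using Hahn_Banach_dominated_by_norm[OF infdist_subspace_sublinear[OF V]] by metis
  show ?thesis
  proof (rule that[of \<phi>])
    show "\<phi> v = 0" if v: "v \<in> V" for v
      using \<phi>(1)[of v] \<phi>(1)[of "- v"] v subspace_neg[OF V v] by (simp add: blinfun.minus_right)
    show "\<phi> x0 > 0"
      using \<phi>(2) x0 in_closure_iff_infdist_zero[OF ne, of x0] infdist_nonneg[of x0 V] by linarith
  qed
qed

section \<open>Reflexive separable spaces\<close>

lemma rational_span_dense:
  fixes B :: "nat \<Rightarrow> 'a::real_normed_vector"
  shows "span (range B) \<subseteq> closure (range (\<lambda>qs :: rat list. \<Sum>i<length qs. of_rat (qs ! i) *\<^sub>R B i))"
    (is "_ \<subseteq> closure (range ?s)")
proof
  fix v assume v: "v \<in> span (range B)"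
  then have "v \<in> span (\<Union>n. B ` {..<n})"
    by (rule rev_subsetD[OF _ span_mono]) auto
  obtain n r where vr: "v = (\<Sum>i<(n::nat). r i *\<^sub>R B i)"
  proof -
    obtain t r where t: "finite t" "t \<subseteq> range B" and vt: "v = (\<Sum>a\<in>t. r a *\<^sub>R a)"
      using v unfolding span_explicit by blast
    from finite_subset_image[OF t] obtain I where I: "finite I" "t = B ` I" by blast
    obtain J where J: "J \<subseteq> I" "inj_on B J" "B ` J = t"
      using subset_image_inj[of t B I] I by auto
    have finJ: "finite J" using J(1) I(1) finite_subset by blast
    then obtain n where n: "J \<subseteq> {..<n}" by (metis finite_nat_iff_bounded)
    have "v = (\<Sum>i\<in>J. r (B i) *\<^sub>R B i)"
      unfolding vt J(3)[symmetric] by (rule sum.reindex_cong[OF J(2)]) auto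
    also have "\<dots> = (\<Sum>i<n. (if i \<in> J then r (B i) else 0) *\<^sub>R B i)"
      by (rule sum.mono_neutral_cong_left) (use n in auto)
    finally show ?thesis by (rule that)
  qed
  show "v \<in> closure (range ?s)"
    unfolding closure_approachable
  proof (intro allI impI)
    fix e :: real assume e: "0 < e"
    define S where "S = (\<Sum>i<n. norm (B i)) + 1"
    have S: "S > 0" by (simp add: S_def sum_nonneg add_nonneg_pos)
    have "\<exists>q. \<bar>of_rat q - r i\<bar> < e / S" for i
    proof -
      have "r i - e / S < r i + e / S" using e S by simp
      then obtain q where "r i - e / S < of_rat q" "of_rat q < r i + e / S"
        using of_rat_dense by blast
      then show ?thesis by (intro exI[of _ q]) (simp add: abs_less_iff)
    qed
    then obtain q where q: "\<And>i. \<bar>of_rat (q i) - r i\<bar> < e / S" by metis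
    let ?qs = "map q [0..<n]"
    have "?s ?qs - v = (\<Sum>i<n. (of_rat (q i) - r i) *\<^sub>R B i)"
      by (simp add: vr sum_subtractf[symmetric] scaleR_diff_left)
    then have "norm (?s ?qs - v) \<le> (\<Sum>i<n. \<bar>of_rat (q i) - r i\<bar> * norm (B i))"
      by (auto intro: order_trans[OF norm_sum])
    also have "\<dots> \<le> (\<Sum>i<n. (e / S) * norm (B i))"
      by (intro sum_mono mult_right_mono less_imp_le[OF q]) auto
    also have "\<dots> = (e / S) * (S - 1)" by (simp add: S_def sum_distrib_left)
    also have "\<dots> < e" using e S by (simp add: field_simps)
    finally have "dist (?s ?qs) v < e" by (simp only: dist_norm)
    then show "\<exists>y\<in>range ?s. dist y v < e" by blast
  qed
qed

text \<open>The functionals that norm a dense sequence of points span a dense subspace of the dual: a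
  continuous functional on the dual that vanishes on them is, by reflexivity, the evaluation at a
  point \<open>b\<close>, and the functional norming a point close to \<open>b\<close> does not vanish at \<open>b\<close> unless
  \<open>b = 0\<close>.\<close>

lemma reflexive_imp_dual_separable:
  assumes refl: "reflexive_space TYPE('a::{real_normed_vector, second_countable_topology})"
  obtains \<phi> :: "nat \<Rightarrow> 'a::{real_normed_vector, second_countable_topology} \<Rightarrow>\<^sub>L real" where
    "closure (range \<phi>) = UNIV"
proof -
  obtain D :: "'a set" where D: "countable D" "\<And>X. open X \<Longrightarrow> X \<noteq> {} \<Longrightarrow> \<exists>d\<in>D. d \<in> X"
    by (rule countable_dense_setE) blast
  have Dne: "D \<noteq> {}" using D(2)[of UNIV] by auto
  define d where "d = from_nat_into D"
  have "\<exists>\<psi> :: 'a \<Rightarrow>\<^sub>L real. norm \<psi> \<le> 1 \<and> blinfun_apply \<psi> (d i) = norm (d i)" for i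
    using norming_functional by metis
  then obtain \<psi> :: "nat \<Rightarrow> 'a \<Rightarrow>\<^sub>L real" where \<psi>: "\<And>i. norm (\<psi> i) \<le> 1"
    "\<And>i. blinfun_apply (\<psi> i) (d i) = norm (d i)"
    by metis
  have dense: "closure (span (range \<psi>)) = UNIV"
  proof (rule ccontr)
    assume "closure (span (range \<psi>)) \<noteq> UNIV"
    then obtain \<phi>0 where "\<phi>0 \<notin> closure (span (range \<psi>))" by auto
    then obtain \<Phi> :: "('a \<Rightarrow>\<^sub>L real) \<Rightarrow>\<^sub>L real" where
      \<Phi>: "\<And>v. v \<in> span (range \<psi>) \<Longrightarrow> \<Phi> v = 0" "\<Phi> \<phi>0 > 0"
      using functional_vanishing_on_subspace[OF subspace_span] by metis
    obtain b where b: "\<And>\<phi>. \<Phi> \<phi> = \<phi> b" using refl unfolding reflexive_space_def by metis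
    have "b \<noteq> 0" using b[of \<phi>0] \<Phi>(2) by auto
    then have pos: "norm b / 4 > 0" by simp
    then obtain e where e: "e \<in> D" "dist b e < norm b / 4"
      using D(2)[of "ball b (norm b / 4)"] by auto
    obtain i where i: "e = d i" using from_nat_into_surj[OF D(1) e(1)] by (auto simp: d_def)
    have "\<psi> i b = 0" using \<Phi>(1)[OF span_base, of "\<psi> i"] by (simp add: b)
    then have "norm (d i) = \<psi> i (d i - b)" by (simp add: \<psi>(2) blinfun.diff_right)
    also have "\<dots> \<le> norm (\<psi> i) * norm (d i - b)"
      using norm_blinfun[of "\<psi> i" "d i - b"] by simp
    also have "\<dots> \<le> norm (d i - b)" using \<psi>(1)[of i] by (simp add: mult_left_le_one_le)
    finally have "norm (d i) \<le> norm b / 4" using e(2) i by (simp add: dist_norm norm_minus_commute)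
    moreover have "norm b \<le> norm (d i) + norm (b - d i)" by (metis norm_triangle_sub)
    ultimately show False using e(2) i pos by (simp add: dist_norm)
  qed
  let ?s = "\<lambda>qs :: rat list. \<Sum>i<length qs. of_rat (qs ! i) *\<^sub>R \<psi> i"
  have "closure (range ?s) = UNIV"
    using closure_mono[OF rational_span_dense[of \<psi>]] dense by auto
  moreover have "range (\<lambda>n. ?s (from_nat n)) = range ?s"
    by (simp only: surj_from_nat flip: image_image[of ?s from_nat])
  ultimately show ?thesis using that[of "\<lambda>n. ?s (from_nat n)"] by simp
qed

text \<open>A diagonal subsequence converges against a dense sequence of functionals, hence, by
  boundedness, against all of them. The limit is a bounded linear functional on the dual, so it is
  a point of the space.\<close>

lemma reflexive_bounded_weakly_convergent_subsequence:
  fixes b :: "nat \<Rightarrow> 'a::{real_normed_vector, second_countable_topology}"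
  assumes refl: "reflexive_space TYPE('a)" and bound: "\<And>n. norm (b n) \<le> R"
  obtains r l where "strict_mono r" "\<And>\<phi> :: 'a \<Rightarrow>\<^sub>L real. (\<lambda>n. \<phi> (b (r n))) \<longlonglongrightarrow> \<phi> l"
proof -
  have R: "0 \<le> R" using bound[of 0] norm_ge_zero order_trans by blast
  obtain \<phi> :: "nat \<Rightarrow> 'a \<Rightarrow>\<^sub>L real" where dense: "closure (range \<phi>) = UNIV"
    using reflexive_imp_dual_separable[OF refl] by blast
  have cb: "\<bar>\<psi> (b n)\<bar> \<le> norm \<psi> * R" for \<psi> :: "'a \<Rightarrow>\<^sub>L real" and n
    using norm_blinfun[of \<psi> "b n"] bound[of n] mult_left_mono[of "norm (b n)" R "norm \<psi>"] by simp
  \<comment> \<open>normalising makes the values on the dense family uniformly bounded\<close>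
  define g where "g = (\<lambda>n i. \<phi> i (b n) / (norm (\<phi> i) + 1))"
  have "norm (g n i) \<le> R" for n i
  proof -
    have "\<bar>\<phi> i (b n)\<bar> \<le> (norm (\<phi> i) + 1) * R" using cb[of "\<phi> i" n] R by (simp add: algebra_simps)
    moreover have "norm (\<phi> i) + 1 > 0" using norm_ge_zero[of "\<phi> i"] by linarith
    ultimately show ?thesis by (simp add: g_def pos_divide_le_eq mult.commute)
  qed
  then obtain r where r: "strict_mono r" and ex: "\<And>i. \<exists>l. (\<lambda>n. g (r n) i) \<longlonglongrightarrow> l"
  proof -
    assume bound: "\<And>n i. norm (g n i) \<le> R"
      and conv: "\<And>r. strict_mono r \<Longrightarrow> (\<And>i. \<exists>l. (\<lambda>n. g (r n) i) \<longlonglongrightarrow> l) \<Longrightarrow> thesis"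
    show thesis
      by (rule function_convergent_subsequence[of UNIV g R]) (use bound conv in \<open>simp, simp, simp\<close>)
  qed
  have conv_dense: "Cauchy (\<lambda>n. \<phi> i (b (r n)))" for i
  proof -
    obtain l where "(\<lambda>n. g (r n) i) \<longlonglongrightarrow> l" using ex by blast
    then have "(\<lambda>n. (norm (\<phi> i) + 1) * g (r n) i) \<longlonglongrightarrow> (norm (\<phi> i) + 1) * l"
      by (intro tendsto_intros)
    moreover have "norm (\<phi> i) + 1 \<noteq> 0" using norm_ge_zero[of "\<phi> i"] by linarith
    ultimately have "convergent (\<lambda>n. \<phi> i (b (r n)))"
      by (auto simp: g_def convergent_def)
    then show ?thesis by (rule convergent_Cauchy)
  qed
  have "Cauchy (\<lambda>n. \<psi> (b (r n)))" for \<psi> :: "'a \<Rightarrow>\<^sub>L real"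
  proof (rule metric_CauchyI)
    fix e :: real assume e: "0 < e"
    define \<delta> where "\<delta> = e / (3 * (R + 1))"
    have \<delta>: "\<delta> > 0" "\<delta> * R < e / 3" using e R by (auto simp: \<delta>_def field_simps)
    obtain i where i: "dist (\<phi> i) \<psi> < \<delta>"
      using dense \<delta>(1) closure_approachable[of \<psi> "range \<phi>"] by auto
    have close: "\<bar>\<phi> i (b n) - \<psi> (b n)\<bar> < e / 3" for n
      using cb[of "\<phi> i - \<psi>" n] i \<delta> R mult_right_mono[of "norm (\<phi> i - \<psi>)" \<delta> R]
      by (simp add: blinfun.diff_left dist_norm)
    obtain N where N: "\<And>m n. m \<ge> N \<Longrightarrow> n \<ge> N \<Longrightarrow> dist (\<phi> i (b (r m))) (\<phi> i (b (r n))) < e / 3"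
      using metric_CauchyD[OF conv_dense[of i], of "e / 3"] e by auto
    show "\<exists>N. \<forall>m\<ge>N. \<forall>n\<ge>N. dist (\<psi> (b (r m))) (\<psi> (b (r n))) < e"
    proof (intro exI[of _ N] allI impI)
      fix m n assume "N \<le> m" "N \<le> n"
      with N have "\<bar>\<phi> i (b (r m)) - \<phi> i (b (r n))\<bar> < e / 3" by (simp add: dist_real_def)
      with close[of "r m"] close[of "r n"] show "dist (\<psi> (b (r m))) (\<psi> (b (r n))) < e"
        unfolding dist_real_def by linarith
    qed
  qed
  then have "\<exists>l. (\<lambda>n. \<psi> (b (r n))) \<longlonglongrightarrow> l" for \<psi> :: "'a \<Rightarrow>\<^sub>L real"
    using Cauchy_convergent convergent_def by blast
  then obtain \<Phi> :: "('a \<Rightarrow>\<^sub>L real) \<Rightarrow> real" where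
      \<Phi>: "\<And>\<psi>. (\<lambda>n. blinfun_apply \<psi> (b (r n))) \<longlonglongrightarrow> \<Phi> \<psi>"
    using choice[of "\<lambda>\<psi> l. (\<lambda>n. blinfun_apply \<psi> (b (r n))) \<longlonglongrightarrow> l"] by auto
  have "bounded_linear \<Phi>"
  proof (rule bounded_linear_intro[where K = R])
    show "\<Phi> (\<psi>1 + \<psi>2) = \<Phi> \<psi>1 + \<Phi> \<psi>2" for \<psi>1 \<psi>2
      by (rule LIMSEQ_unique[OF \<Phi>]) (use tendsto_add[OF \<Phi> \<Phi>] in \<open>simp add: blinfun.add_left\<close>)
    show "\<Phi> (c *\<^sub>R \<psi>) = c *\<^sub>R \<Phi> \<psi>" for c \<psi>
      by (rule LIMSEQ_unique[OF \<Phi>]) (use tendsto_scaleR[OF tendsto_const \<Phi>] in \<open>simp add: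
        blinfun.scaleR_left\<close>)
    show "norm (\<Phi> \<psi>) \<le> norm \<psi> * R" for \<psi>
      by (rule LIMSEQ_le_const2[OF tendsto_norm[OF \<Phi>]]) (use cb in auto)
  qed
  then obtain l where "\<And>\<psi>. \<Phi> \<psi> = \<psi> l"
    using refl bounded_linear_Blinfun_apply[OF \<open>bounded_linear \<Phi>\<close>]
    unfolding reflexive_space_def by metis
  with \<Phi> have "\<And>\<psi> :: 'a \<Rightarrow>\<^sub>L real. (\<lambda>n. \<psi> (b (r n))) \<longlonglongrightarrow> \<psi> l" by simp
  with r show ?thesis by (rule that)
qed

lemma limitin_weak_topology:
  fixes b :: "nat \<Rightarrow> 'a::real_normed_vector"
  assumes conv: "\<And>\<phi> :: 'a \<Rightarrow>\<^sub>L real. (\<lambda>n. \<phi> (b n)) \<longlonglongrightarrow> \<phi> l"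
  shows "limitin weak_topology b l sequentially"
proof -
  let ?G = "{blinfun_apply \<phi> -` U |(\<phi> :: 'a \<Rightarrow>\<^sub>L real) U. open U}"
  have top: "topspace (weak_topology :: 'a topology) = UNIV"
    unfolding weak_topology_def topology_generated_by_topspace by (auto intro!: exI[of _ UNIV])
  have "l \<in> U \<longrightarrow> (\<forall>\<^sub>F n in sequentially. b n \<in> U)" if "generate_topology_on ?G U" for U
    using that
  proof induction
    case (Int A B) then show ?case by (auto intro: eventually_conj)
  next
    case (UN K)
    show ?case
    proof
      assume "l \<in> \<Union>K"
      then obtain k where "k \<in> K" "l \<in> k" by blast
      with UN have "\<forall>\<^sub>F n in sequentially. b n \<in> k" by blast
      then show "\<forall>\<^sub>F n in sequentially. b n \<in> \<Union>K"
        by (rule eventually_mono) (use \<open>k \<in> K\<close> in blast)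
    qed
  next
    case (Basis S)
    then obtain \<phi> :: "'a \<Rightarrow>\<^sub>L real" and V where "S = blinfun_apply \<phi> -` V" "open V" by auto
    then show ?case using topological_tendstoD[OF conv[of \<phi>]] by auto
  qed simp
  then show ?thesis
    unfolding limitin_def top by (simp add: weak_topology_def openin_topology_generated_by_iff)
qed

section \<open>Weakly null sequences of integrable functions\<close>

text \<open>The part of \<open>g\<close> above a high level has small integral, and the rest is bounded.\<close>

lemma integral_absolutely_continuous:
  fixes g :: "'w \<Rightarrow> real"
  assumes g: "integrable N g" and nonneg: "\<And>\<omega>. 0 \<le> g \<omega>" and \<delta>: "0 < \<delta>"
  obtains \<eta> where "0 < \<eta>"
    "\<And>A. A \<in> sets N \<Longrightarrow> emeasure N A \<le> ennreal \<eta> \<Longrightarrow> (LINT \<omega>:A|N. g \<omega>) \<le> \<delta>"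
proof -
  have [measurable]: "g \<in> borel_measurable N" using g by simp
  have int_min: "integrable N (\<lambda>\<omega>. min (g \<omega>) (real k))" for k
    by (rule Bochner_Integration.integrable_bound[OF g]) (use nonneg in auto)
  have "(\<lambda>k. LINT \<omega>|N. g \<omega> - min (g \<omega>) (real k)) \<longlonglongrightarrow> (LINT \<omega>|N. 0)"
  proof (rule integral_dominated_convergence[where w = g])
    show "AE \<omega> in N. (\<lambda>k. g \<omega> - min (g \<omega>) (real k)) \<longlonglongrightarrow> 0"
    proof (rule AE_I2, rule tendsto_eventually)
      fix \<omega>
      show "\<forall>\<^sub>F k in sequentially. g \<omega> - min (g \<omega>) (real k) = 0"
        using eventually_ge_at_top[of "nat \<lceil>g \<omega>\<rceil>"] by eventually_elim linarith
    qed
    show "AE \<omega> in N. norm (g \<omega> - min (g \<omega>) (real k)) \<le> g \<omega>" for k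
      using nonneg by (intro AE_I2) (auto simp: min_def)
  qed (use g in auto)
  then have "\<forall>\<^sub>F k in sequentially. (LINT \<omega>|N. g \<omega> - min (g \<omega>) (real k)) < \<delta> / 2"
    using \<delta> by (intro order_tendstoD) auto
  then obtain k where k: "(LINT \<omega>|N. g \<omega> - min (g \<omega>) (real k)) < \<delta> / 2"
    by (auto simp: eventually_sequentially)
  show ?thesis
  proof (rule that[of "\<delta> / (2 * (real k + 1))"])
    show "0 < \<delta> / (2 * (real k + 1))" using \<delta> by simp
    fix A assume A [measurable]: "A \<in> sets N"
      and small: "emeasure N A \<le> ennreal (\<delta> / (2 * (real k + 1)))"
    have fin: "emeasure N A < \<infinity>" using small by (simp add: order_le_less_trans)
    have meas: "measure N A \<le> \<delta> / (2 * (real k + 1))"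
      using small \<delta> by (simp add: measure_def enn2real_leI)
    have "(LINT \<omega>:A|N. g \<omega>) \<le> (LINT \<omega>|N. (g \<omega> - min (g \<omega>) (real k)) + real k * indicator A \<omega>)"
      unfolding set_lebesgue_integral_def
    proof (rule integral_mono)
      show "integrable N (\<lambda>\<omega>. indicator A \<omega> *\<^sub>R g \<omega>)"
        using g A by (rule integrable_mult_indicator[rotated])
      show "integrable N (\<lambda>\<omega>. (g \<omega> - min (g \<omega>) (real k)) + real k * indicator A \<omega>)"
        using g int_min fin by (intro Bochner_Integration.integrable_add
          Bochner_Integration.integrable_diff
            integrable_mult_right) auto
      show "indicator A \<omega> *\<^sub>R g \<omega> \<le> (g \<omega> - min (g \<omega>) (real k)) + real k * indicator A \<omega>" for \<omega>
        using nonneg[of \<omega>] by (auto simp: indicator_def)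
    qed
    also have "\<dots> = (LINT \<omega>|N. g \<omega> - min (g \<omega>) (real k)) + real k * measure N A"
      using g int_min fin by simp
    also have "real k * measure N A \<le> \<delta> / 2"
    proof -
      have "real k * measure N A \<le> (real k + 1) * (\<delta> / (2 * (real k + 1)))"
        using meas by (intro mult_mono) auto
      also have "\<dots> = \<delta> / 2" by (simp add: field_simps)
      finally show ?thesis .
    qed
    finally show "(LINT \<omega>:A|N. g \<omega>) \<le> \<delta>" using k by simp
  qed
qed

text \<open>Densities of continuous functionals on the space of integrable functions. Only weak*
  measurability is required, because it survives gluing and pointwise limits without any
  assumption on the dual space.\<close>

definition bounded_density :: "'w measure \<Rightarrow> real \<Rightarrow> ('w \<Rightarrow> 'a::real_normed_vector \<Rightarrow>\<^sub>L real) \<Rightarrow> bool" where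
  "bounded_density N C \<psi> \<longleftrightarrow>
     (\<forall>b. (\<lambda>\<omega>. blinfun_apply (\<psi> \<omega>) b) \<in> borel_measurable N) \<and> (\<forall>\<omega>. norm (\<psi> \<omega>) \<le> C)"

lemma bounded_density_nonneg: "bounded_density N C \<psi> \<Longrightarrow> 0 \<le> C"
  unfolding bounded_density_def using norm_ge_zero order_trans by blast

lemma bounded_density_apply_le: "bounded_density N C \<psi> \<Longrightarrow> \<bar>blinfun_apply (\<psi> \<omega>) b\<bar> \<le> C * norm b"
  using norm_blinfun[of "\<psi> \<omega>" b] mult_right_mono[of "norm (\<psi> \<omega>)" C "norm b"]
  unfolding bounded_density_def by auto

text \<open>A measurable \<open>u\<close> is a pointwise limit of simple functions, each of which takes only finitely
  many values.\<close>

lemma bounded_density_measurable: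
  fixes u :: "'w \<Rightarrow> 'a::{real_normed_vector, second_countable_topology}"
  assumes \<psi>: "bounded_density N C \<psi>" and u: "u \<in> borel_measurable N"
  shows "(\<lambda>\<omega>. blinfun_apply (\<psi> \<omega>) (u \<omega>)) \<in> borel_measurable N"
proof -
  obtain F where F: "\<And>i. simple_function N (F i)"
      and lim: "\<And>\<omega>. \<omega> \<in> space N \<Longrightarrow> (\<lambda>i. F i \<omega>) \<longlonglongrightarrow> u \<omega>"
    using borel_measurable_implies_sequence_metric[OF u] by metis
  show ?thesis
  proof (rule borel_measurable_LIMSEQ_real)
    show "(\<lambda>i. blinfun_apply (\<psi> \<omega>) (F i \<omega>)) \<longlonglongrightarrow> blinfun_apply (\<psi> \<omega>) (u \<omega>)" if "\<omega> \<in> space N" for \<omega>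
      by (intro tendsto_intros lim that)
    show "(\<lambda>\<omega>. blinfun_apply (\<psi> \<omega>) (F i \<omega>)) \<in> borel_measurable N" for i
    proof (rule measurable_compose_countable'[where I = "F i ` space N"])
      show "F i \<in> measurable N (count_space (F i ` space N))"
        using simple_functionD[OF F[of i]]
        by (subst measurable_count_space_eq_countable) (auto intro: countable_finite)
      show "countable (F i ` space N)" using simple_functionD(1)[OF F] by (rule countable_finite)
    qed (use \<psi> in \<open>simp add: bounded_density_def\<close>)
  qed
qed

lemma bounded_density_integrable:
  fixes u :: "'w \<Rightarrow> 'a::{banach, second_countable_topology}"
  assumes \<psi>: "bounded_density N C \<psi>" and u: "integrable N u"
  shows "integrable N (\<lambda>\<omega>. blinfun_apply (\<psi> \<omega>) (u \<omega>))"
proof (rule Bochner_Integration.integrable_bound)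
  show "integrable N (\<lambda>\<omega>. C * norm (u \<omega>))" using u by simp
  show "(\<lambda>\<omega>. blinfun_apply (\<psi> \<omega>) (u \<omega>)) \<in> borel_measurable N"
    using bounded_density_measurable[OF \<psi>] u by simp
  show "AE \<omega> in N. norm (blinfun_apply (\<psi> \<omega>) (u \<omega>)) \<le> norm (C * norm (u \<omega>))"
    by (intro AE_I2) (metis abs_ge_self bounded_density_apply_le[OF \<psi>] order_trans real_norm_def)
qed

lemma bounded_density_L1_dual:
  assumes \<psi>: "bounded_density N C \<psi>"
  shows "(\<lambda>u. LINT \<omega>|N. blinfun_apply (\<psi> \<omega>) (u \<omega>)) \<in> L1_dual N"
  unfolding L1_dual_def
proof (intro CollectI conjI allI impI exI[of _ C])
  fix u v :: "'a \<Rightarrow> 'b" and c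
  assume u: "integrable N u"
  note iu = bounded_density_integrable[OF \<psi> u]
  show "(LINT \<omega>|N. blinfun_apply (\<psi> \<omega>) (c *\<^sub>R u \<omega>)) = c * (LINT \<omega>|N. blinfun_apply (\<psi> \<omega>) (u \<omega>))"
    by (simp add: blinfun.scaleR_right)
  have "\<bar>LINT \<omega>|N. blinfun_apply (\<psi> \<omega>) (u \<omega>)\<bar> \<le> (LINT \<omega>|N. C * norm (u \<omega>))"
    using u iu bounded_density_apply_le[OF \<psi>] by (intro integral_abs_bound[THEN order_trans]
      integral_mono) auto
  then show "\<bar>LINT \<omega>|N. blinfun_apply (\<psi> \<omega>) (u \<omega>)\<bar> \<le> C * (LINT \<omega>|N. norm (u \<omega>))" by simp
  assume v: "integrable N v"
  show "(LINT \<omega>|N. blinfun_apply (\<psi> \<omega>) (u \<omega> + v \<omega>)) =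
      (LINT \<omega>|N. blinfun_apply (\<psi> \<omega>) (u \<omega>)) + (LINT \<omega>|N. blinfun_apply (\<psi> \<omega>) (v \<omega>))"
    using iu bounded_density_integrable[OF \<psi> v] by (simp add: blinfun.add_right)
qed

text \<open>The factor \<open>1 / 2\<close> leaves room to choose the functional among those that norm a dense
  sequence of vectors, which makes the choice measurable.\<close>

lemma norming_density:
  fixes u :: "'w \<Rightarrow> 'a::{real_normed_vector, second_countable_topology}"
  assumes [measurable]: "u \<in> borel_measurable N"
  obtains \<theta> where "bounded_density N 1 \<theta>" "\<And>\<omega>. norm (u \<omega>) / 2 \<le> blinfun_apply (\<theta> \<omega>) (u \<omega>)"
proof -
  obtain D :: "'a set" where D: "countable D" "\<And>X. open X \<Longrightarrow> X \<noteq> {} \<Longrightarrow> \<exists>d\<in>D. d \<in> X"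
    by (rule countable_dense_setE) blast
  define d where "d = from_nat_into D"
  have dense: "\<exists>i. norm (u - d i) < e" if "e > 0" for u e
  proof -
    have "ball u e \<noteq> {}" using that by simp
    then obtain a where "a \<in> D" "a \<in> ball u e" using D(2)[OF open_ball] by blast
    then show ?thesis
      using from_nat_into_surj[OF D(1), of a] by (auto simp: d_def dist_norm)
  qed
  have "\<exists>\<phi> :: 'a \<Rightarrow>\<^sub>L real. norm \<phi> \<le> 1 \<and> blinfun_apply \<phi> (d i) = norm (d i)" for i
    using norming_functional by metis
  then obtain \<phi> :: "nat \<Rightarrow> 'a \<Rightarrow>\<^sub>L real"
    where \<phi>: "\<And>i. norm (\<phi> i) \<le> 1" "\<And>i. blinfun_apply (\<phi> i) (d i) = norm (d i)" by metis
  define I where "I = (\<lambda>\<omega>. LEAST i. u \<omega> = 0 \<or> norm (u \<omega> - d i) < norm (u \<omega>) / 4)"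
  have I [measurable]: "I \<in> measurable N (count_space UNIV)" unfolding I_def by measurable
  have close: "u \<omega> = 0 \<or> norm (u \<omega> - d (I \<omega>)) < norm (u \<omega>) / 4" for \<omega>
  proof -
    have "\<exists>i. u \<omega> = 0 \<or> norm (u \<omega> - d i) < norm (u \<omega>) / 4"
      using dense[of "norm (u \<omega>) / 4" "u \<omega>"] by auto
    then show ?thesis unfolding I_def by (rule LeastI_ex)
  qed
  show ?thesis
  proof (rule that[of "\<lambda>\<omega>. \<phi> (I \<omega>)"])
    show "bounded_density N 1 (\<lambda>\<omega>. \<phi> (I \<omega>))"
      unfolding bounded_density_def using \<phi>(1) by auto
    fix \<omega>
    show "norm (u \<omega>) / 2 \<le> blinfun_apply (\<phi> (I \<omega>)) (u \<omega>)"
    proof (cases "u \<omega> = 0")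
      case False
      let ?i = "I \<omega>"
      have "\<bar>blinfun_apply (\<phi> ?i) (u \<omega> - d ?i)\<bar> \<le> norm (u \<omega> - d ?i)"
        using norm_blinfun[of "\<phi> ?i" "u \<omega> - d ?i"] \<phi>(1)[of ?i]
          mult_left_le_one_le[of "norm (u \<omega> - d ?i)" "norm (\<phi> ?i)"] by simp
      moreover have "norm (u \<omega>) \<le> norm (d ?i) + norm (u \<omega> - d ?i)" by (rule norm_triangle_sub)
      ultimately show ?thesis
        using close[of \<omega>] False \<phi>(2)[of ?i] by (simp add: blinfun.diff_right)
    qed simp
  qed
qed

text \<open>Weak convergence to zero in \<open>L\<^sub>1\<close>, tested against the functionals that are given by
  densities.\<close>

definition weakly_null :: "'w measure \<Rightarrow> (nat \<Rightarrow> 'w \<Rightarrow> 'a::{banach, second_countable_topology}) \<Rightarrow> bool"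
  where
  "weakly_null N z \<longleftrightarrow> (\<forall>n. integrable N (z n)) \<and>
     (\<forall>C \<psi>. bounded_density N C \<psi> \<longrightarrow> (\<lambda>n. LINT \<omega>|N. blinfun_apply (\<psi> \<omega>) (z n \<omega>)) \<longlonglongrightarrow> 0)"

text \<open>Otherwise pick members with norms growing faster than \<open>8\<^sup>j\<close>, and add up densities norming
  them, with weights \<open>8\<^sup>-\<^sup>j\<close>. When the \<open>j\<close>-th term is added with the right sign, the functional
  becomes large on the \<open>j\<close>-th member, and the later terms are too small to undo this. The limit
  functional is unbounded along the sequence.\<close>

lemma weakly_null_bounded:
  assumes null: "weakly_null N z"
  obtains C where "\<And>n. (LINT \<omega>|N. norm (z n \<omega>)) \<le> C"
proof (rule ccontr)
  assume "\<not> thesis"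
  then have unbounded: "\<exists>n. C < (LINT \<omega>|N. norm (z n \<omega>))" for C
    using that by (meson not_le)
  have int [simp]: "integrable N (z n)" for n using null by (simp add: weakly_null_def)
  then have [measurable]: "z n \<in> borel_measurable N" for n
    by (rule borel_measurable_integrable)
  obtain m where m: "\<And>j. 4 * 8 ^ j * (real j + 1) < (LINT \<omega>|N. norm (z (m j) \<omega>))"
    using choice[of "\<lambda>j n. 4 * 8 ^ j * (real j + 1) < (LINT \<omega>|N. norm (z n \<omega>))"] unbounded by auto
  define a where "a j = (LINT \<omega>|N. norm (z (m j) \<omega>))" for j
  have "\<exists>\<theta>. bounded_density N 1 \<theta> \<and> (\<forall>\<omega>. norm (z (m j) \<omega>) / 2 \<le> blinfun_apply (\<theta> \<omega>) (z (m j) \<omega>))" for j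
    by (rule norming_density[OF borel_measurable_integrable[OF int[of "m j"]]]) blast
  then obtain \<theta> where \<theta>: "\<And>j. bounded_density N 1 (\<theta> j)"
      and \<theta>_ge: "\<And>j \<omega>. norm (z (m j) \<omega>) / 2 \<le> blinfun_apply (\<theta> j \<omega>) (z (m j) \<omega>)" by metis
  define \<rho> where "\<rho> j = (1 / 8 :: real) ^ j" for j
  define partial where "partial s n \<omega> = (\<Sum>i<n. (s i * \<rho> i) *\<^sub>R \<theta> i \<omega>)" for s :: "nat \<Rightarrow> real" and n \<omega>
  define T :: "nat \<Rightarrow> _ \<Rightarrow> real"
    where "T j \<psi> = (LINT \<omega>|N. blinfun_apply (\<psi> \<omega>) (z (m j) \<omega>))" for j \<psi>
  have norm\<theta>: "norm (\<theta> i \<omega>) \<le> 1" for i \<omega> using \<theta> by (auto simp: bounded_density_def)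
  have sum\<rho>: "summable \<rho>" "(\<Sum>i. \<rho> i) = 8 / 7" unfolding \<rho>_def
    using summable_geometric[of "1 / 8 :: real"] suminf_geometric[of "1 / 8 :: real"] by auto
  have tail\<rho>: "(\<Sum>i. \<rho> (i + n)) = \<rho> n * (8 / 7)" for n
    using suminf_mult[OF sum\<rho>(1), of "\<rho> n"] sum\<rho>(2) by (simp add: \<rho>_def power_add mult.commute)
  have \<theta>_int: "integrable N (\<lambda>\<omega>. blinfun_apply (\<theta> i \<omega>) (z n \<omega>))" for i n
    using bounded_density_integrable[OF \<theta> int] .
  have T_partial: "T j (partial s n) = (\<Sum>i<n. (s i * \<rho> i) * (LINT \<omega>|N. blinfun_apply (\<theta> i \<omega>) (z (m
    j) \<omega>)))"
    for j s n
    unfolding T_def partial_def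
    using \<theta>_int by (simp add: blinfun.sum_left blinfun.scaleR_left Bochner_Integration.integral_sum)
  have T_\<theta>: "a j / 2 \<le> (LINT \<omega>|N. blinfun_apply (\<theta> j \<omega>) (z (m j) \<omega>))" for j
  proof -
    have "(LINT \<omega>|N. norm (z (m j) \<omega>) / 2) \<le> (LINT \<omega>|N. blinfun_apply (\<theta> j \<omega>) (z (m j) \<omega>))"
      using \<theta>_int \<theta>_ge by (intro integral_mono) auto
    then show ?thesis by (simp add: a_def)
  qed
  \<comment> \<open>choose the signs one after the other: of the two values that differ by a large amount, one is
    large\<close>
  have "\<exists>s. \<forall>n. (\<forall>i<n. \<bar>s n i\<bar> \<le> (1::real)) \<and>
      ((\<forall>i<n. s (Suc n) i = s n i) \<and> \<rho> n * a n / 2 \<le> \<bar>T n (partial (s (Suc n)) (Suc n))\<bar>)"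
  proof (rule dependent_nat_choice)
    fix s :: "nat \<Rightarrow> real" and n assume s: "\<forall>i<n. \<bar>s i\<bar> \<le> 1"
    have upd: "T n (partial (s(n := t)) (Suc n)) =
        T n (partial s n) + t * (\<rho> n * (LINT \<omega>|N. blinfun_apply (\<theta> n \<omega>) (z (m n) \<omega>)))" for t
      unfolding T_partial by (simp add: mult.assoc)
    have "\<rho> n * (a n / 2) \<le> \<rho> n * (LINT \<omega>|N. blinfun_apply (\<theta> n \<omega>) (z (m n) \<omega>))"
      using T_\<theta>[of n] by (intro mult_left_mono) (auto simp: \<rho>_def)
    then have "\<rho> n * a n / 2 \<le> \<bar>T n (partial (s(n := 1)) (Suc n))\<bar> \<or>
        \<rho> n * a n / 2 \<le> \<bar>T n (partial (s(n := - 1)) (Suc n))\<bar>"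
      unfolding upd by linarith
    then obtain t where t: "t \<in> {1, -1::real}" "\<rho> n * a n / 2 \<le> \<bar>T n (partial (s(n := t)) (Suc n))\<bar>"
      by blast
    show "\<exists>s'. (\<forall>i<Suc n. \<bar>s' i\<bar> \<le> 1) \<and> (\<forall>i<n. s' i = s i) \<and>
        \<rho> n * a n / 2 \<le> \<bar>T n (partial s' (Suc n))\<bar>"
      by (rule exI[of _ "s(n := t)"]) (use s t in \<open>auto simp: less_Suc_eq\<close>)
  qed auto
  then obtain S where S_le: "\<And>n i. i < n \<Longrightarrow> \<bar>S n i\<bar> \<le> (1::real)"
    and S_Suc: "\<And>n i. i < n \<Longrightarrow> S (Suc n) i = S n i"
    and S_T: "\<And>n. \<rho> n * a n / 2 \<le> \<bar>T n (partial (S (Suc n)) (Suc n))\<bar>" by metis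
  define s where "s i = S (Suc i) i" for i
  have S_eq: "S n i = s i" if "i < n" for n i
    using that
  proof (induction n)
    case (Suc n) then show ?case using S_Suc[of i n] by (cases "i = n") (auto simp: s_def)
  qed simp
  have s_le: "\<bar>s i\<bar> \<le> 1" for i using S_le[of i "Suc i"] by (simp add: s_def)
  have partial_eq: "partial (S n) n = partial s n" for n
    unfolding partial_def using S_eq by (intro ext sum.cong) auto
  have term_le: "norm ((s i * \<rho> i) *\<^sub>R \<theta> i \<omega>) \<le> \<rho> i" for i \<omega>
    using mult_mono[OF s_le[of i] norm\<theta>[of i \<omega>]] mult_left_mono[of _ 1 "\<rho> i"]
    by (simp add: abs_mult \<rho>_def mult_ac)
  have summ: "summable (\<lambda>i. (s i * \<rho> i) *\<^sub>R \<theta> i \<omega>)" for \<omega>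
    by (rule summable_comparison_test'[OF sum\<rho>(1)]) (rule term_le)
  define \<psi> where "\<psi> \<omega> = (\<Sum>i. (s i * \<rho> i) *\<^sub>R \<theta> i \<omega>)" for \<omega>
  have tail: "norm (\<psi> \<omega> - partial s n \<omega>) \<le> \<rho> n * (8 / 7)" for n \<omega>
  proof -
    have "\<psi> \<omega> - partial s n \<omega> = (\<Sum>i. (s (i + n) * \<rho> (i + n)) *\<^sub>R \<theta> (i + n) \<omega>)"
      unfolding \<psi>_def partial_def using suminf_split_initial_segment[OF summ[of \<omega>], of n] by simp
    also have "norm \<dots> \<le> (\<Sum>i. \<rho> (i + n))"
      by (rule norm_suminf_le) (use term_le sum\<rho>(1) in \<open>auto simp: summable_iff_shift\<close>)
    finally show ?thesis by (simp add: tail\<rho>)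
  qed
  have \<psi>: "bounded_density N (8 / 7) \<psi>"
    unfolding bounded_density_def
  proof (intro conjI allI)
    show "norm (\<psi> \<omega>) \<le> 8 / 7" for \<omega> using tail[of \<omega> 0] by (simp add: partial_def \<rho>_def)
    show "(\<lambda>\<omega>. blinfun_apply (\<psi> \<omega>) b) \<in> borel_measurable N" for b
    proof (rule borel_measurable_LIMSEQ_real)
      show "(\<lambda>n. blinfun_apply (partial s n \<omega>) b) \<longlonglongrightarrow> blinfun_apply (\<psi> \<omega>) b" for \<omega>
        unfolding \<psi>_def partial_def by (intro tendsto_intros summable_LIMSEQ[OF summ])
      show "(\<lambda>\<omega>. blinfun_apply (partial s n \<omega>) b) \<in> borel_measurable N" for n
        unfolding partial_def blinfun.sum_left blinfun.scaleR_left
        by (intro borel_measurable_sum borel_measurable_scaleR borel_measurable_const)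
          (use \<theta> in \<open>auto simp: bounded_density_def\<close>)
    qed
  qed
  have large: "real j + 1 \<le> \<bar>LINT \<omega>|N. blinfun_apply (\<psi> \<omega>) (z (m j) \<omega>)\<bar>" for j
  proof -
    let ?p = "partial s (Suc j)"
    have p_int: "integrable N (\<lambda>\<omega>. blinfun_apply (?p \<omega>) (z (m j) \<omega>))"
      unfolding partial_def blinfun.sum_left blinfun.scaleR_left using \<theta>_int by simp
    have "T j \<psi> - T j ?p = (LINT \<omega>|N. blinfun_apply (\<psi> \<omega> - ?p \<omega>) (z (m j) \<omega>))"
      unfolding T_def using bounded_density_integrable[OF \<psi> int] p_int by (simp add: blinfun.diff_left)
    also have "\<bar>\<dots>\<bar> \<le> (LINT \<omega>|N. \<rho> (Suc j) * (8 / 7) * norm (z (m j) \<omega>))"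
    proof (rule integral_abs_bound[THEN order_trans], rule integral_mono)
      show "integrable N (\<lambda>\<omega>. \<bar>blinfun_apply (\<psi> \<omega> - ?p \<omega>) (z (m j) \<omega>)\<bar>)"
        using bounded_density_integrable[OF \<psi> int] p_int by (simp add: blinfun.diff_left)
      show "\<bar>blinfun_apply (\<psi> \<omega> - ?p \<omega>) (z (m j) \<omega>)\<bar> \<le> \<rho> (Suc j) * (8 / 7) * norm (z (m j) \<omega>)" for \<omega>
        using norm_blinfun[of "\<psi> \<omega> - ?p \<omega>" "z (m j) \<omega>"] mult_right_mono[OF tail[of \<omega>
          "Suc j"] norm_ge_zero[of "z (m j) \<omega>"]]
        by simp
    qed simp
    also have "\<dots> = \<rho> j * a j / 7" by (simp add: a_def \<rho>_def)
    finally have "\<rho> j * a j / 2 - \<rho> j * a j / 7 \<le> \<bar>T j \<psi>\<bar>"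
      using S_T[of j] unfolding partial_eq by linarith
    moreover have "4 * (real j + 1) \<le> \<rho> j * a j"
      using m[of j] by (simp add: a_def \<rho>_def field_simps power_divide)
    moreover have "r + 1 \<le> y" if "x / 2 - x / 7 \<le> y" "4 * (r + 1) \<le> x" "0 \<le> r" for x y r :: real
      using that by (simp add: field_simps)
    ultimately show ?thesis unfolding T_def using of_nat_0_le_iff by blast
  qed
  have "Bseq (\<lambda>n. LINT \<omega>|N. blinfun_apply (\<psi> \<omega>) (z n \<omega>))"
    using null \<psi> unfolding weakly_null_def by (metis convergentI convergent_imp_Bseq)
  then obtain K where "\<And>n. \<bar>LINT \<omega>|N. blinfun_apply (\<psi> \<omega>) (z n \<omega>)\<bar> \<le> K"
    by (auto simp: Bseq_def)
  with large have "real j + 1 \<le> K" for j using order_trans by blast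
  from this[of "nat \<lceil>K\<rceil>"] show False by linarith
qed


lemma set_integral_Union_le:
  fixes g :: "'w \<Rightarrow> real"
  assumes g: "integrable N g" and nonneg: "\<And>\<omega>. 0 \<le> g \<omega>"
    and A: "\<And>i :: nat. A i \<in> sets N" and le: "\<And>i. (LINT \<omega>:A i|N. g \<omega>) \<le> c i" and c: "c sums d"
  shows "(LINT \<omega>:(\<Union>i. A i)|N. g \<omega>) \<le> d"
proof -
  let ?D = "density N (\<lambda>\<omega>. ennreal (g \<omega>))"
  have [measurable]: "g \<in> borel_measurable N" using g by (rule borel_measurable_integrable)
  have D: "emeasure ?D B = ennreal (LINT \<omega>:B|N. g \<omega>)" if B: "B \<in> sets N" for B
  proof -
    have "emeasure ?D B = (\<integral>\<^sup>+\<omega>. ennreal (indicator B \<omega> *\<^sub>R g \<omega>) \<partial>N)"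
      using B by (subst emeasure_density) (auto intro!: nn_integral_cong simp: indicator_def)
    also have "\<dots> = ennreal (LINT \<omega>:B|N. g \<omega>)"
      unfolding set_lebesgue_integral_def
      by (rule nn_integral_eq_integral) (use integrable_mult_indicator[OF B g] nonneg in auto)
    finally show ?thesis .
  qed
  have pos: "0 \<le> (LINT \<omega>:B|N. g \<omega>)" for B
    unfolding set_lebesgue_integral_def by (rule integral_nonneg_AE) (use nonneg in auto)
  then have c0: "0 \<le> c i" for i using le order_trans by blast
  then have d0: "0 \<le> d" using c by (metis sums_unique suminf_nonneg sums_summable)
  have "ennreal (LINT \<omega>:(\<Union>i. A i)|N. g \<omega>) \<le> (\<Sum>i. emeasure ?D (A i))"
    unfolding D[OF sets.countable_UN[OF image_subsetI[OF A]], symmetric]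
    by (rule emeasure_subadditive_countably) (use A in auto)
  also have "\<dots> \<le> (\<Sum>i. ennreal (c i))"
    by (intro suminf_le) (auto simp: D[OF A] le ennreal_leI)
  also have "\<dots> = ennreal d" using c0 c by (intro sums_unique[symmetric] sums_ennreal[THEN iffD2])
    (auto simp: d0)
  finally show ?thesis using d0 by simp
qed

lemma bounded_density_If:
  assumes \<psi>: "bounded_density N C \<psi>" and \<psi>': "bounded_density N C \<psi>'" and A [measurable]: "A \<in> sets N"
  shows "bounded_density N C (\<lambda>\<omega>. if \<omega> \<in> A then \<psi> \<omega> else \<psi>' \<omega>)"
  unfolding bounded_density_def
proof (intro conjI allI)
  have [measurable]: "(\<lambda>\<omega>. blinfun_apply (\<psi> \<omega>) b) \<in> borel_measurable N"
      "(\<lambda>\<omega>. blinfun_apply (\<psi>' \<omega>) b) \<in> borel_measurable N" for b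
    using \<psi> \<psi>' by (auto simp: bounded_density_def)
  show "(\<lambda>\<omega>. blinfun_apply (if \<omega> \<in> A then \<psi> \<omega> else \<psi>' \<omega>) b) \<in> borel_measurable N" for b
    by (simp add: if_distrib[of "\<lambda>\<phi>. blinfun_apply \<phi> b"])
qed (use \<psi> \<psi>' in \<open>auto simp: bounded_density_def\<close>)

lemma bounded_density_0: "0 \<le> C \<Longrightarrow> bounded_density N C (\<lambda>_. 0)"
  by (simp add: bounded_density_def)

text \<open>Otherwise there are members of the sequence with mass more than \<open>\<epsilon>\<close> on sets \<open>A j\<close> that are
  negligible for all members selected before. Densities are defined recursively: on \<open>A j\<close> the old
  density is overwritten either by one that norms the \<open>j\<close>-th member or by zero. The two results
  differ by at least \<open>\<epsilon> / 2\<close> when integrated against that member, so one of them gives at least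
  \<open>\<epsilon> / 4\<close> in absolute value, and later changes happen on a set that is negligible for it. The
  integrals of the final density against the sequence do not tend to zero. Points in infinitely
  many \<open>A j\<close> need no limit: the density is set to zero there.\<close>

lemma weakly_null_uniformly_absolutely_continuous:
  fixes z :: "nat \<Rightarrow> 'w \<Rightarrow> 'a::{banach, second_countable_topology}"
  assumes null: "weakly_null N z" and \<epsilon>: "0 < \<epsilon>"
  obtains \<eta> where "0 < \<eta>"
    "\<And>n A. A \<in> sets N \<Longrightarrow> emeasure N A \<le> ennreal \<eta> \<Longrightarrow> (LINT \<omega>:A|N. norm (z n \<omega>)) \<le> \<epsilon>"
proof (rule ccontr)
  note witness = that
  assume "\<not> thesis"
  then have concentrated: "\<exists>n A. A \<in> sets N \<and> emeasure N A \<le> ennreal \<eta> \<and> \<epsilon> < (LINT \<omega>:A|N. norm (z n \<omega>))"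
    if "0 < \<eta>" for \<eta>
    using that witness by (meson not_le)
  have int [simp]: "integrable N (z n)" for n using null by (simp add: weakly_null_def)
  then have [measurable]: "z n \<in> borel_measurable N" for n
    by (rule borel_measurable_integrable)
  have set_int: "integrable N (\<lambda>\<omega>. indicator A \<omega> *\<^sub>R norm (z n \<omega>))" if "A \<in> sets N" for A n
    using that by (intro integrable_mult_indicator) auto
  have single: "\<exists>\<eta>>0. \<forall>n\<le>k. \<forall>A\<in>sets N. emeasure N A \<le> ennreal \<eta> \<longrightarrow> (LINT \<omega>:A|N. norm (z n \<omega>)) \<le> \<delta>"
    if \<delta>: "0 < \<delta>" for \<delta> and k :: nat
  proof -
    have "\<exists>\<eta>>0. \<forall>A\<in>sets N. emeasure N A \<le> ennreal \<eta> \<longrightarrow> (LINT \<omega>:A|N. norm (z n \<omega>)) \<le> \<delta>" for n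
      by (rule integral_absolutely_continuous[of N "\<lambda>\<omega>. norm (z n \<omega>)" \<delta>]) (use \<delta> in auto)
    then obtain h where h: "\<And>n. 0 < h n" "\<And>n A. A \<in> sets N \<Longrightarrow> emeasure N A \<le> ennreal (h n) \<Longrightarrow>
        (LINT \<omega>:A|N. norm (z n \<omega>)) \<le> \<delta>" by metis
    show ?thesis
    proof (intro exI[of _ "Min (h ` {..k})"] conjI allI impI ballI)
      show "0 < Min (h ` {..k})" using h(1) by simp
      fix n A assume "n \<le> k" "A \<in> sets N" "emeasure N A \<le> ennreal (Min (h ` {..k}))"
      moreover from \<open>n \<le> k\<close> have "ennreal (Min (h ` {..k})) \<le> ennreal (h n)"
        by (intro ennreal_leI Min_le) auto
      ultimately show "(LINT \<omega>:A|N. norm (z n \<omega>)) \<le> \<delta>" using h(2) order_trans by blast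
    qed
  qed
  define \<rho> where "\<rho> j = \<epsilon> / 16 * (1 / 2) ^ j" for j :: nat
  have \<rho>_pos: "0 < \<rho> j" for j using \<epsilon> by (simp add: \<rho>_def)
  \<comment> \<open>each hump is negligible for all the functions selected before it\<close>
  have "\<exists>F. \<forall>j. (snd (F j) \<in> sets N \<and> \<epsilon> < (LINT \<omega>:snd (F j)|N. norm (z (fst (F j)) \<omega>))) \<and>
      (fst (F j) < fst (F (Suc j)) \<and> (\<forall>n\<le>fst (F j). (LINT \<omega>:snd (F (Suc j))|N. norm (z n \<omega>)) \<le>
        \<rho> (Suc j)))"
  proof (rule dependent_nat_choice)
    show "\<exists>x. snd x \<in> sets N \<and> \<epsilon> < (LINT \<omega>:snd x|N. norm (z (fst x) \<omega>))"
      using concentrated[of 1] by auto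
    fix x :: "nat \<times> 'w set" and j
    obtain \<eta> where \<eta>: "\<eta> > 0" "\<And>n A. n \<le> fst x \<Longrightarrow> A \<in> sets N \<Longrightarrow> emeasure N A \<le> ennreal \<eta> \<Longrightarrow>
        (LINT \<omega>:A|N. norm (z n \<omega>)) \<le> min \<epsilon> (\<rho> (Suc j))"
      using single[of "min \<epsilon> (\<rho> (Suc j))" "fst x"] \<epsilon> \<rho>_pos[of "Suc j"] by auto
    obtain n A where nA: "A \<in> sets N" "emeasure N A \<le> ennreal \<eta>" "\<epsilon> < (LINT \<omega>:A|N. norm (z n \<omega>))"
      using concentrated[OF \<eta>(1)] by blast
    have "fst x < n" using \<eta>(2)[of n A] nA by force
    then show "\<exists>y. (snd y \<in> sets N \<and> \<epsilon> < (LINT \<omega>:snd y|N. norm (z (fst y) \<omega>))) \<and>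
        (fst x < fst y \<and> (\<forall>n\<le>fst x. (LINT \<omega>:snd y|N. norm (z n \<omega>)) \<le> \<rho> (Suc j)))"
      using nA \<eta>(2) by (intro exI[of _ "(n, A)"]) force
  qed
  then obtain F where F: "\<And>j. snd (F j) \<in> sets N" "\<And>j. \<epsilon> < (LINT \<omega>:snd (F j)|N. norm (z (fst (F j)) \<omega>))"
    "\<And>j. fst (F j) < fst (F (Suc j))"
    "\<And>j n. n \<le> fst (F j) \<Longrightarrow> (LINT \<omega>:snd (F (Suc j))|N. norm (z n \<omega>)) \<le> \<rho> (Suc j)"
    by blast
  define m where "m j = fst (F j)" for j
  define A where "A j = snd (F j)" for j
  have m_mono: "strict_mono m" unfolding strict_mono_Suc_iff m_def using F(3) by blast
  have A [measurable]: "A j \<in> sets N" for j using F(1) by (simp add: A_def)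
  have A_large: "\<epsilon> < (LINT \<omega>:A j|N. norm (z (m j) \<omega>))" for j using F(2) by (simp add: A_def m_def)
  have A_small: "(LINT \<omega>:A i|N. norm (z (m j) \<omega>)) \<le> \<rho> i" if "j < i" for i j
  proof -
    obtain i' where i': "i = Suc i'" "j \<le> i'" using \<open>j < i\<close> by (cases i) auto
    then show ?thesis using F(4)[of "m j" i'] strict_mono_less_eq[OF m_mono, of j i']
      by (simp add: A_def m_def)
  qed
  have "\<exists>\<theta>. bounded_density N 1 \<theta> \<and> (\<forall>\<omega>. norm (z (m j) \<omega>) / 2 \<le> blinfun_apply (\<theta> \<omega>) (z (m j) \<omega>))" for j
    by (rule norming_density[OF borel_measurable_integrable[OF int[of "m j"]]]) blast
  then obtain \<theta> where \<theta>: "\<And>j. bounded_density N 1 (\<theta> j)"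
      and \<theta>_ge: "\<And>j \<omega>. norm (z (m j) \<omega>) / 2 \<le> blinfun_apply (\<theta> j \<omega>) (z (m j) \<omega>)" by metis
  define T :: "nat \<Rightarrow> _ \<Rightarrow> real"
    where "T j \<psi> = (LINT \<omega>|N. blinfun_apply (\<psi> \<omega>) (z (m j) \<omega>))" for j \<psi>
  define glued where "glued j \<phi> \<psi> \<omega> = (if \<omega> \<in> A j then \<phi> \<omega> else \<psi> \<omega>)"
    for j :: nat and \<phi> \<psi> :: "'w \<Rightarrow> 'a \<Rightarrow>\<^sub>L real" and \<omega>
  have glued: "bounded_density N 1 (glued j \<phi> \<psi>)" if "bounded_density N 1 \<phi>"
    "bounded_density N 1 \<psi>" for j \<phi> \<psi>
    unfolding glued_def using that A by (rule bounded_density_If)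
  have zero: "bounded_density N 1 (\<lambda>_. 0 :: 'a \<Rightarrow>\<^sub>L real)" by (simp add: bounded_density_0)
  have "\<exists>\<Psi>. \<forall>j. bounded_density N 1 (\<Psi> j) \<and>
      (\<epsilon> / 4 \<le> \<bar>T j (\<Psi> (Suc j))\<bar> \<and> (\<forall>\<omega>. \<omega> \<notin> A j \<longrightarrow> \<Psi> (Suc j) \<omega> = \<Psi> j \<omega>))"
  proof (rule dependent_nat_choice)
    show "\<exists>\<psi> :: 'w \<Rightarrow> 'a \<Rightarrow>\<^sub>L real. bounded_density N 1 \<psi>" using zero by blast
    fix \<psi> :: "'w \<Rightarrow> 'a \<Rightarrow>\<^sub>L real" and j assume \<psi>: "bounded_density N 1 \<psi>"
    let ?a = "glued j (\<theta> j) \<psi>" and ?b = "glued j (\<lambda>_. 0) \<psi>"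
    have "T j ?a - T j ?b = (LINT \<omega>|N. blinfun_apply (?a \<omega>) (z (m j) \<omega>)
      - blinfun_apply (?b \<omega>) (z (m j) \<omega>))"
      unfolding T_def using bounded_density_integrable[OF glued[OF \<theta> \<psi>] int]
        bounded_density_integrable[OF glued[OF zero \<psi>] int]
      by simp
    also have "\<dots> \<ge> (LINT \<omega>|N. (indicator (A j) \<omega> *\<^sub>R norm (z (m j) \<omega>)) / 2)"
    proof (rule integral_mono)
      show "integrable N (\<lambda>\<omega>. (indicator (A j) \<omega> *\<^sub>R norm (z (m j) \<omega>)) / 2)" using set_int[OF A] by simp
      show "integrable N (\<lambda>\<omega>. blinfun_apply (?a \<omega>) (z (m j) \<omega>) - blinfun_apply (?b \<omega>) (z (m j) \<omega>))"
        using bounded_density_integrable[OF glued[OF \<theta> \<psi>] int] bounded_density_integrable[OF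
          glued[OF zero \<psi>] int]
        by simp
      show "(indicator (A j) \<omega> *\<^sub>R norm (z (m j) \<omega>)) / 2 \<le>
          blinfun_apply (?a \<omega>) (z (m j) \<omega>) - blinfun_apply (?b \<omega>) (z (m j) \<omega>)" for \<omega>
        using \<theta>_ge[of j \<omega>] by (simp add: glued_def)
    qed
    finally have "(LINT \<omega>:A j|N. norm (z (m j) \<omega>)) / 2 \<le> T j ?a - T j ?b"
      by (simp add: set_lebesgue_integral_def)
    with A_large[of j] have "\<epsilon> / 4 \<le> \<bar>T j ?a\<bar> \<or> \<epsilon> / 4 \<le> \<bar>T j ?b\<bar>" by linarith
    moreover have "\<forall>\<omega>. \<omega> \<notin> A j \<longrightarrow> glued j \<phi> \<psi> \<omega> = \<psi> \<omega>" for \<phi> by (simp add: glued_def)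
    ultimately show "\<exists>\<psi>'. bounded_density N 1 \<psi>' \<and> (\<epsilon> / 4 \<le> \<bar>T j \<psi>'\<bar> \<and> (\<forall>\<omega>. \<omega> \<notin> A j \<longrightarrow> \<psi>' \<omega> = \<psi> \<omega>))"
      using glued[OF \<theta> \<psi>] glued[OF zero \<psi>] by metis
  qed
  then obtain \<Psi> where \<Psi>: "\<And>j. bounded_density N 1 (\<Psi> j)" "\<And>j. \<epsilon> / 4 \<le> \<bar>T j (\<Psi> (Suc j))\<bar>"
    "\<And>j \<omega>. \<omega> \<notin> A j \<Longrightarrow> \<Psi> (Suc j) \<omega> = \<Psi> j \<omega>" by blast
  have stable: "\<Psi> n \<omega> = \<Psi> k \<omega>" if "\<And>i. k \<le> i \<Longrightarrow> \<omega> \<notin> A i" "k \<le> n" for n k \<omega>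
    using that(2) by (induction n rule: dec_induct) (use that(1) \<Psi>(3) in auto)
  define Q where "Q = {\<omega> \<in> space N. \<exists>k. \<forall>i\<ge>k. \<omega> \<notin> A i}"
  have Q [measurable]: "Q \<in> sets N" unfolding Q_def by measurable
  define \<psi> where "\<psi> \<omega> = (if \<omega> \<in> Q then \<Psi> (LEAST k. \<forall>i\<ge>k. \<omega> \<notin> A i) \<omega> else 0)" for \<omega>
  have \<psi>_eq: "\<psi> \<omega> = \<Psi> k \<omega>" if k: "\<And>i. k \<le> i \<Longrightarrow> \<omega> \<notin> A i" and \<omega>: "\<omega> \<in> space N" for k \<omega>
  proof -
    define l where "l = (LEAST k. \<forall>i\<ge>k. \<omega> \<notin> A i)"
    have "\<forall>i\<ge>k. \<omega> \<notin> A i" using k by blast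
    then have l: "\<forall>i\<ge>l. \<omega> \<notin> A i" "l \<le> k" unfolding l_def by (rule LeastI, rule Least_le)
    have "\<Psi> k \<omega> = \<Psi> l \<omega>" by (rule stable[OF _ l(2)]) (use l(1) in blast)
    moreover have "\<omega> \<in> Q" using k \<omega> by (auto simp: Q_def)
    ultimately show ?thesis by (simp add: \<psi>_def l_def)
  qed
  have \<psi>: "bounded_density N 1 \<psi>"
    unfolding bounded_density_def
  proof (intro conjI allI)
    show "norm (\<psi> \<omega>) \<le> 1" for \<omega> using \<Psi>(1) by (auto simp: \<psi>_def bounded_density_def)
    have \<Psi>_meas [measurable]: "(\<lambda>\<omega>. blinfun_apply (\<Psi> k \<omega>) b) \<in> borel_measurable N" for k b
      using \<Psi>(1) by (auto simp: bounded_density_def)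
    have [measurable]: "(\<lambda>\<omega>. LEAST k. \<forall>i\<ge>k. \<omega> \<notin> A i) \<in> measurable N (count_space UNIV)"
      by measurable
    show "(\<lambda>\<omega>. blinfun_apply (\<psi> \<omega>) b) \<in> borel_measurable N" for b
    proof -
      have meas: "(\<lambda>\<omega>. blinfun_apply (\<Psi> (LEAST k. \<forall>i\<ge>k. \<omega> \<notin> A i) \<omega>) b) \<in> borel_measurable N"
        by (rule measurable_compose_countable[where f =
          "\<lambda>k \<omega>. blinfun_apply (\<Psi> k \<omega>) b", OF \<Psi>_meas]) fact
      have "(\<lambda>\<omega>. blinfun_apply (\<psi> \<omega>) b) =
          (\<lambda>\<omega>. if \<omega> \<in> Q then blinfun_apply (\<Psi> (LEAST k. \<forall>i\<ge>k. \<omega> \<notin> A i) \<omega>) b else 0)"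
        by (simp add: \<psi>_def fun_eq_iff)
      also have "\<dots> \<in> borel_measurable N"
        by (rule measurable_If_set[OF meas]) (use Q in \<open>auto intro: sets.Int\<close>)
      finally show ?thesis .
    qed
  qed
  have large: "\<epsilon> / 8 \<le> \<bar>LINT \<omega>|N. blinfun_apply (\<psi> \<omega>) (z (m j) \<omega>)\<bar>" for j
  proof -
    let ?R = "\<Union>i. A (i + Suc j)"
    let ?p = "\<Psi> (Suc j)"
    have "(LINT \<omega>:?R|N. norm (z (m j) \<omega>)) \<le> \<epsilon> / 16"
    proof (rule set_integral_Union_le)
      show "(LINT \<omega>:A (i + Suc j)|N. norm (z (m j) \<omega>)) \<le> \<epsilon> / 16 * (1 / 2) ^ Suc i" for i
      proof -
        have "(1 / 2 :: real) ^ (i + Suc j) \<le> (1 / 2) ^ Suc i" by (rule power_decreasing) auto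
        then have "\<rho> (i + Suc j) \<le> \<epsilon> / 16 * (1 / 2) ^ Suc i"
          unfolding \<rho>_def by (rule mult_left_mono) (use \<epsilon> in simp)
        then show ?thesis using A_small[of j "i + Suc j"] by linarith
      qed
      show "(\<lambda>i. \<epsilon> / 16 * (1 / 2) ^ Suc i) sums (\<epsilon> / 16)"
        using sums_mult[OF power_half_series, of "\<epsilon> / 16"] by simp
    qed auto
    moreover have "\<bar>T j \<psi> - T j ?p\<bar> \<le> 2 * (LINT \<omega>:?R|N. norm (z (m j) \<omega>))"
    proof -
      note ints = bounded_density_integrable[OF \<psi> int] bounded_density_integrable[OF \<Psi>(1) int]
      have R: "?R \<in> sets N" by measurable
      have "T j \<psi> - T j ?p = (LINT \<omega>|N. blinfun_apply (\<psi> \<omega>) (z (m j) \<omega>)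
        - blinfun_apply (?p \<omega>) (z (m j) \<omega>))"
        unfolding T_def using ints by simp
      also have "\<bar>\<dots>\<bar> \<le> (LINT \<omega>|N. 2 * (indicator ?R \<omega> *\<^sub>R norm (z (m j) \<omega>)))"
      proof (rule integral_abs_bound[THEN order_trans], rule integral_mono)
        show "integrable N (\<lambda>\<omega>. \<bar>blinfun_apply (\<psi> \<omega>) (z (m j) \<omega>) - blinfun_apply (?p \<omega>) (z (m j) \<omega>)\<bar>)"
          using ints by simp
        show "integrable N (\<lambda>\<omega>. 2 * (indicator ?R \<omega> *\<^sub>R norm (z (m j) \<omega>)))"
          using set_int[OF R] by (rule integrable_mult_right)
        fix \<omega> assume \<omega>: "\<omega> \<in> space N"
        show "\<bar>blinfun_apply (\<psi> \<omega>) (z (m j) \<omega>) - blinfun_apply (?p \<omega>) (z (m j) \<omega>)\<bar>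
            \<le> 2 * (indicator ?R \<omega> *\<^sub>R norm (z (m j) \<omega>))"
        proof (cases "\<omega> \<in> ?R")
          case True
          then show ?thesis
            using bounded_density_apply_le[OF \<psi>, of \<omega> "z (m j) \<omega>"]
              bounded_density_apply_le[OF \<Psi>(1), of "Suc j" \<omega> "z (m j) \<omega>"]
                by (simp only: indicator_simps) simp
        next
          case False
          have "\<omega> \<notin> A i" if "Suc j \<le> i" for i
            using False that by (auto dest: le_Suc_ex simp: add.commute)
          then have "\<psi> \<omega> = ?p \<omega>" using \<omega> by (intro \<psi>_eq) auto
          with False show ?thesis by simp
        qed
      qed
      finally show ?thesis by (simp add: set_lebesgue_integral_def)
    qed
    ultimately show ?thesis using \<Psi>(2)[of j] unfolding T_def by linarith
  qed
  have "(\<lambda>n. LINT \<omega>|N. blinfun_apply (\<psi> \<omega>) (z n \<omega>)) \<longlonglongrightarrow> 0"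
    using null \<psi> by (auto simp: weakly_null_def)
  from LIMSEQ_subseq_LIMSEQ[OF this m_mono]
  have "(\<lambda>j. \<bar>LINT \<omega>|N. blinfun_apply (\<psi> \<omega>) (z (m j) \<omega>)\<bar>) \<longlonglongrightarrow> \<bar>0\<bar>"
    unfolding o_def by (rule tendsto_rabs)
  then have "\<epsilon> / 8 \<le> \<bar>0 :: real\<bar>" by (rule LIMSEQ_le_const) (use large in auto)
  then show False using \<epsilon> by simp
qed

section \<open>Pieces of a biting convergent sequence\<close>

lemma set_integral_restrict_space_subset:
  fixes g :: "'w \<Rightarrow> 'b::{banach, second_countable_topology}"
  assumes O: "P \<in> sets M" and A: "A \<subseteq> P"
  shows "(LINT \<omega>:A|restrict_space M P. g \<omega>) = (LINT \<omega>:A|M. g \<omega>)"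
proof -
  have "(\<lambda>\<omega>. indicator P \<omega> *\<^sub>R indicator A \<omega> *\<^sub>R g \<omega>) = (\<lambda>\<omega>. indicator A \<omega> *\<^sub>R g \<omega>)"
    using A by (auto simp: indicator_def fun_eq_iff)
  then show ?thesis
    unfolding set_lebesgue_integral_def using O by (simp only: integral_restrict_space
      sets.Int_space_eq2)
qed

lemma bounded_density_restrict_space:
  "bounded_density M C \<psi> \<Longrightarrow> bounded_density (restrict_space M P) C \<psi>"
  by (auto simp: bounded_density_def intro: measurable_restrict_space1)

context
  fixes M :: "'w measure" and P :: "'w set"
    and s :: "nat \<Rightarrow> 'w \<Rightarrow> 'b::{banach, second_countable_topology}" and u
  assumes P: "P \<in> sets M" and weak: "tendsto_weak_L1 (restrict_space M P) s u"
begin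

lemma tendsto_weak_L1_piece_dual:
  "\<Lambda> \<in> L1_dual (restrict_space M P) \<Longrightarrow> (\<lambda>n. \<Lambda> (s n)) \<longlonglongrightarrow> \<Lambda> u"
  using weak by (simp add: tendsto_weak_L1_def)

lemma tendsto_weak_L1_piece_integrable:
  "set_integrable M P (s n)" "set_integrable M P u"
  using weak P unfolding tendsto_weak_L1_def set_integrable_def
    by (auto simp: integrable_restrict_space)

lemma tendsto_weak_L1_piece_density:
  assumes \<psi>: "bounded_density M C \<psi>" and A: "A \<in> sets M" "A \<subseteq> P"
  shows "(\<lambda>n. LINT \<omega>:A|M. blinfun_apply (\<psi> \<omega>) (s n \<omega>)) \<longlonglongrightarrow> (LINT \<omega>:A|M. blinfun_apply (\<psi> \<omega>) (u \<omega>))"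
proof -
  let ?\<psi> = "\<lambda>\<omega>. if \<omega> \<in> A then \<psi> \<omega> else 0"
  have "bounded_density M C ?\<psi>"
    by (intro bounded_density_If \<psi> bounded_density_0 A(1) bounded_density_nonneg[OF \<psi>])
  then have "(\<lambda>v. LINT \<omega>|restrict_space M P. blinfun_apply (?\<psi> \<omega>) (v \<omega>)) \<in> L1_dual (restrict_space M P)"
    by (intro bounded_density_L1_dual bounded_density_restrict_space)
  then have lim: "(\<lambda>n. LINT \<omega>|restrict_space M P. blinfun_apply (?\<psi> \<omega>) (s n \<omega>)) \<longlonglongrightarrow>
      (LINT \<omega>|restrict_space M P. blinfun_apply (?\<psi> \<omega>) (u \<omega>))"
    by (rule tendsto_weak_L1_piece_dual)
  have "(LINT \<omega>|restrict_space M P. blinfun_apply (?\<psi> \<omega>) (v \<omega>)) =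
    (LINT \<omega>:A|M. blinfun_apply (\<psi> \<omega>) (v \<omega>))"
    for v :: "'w \<Rightarrow> 'b"
    unfolding set_integral_restrict_space_subset[OF P A(2), symmetric]
    unfolding set_lebesgue_integral_def
    by (intro Bochner_Integration.integral_cong) (auto simp: indicator_def)
  with lim show ?thesis by simp
qed

lemma tendsto_weak_L1_piece_weakly_null:
  "weakly_null (restrict_space M P) (\<lambda>n \<omega>. s n \<omega> - u \<omega>)"
  unfolding weakly_null_def
proof (intro conjI allI impI)
  let ?N = "restrict_space M P"
  have int: "integrable ?N (s n)" "integrable ?N u" for n using weak by (auto simp: tendsto_weak_L1_def)
  then show "integrable ?N (\<lambda>\<omega>. s n \<omega> - u \<omega>)" for n by simp
  fix C \<psi> assume \<psi>: "bounded_density ?N C (\<psi> :: 'w \<Rightarrow> 'b \<Rightarrow>\<^sub>L real)"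
  have "(\<lambda>n. (LINT \<omega>|?N. blinfun_apply (\<psi> \<omega>) (s n \<omega>)) - (LINT \<omega>|?N. blinfun_apply (\<psi> \<omega>) (u \<omega>))) \<longlonglongrightarrow> 0"
    unfolding LIM_zero_iff by (rule tendsto_weak_L1_piece_dual[OF bounded_density_L1_dual[OF \<psi>]])
  then show "(\<lambda>n. LINT \<omega>|?N. blinfun_apply (\<psi> \<omega>) (s n \<omega> - u \<omega>)) \<longlonglongrightarrow> 0"
    using bounded_density_integrable[OF \<psi> int(1)] bounded_density_integrable[OF \<psi> int(2)]
    by (simp add: blinfun.diff_right)
qed

lemma tendsto_weak_L1_piece_bounded:
  obtains C where "0 \<le> C" "\<And>n. (LINT \<omega>:P|M. norm (s n \<omega>)) \<le> C"
proof -
  let ?N = "restrict_space M P"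
  have int: "integrable ?N (s n)" "integrable ?N u" for n using weak by (auto simp: tendsto_weak_L1_def)
  obtain C where C: "\<And>n. (LINT \<omega>|?N. norm (s n \<omega> - u \<omega>)) \<le> C"
    using weakly_null_bounded[OF tendsto_weak_L1_piece_weakly_null] by blast
  have eq: "(LINT \<omega>:P|M. norm (s n \<omega>)) = (LINT \<omega>|?N. norm (s n \<omega>))" for n
    unfolding set_lebesgue_integral_def using P by (subst integral_restrict_space) auto
  have bound: "(LINT \<omega>:P|M. norm (s n \<omega>)) \<le> C + (LINT \<omega>|?N. norm (u \<omega>))" for n
  proof -
    have "(LINT \<omega>|?N. norm (s n \<omega>)) \<le> (LINT \<omega>|?N. norm (s n \<omega> - u \<omega>) + norm (u \<omega>))"
      using int by (intro integral_mono) (auto simp: norm_triangle_sub add.commute)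
    also have "\<dots> \<le> C + (LINT \<omega>|?N. norm (u \<omega>))" using int C[of n] by simp
    finally show ?thesis by (simp add: eq)
  qed
  have "0 \<le> (LINT \<omega>|?N. norm (s 0 \<omega>))" by simp
  then have "0 \<le> C + (LINT \<omega>|?N. norm (u \<omega>))" using bound[of 0] unfolding eq by (rule order_trans)
  then show ?thesis using that bound by blast
qed

lemma tendsto_weak_L1_piece_uniformly_absolutely_continuous:
  assumes \<epsilon>: "0 < \<epsilon>"
  obtains \<eta> where "0 < \<eta>" "\<And>n A. A \<in> sets M \<Longrightarrow> A \<subseteq> P \<Longrightarrow> emeasure M A \<le> ennreal \<eta> \<Longrightarrow>
    (LINT \<omega>:A|M. norm (s n \<omega>)) \<le> \<epsilon>"
proof -
  let ?N = "restrict_space M P"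
  have int: "integrable ?N (s n)" "integrable ?N u" for n using weak by (auto simp: tendsto_weak_L1_def)
  obtain \<eta>1 where \<eta>1: "0 < \<eta>1" "\<And>n A. A \<in> sets ?N \<Longrightarrow> emeasure ?N A \<le> ennreal \<eta>1 \<Longrightarrow>
      (LINT \<omega>:A|?N. norm (s n \<omega> - u \<omega>)) \<le> \<epsilon> / 2"
    using weakly_null_uniformly_absolutely_continuous[OF tendsto_weak_L1_piece_weakly_null, of
      "\<epsilon> / 2"] \<epsilon> by auto
  obtain \<eta>2 where \<eta>2: "0 < \<eta>2" "\<And>A. A \<in> sets ?N \<Longrightarrow> emeasure ?N A \<le> ennreal \<eta>2 \<Longrightarrow>
      (LINT \<omega>:A|?N. norm (u \<omega>)) \<le> \<epsilon> / 2"
    using integral_absolutely_continuous[of ?N "\<lambda>\<omega>. norm (u \<omega>)" "\<epsilon> / 2"] \<epsilon> int by auto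
  show ?thesis
  proof (rule that[of "min \<eta>1 \<eta>2"])
    show "0 < min \<eta>1 \<eta>2" using \<eta>1 \<eta>2 by simp
    fix n A assume A: "A \<in> sets M" "A \<subseteq> P" and small: "emeasure M A \<le> ennreal (min \<eta>1 \<eta>2)"
    have AN: "A \<in> sets ?N" using A P by (simp add: sets_restrict_space_iff)
    have eA: "emeasure ?N A = emeasure M A" using A P by (intro emeasure_restrict_space) auto
    have small': "emeasure ?N A \<le> ennreal \<eta>1" "emeasure ?N A \<le> ennreal \<eta>2"
      unfolding eA by (rule order_trans[OF small ennreal_leI], simp)+
    have si: "set_integrable ?N A g" if "integrable ?N g" for g :: "'w \<Rightarrow> real"
      unfolding set_integrable_def using AN that by (rule integrable_mult_indicator)
    have ints: "set_integrable ?N A (\<lambda>\<omega>. norm (s n \<omega>))" "set_integrable ?N A (\<lambda>\<omega>. norm (s n \<omega> - u \<omega>))"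
        "set_integrable ?N A (\<lambda>\<omega>. norm (u \<omega>))"
      by (rule si, use int in simp)+
    have "(LINT \<omega>:A|?N. norm (s n \<omega>)) \<le> (LINT \<omega>:A|?N. norm (s n \<omega> - u \<omega>) + norm (u \<omega>))"
      by (rule set_integral_mono) (use ints in \<open>auto simp: norm_triangle_sub add.commute\<close>)
    also have "\<dots> \<le> \<epsilon>" using ints \<eta>1(2)[OF AN small'(1), of n] \<eta>2(2)[OF AN small'(2)] by simp
    finally show "(LINT \<omega>:A|M. norm (s n \<omega>)) \<le> \<epsilon>"
      by (simp add: set_integral_restrict_space_subset[OF P A(2)])
  qed
qed

text \<open>The truncation used later: one level \<open>R\<close> makes both the measure of the set where the
  sequence exceeds \<open>R\<close> and the mass on it uniformly small. Markov's inequality gives the first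
  from boundedness in \<open>L\<^sub>1\<close>, and uniform absolute continuity gives the second.\<close>

lemma tendsto_weak_L1_piece_tails:
  assumes meas [measurable]: "\<And>n. s n \<in> borel_measurable M" and \<delta>: "0 < \<delta>"
  obtains R :: nat where "\<And>n. emeasure M {\<omega> \<in> P. real R < norm (s n \<omega>)} \<le> ennreal \<delta>"
    "\<And>n A. A \<in> sets M \<Longrightarrow> A \<subseteq> {\<omega> \<in> P. real R < norm (s n \<omega>)} \<Longrightarrow> (LINT \<omega>:A|M. norm (s n \<omega>)) \<le> \<delta>"
proof -
  obtain C where C: "0 \<le> C" "\<And>n. (LINT \<omega>:P|M. norm (s n \<omega>)) \<le> C"
    using tendsto_weak_L1_piece_bounded by blast
  obtain \<eta> where \<eta>: "0 < \<eta>" "\<And>n A. A \<in> sets M \<Longrightarrow> A \<subseteq> P \<Longrightarrow> emeasure M A \<le> ennreal \<eta> \<Longrightarrow>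
    (LINT \<omega>:A|M. norm (s n \<omega>)) \<le> \<delta>"
    using tendsto_weak_L1_piece_uniformly_absolutely_continuous[OF \<delta>] by blast
  define h where "h = min \<eta> \<delta>"
  have h: "0 < h" "h \<le> \<eta>" "h \<le> \<delta>" using \<eta> \<delta> by (auto simp: h_def)
  obtain R :: nat where R: "C / h + 1 < real R" using reals_Archimedean2 by blast
  then have R0: "0 < real R" using divide_nonneg_pos[OF C(1) h(1)] by linarith
  have Ch: "C / real R \<le> h"
  proof -
    have "C / h < real R" using R by simp
    then have "C \<le> h * real R" using h(1) by (simp add: field_simps)
    then show ?thesis using R0 by (simp add: field_simps)
  qed
  have Pm [measurable]: "P \<in> sets M" by (rule P)
  have set: "{\<omega> \<in> P. real R < norm (s n \<omega>)} \<in> sets M" for n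
  proof -
    have "{\<omega> \<in> P. real R < norm (s n \<omega>)} = P \<inter> {\<omega> \<in> space M. real R < norm (s n \<omega>)}"
      using sets.sets_into_space[OF P] by auto
    also have "\<dots> \<in> sets M" by measurable
    finally show ?thesis .
  qed
  have small: "emeasure M {\<omega> \<in> P. real R < norm (s n \<omega>)} \<le> ennreal h" for n
  proof -
    have "emeasure M {\<omega> \<in> P. real R < norm (s n \<omega>)} \<le>
        emeasure M {\<omega> \<in> space M. real R \<le> indicator P \<omega> *\<^sub>R norm (s n \<omega>)}"
      using sets.sets_into_space[OF P] by (intro emeasure_mono) auto
    also have "\<dots> \<le> ennreal ((1 / real R) * (LINT \<omega>:P|M. norm (s n \<omega>)))"
      unfolding set_lebesgue_integral_def
    proof (rule integral_Markov_inequality)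
      show "integrable M (\<lambda>\<omega>. indicator P \<omega> *\<^sub>R norm (s n \<omega>))"
        using integrable_norm[OF tendsto_weak_L1_piece_integrable(1)[of n, unfolded
          set_integrable_def]] by simp
    qed (use R0 in auto)
    also have "\<dots> \<le> ennreal h"
    proof (rule ennreal_leI)
      have "(1 / real R) * (LINT \<omega>:P|M. norm (s n \<omega>)) \<le> (1 / real R) * C"
        using C(2)[of n] by (rule mult_left_mono) simp
      with Ch show "(1 / real R) * (LINT \<omega>:P|M. norm (s n \<omega>)) \<le> h" by simp
    qed
    finally show ?thesis .
  qed
  show ?thesis
  proof (rule that[of R])
    show "emeasure M {\<omega> \<in> P. real R < norm (s n \<omega>)} \<le> ennreal \<delta>" for n
      using small[of n] ennreal_leI[OF h(3)] by (rule order_trans)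
    fix n A assume A: "A \<in> sets M" "A \<subseteq> {\<omega> \<in> P. real R < norm (s n \<omega>)}"
    have "emeasure M A \<le> ennreal h" using emeasure_mono[OF A(2) set] small[of n] by (rule order_trans)
    then show "(LINT \<omega>:A|M. norm (s n \<omega>)) \<le> \<delta>"
      using A ennreal_leI[OF h(2)] by (intro \<eta>(2)) auto
  qed
qed

end

lemma incseq_cover_emeasure_Diff_small:
  assumes W: "W \<in> sets M" "emeasure M W < \<infinity>" and G: "incseq G" "\<And>k. G k \<in> sets M"
    and cover: "AE \<omega> in M. \<omega> \<in> W \<longrightarrow> \<omega> \<in> (\<Union>k. G k)" and \<eta>: "0 < \<eta>"
  obtains k where "emeasure M (W - G k) \<le> ennreal \<eta>"
proof -
  have "(\<lambda>k. emeasure M (W - G k)) \<longlonglongrightarrow> emeasure M (\<Inter>k. W - G k)"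
  proof (rule Lim_emeasure_decseq)
    show "range (\<lambda>k. W - G k) \<subseteq> sets M" using W G by auto
    show "decseq (\<lambda>k. W - G k)" using G(1) by (auto simp: incseq_def decseq_def)
    show "emeasure M (W - G k) \<noteq> \<infinity>" for k
      using emeasure_mono[of "W - G k" W M] W by (auto simp: top_unique)
  qed
  moreover have "emeasure M (\<Inter>k. W - G k) = 0"
  proof -
    have "W - (\<Union>k. G k) \<in> null_sets M"
    proof -
      have "{\<omega> \<in> space M. \<not> (\<omega> \<in> W \<longrightarrow> \<omega> \<in> (\<Union>k. G k))} = W - (\<Union>k. G k)"
        using sets.sets_into_space[OF W(1)] by auto
      moreover have "W - (\<Union>k. G k) \<in> sets M" using W G(2) by auto
      ultimately show ?thesis using cover AE_iff_null[of M "\<lambda>\<omega>. \<omega> \<in> W \<longrightarrow> \<omega> \<in> (\<Union>k. G k)"] by simp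
    qed
    moreover have "(\<Inter>k. W - G k) = W - (\<Union>k. G k)" by auto
    ultimately show ?thesis by (simp add: null_setsD1)
  qed
  ultimately have "\<forall>\<^sub>F k in sequentially. emeasure M (W - G k) < ennreal \<eta>"
    using \<eta> by (intro order_tendstoD) auto
  then show ?thesis using that by (auto simp: eventually_sequentially intro: less_imp_le)
qed

section \<open>Integrating affine minorants\<close>

text \<open>A pair \<open>(\<phi>, c)\<close> stands for the continuous affine function \<open>\<phi> - c\<close>, so that the product norm
  bounds slope and constant at the same time.\<close>

abbreviation affine_val :: "('b::real_normed_vector \<Rightarrow>\<^sub>L real) \<times> real \<Rightarrow> 'b \<Rightarrow> real" where
  "affine_val a b \<equiv> blinfun_apply (fst a) b - snd a"

lemma borel_measurable_affine_val [measurable]: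
  fixes u :: "'w \<Rightarrow> 'b::real_normed_vector"
  assumes [measurable]: "u \<in> borel_measurable M"
  shows "(\<lambda>\<omega>. affine_val a (u \<omega>)) \<in> borel_measurable M"
proof -
  have "blinfun_apply (fst a) \<in> borel_measurable borel"
    by (intro borel_measurable_continuous_onI continuous_intros)
  then show ?thesis by measurable
qed

lemma affine_val_ge: "- norm a * (norm b + 1) \<le> affine_val a b"
  and affine_val_le: "affine_val a b \<le> norm a * (norm b + 1)"
proof -
  have "\<bar>blinfun_apply (fst a) b\<bar> \<le> norm (fst a) * norm b" using norm_blinfun[of "fst a" b] by simp
  also have "\<dots> \<le> norm a * norm b" using norm_fst_le[of "fst a" "snd a"] by (intro mult_right_mono) auto
  finally have "\<bar>blinfun_apply (fst a) b\<bar> \<le> norm a * norm b" .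
  moreover have "\<bar>snd a\<bar> \<le> norm a" using norm_snd_le[of "snd a" "fst a"] by simp
  ultimately show "- norm a * (norm b + 1) \<le> affine_val a b" "affine_val a b \<le> norm a * (norm b + 1)"
    by (auto simp: algebra_simps)
qed

lemma set_integrable_of_integrable:
  fixes g :: "'w \<Rightarrow> real"
  assumes "integrable M g" "A \<in> sets M"
  shows "set_integrable M A g"
  unfolding set_integrable_def using assms(2,1) by (rule integrable_mult_indicator)

lemma set_integrable_bounded:
  fixes g :: "'w \<Rightarrow> real"
  assumes "g \<in> borel_measurable M" "A \<in> sets M" "emeasure M A < \<infinity>" "\<And>\<omega>. \<omega> \<in> A \<Longrightarrow> \<bar>g \<omega>\<bar> \<le> B"
  shows "set_integrable M A g"
proof -
  have "set_integrable M A (\<lambda>_. B)"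
    unfolding set_integrable_def using assms(2,3) by simp
  then show ?thesis
  proof (rule set_integrable_bound)
    show "set_borel_measurable M A g" using assms(1,2) by (simp add: set_borel_measurable_def)
    show "AE \<omega> in M. \<omega> \<in> A \<longrightarrow> norm (g \<omega>) \<le> norm B" using assms(4) by (intro AE_I2) force
  qed
qed

lemma set_integral_Diff_split:
  fixes g :: "'w \<Rightarrow> real"
  assumes "set_integrable M W g" "G \<in> sets M" "G \<subseteq> W" "W \<in> sets M"
  shows "(LINT \<omega>:W|M. g \<omega>) = (LINT \<omega>:G|M. g \<omega>) + (LINT \<omega>:W - G|M. g \<omega>)"
proof -
  have "(LINT \<omega>:G \<union> (W - G)|M. g \<omega>) = (LINT \<omega>:G|M. g \<omega>) + (LINT \<omega>:W - G|M. g \<omega>)"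
    by (rule set_integral_Un) (use assms in \<open>auto intro: set_integrable_subset\<close>)
  moreover have "G \<union> (W - G) = W" using assms by auto
  ultimately show ?thesis by simp
qed

text \<open>The order of quantifiers in \<open>minorants\<close> is essential: the bound \<open>L\<close> on the minorants does
  not depend on the truncation level \<open>R\<close>. So one first restricts to a set on which \<open>L\<close> is
  constant, then chooses \<open>R\<close> so large that \<open>L\<close> times the mass of \<open>y n\<close> above level \<open>R\<close> is
  negligible, and only then selects the minorants for this \<open>R\<close>, as the first admissible pair
  \<open>(j, m)\<close>. On a slightly smaller set \<open>G\<close> also \<open>m\<close> is bounded, and \<open>r n\<close> is at least the minorant
  at \<open>y n\<close> up to an error that lives where \<open>norm (y n) > R\<close>. The integrals of the minorants
  converge because their slopes form a bounded density, and off \<open>G\<close> the negative parts of \<open>r n\<close>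
  are uniformly small.\<close>

lemma affine_minorants_imp_eventually_set_integral_ge:
  fixes y :: "nat \<Rightarrow> 'w \<Rightarrow> 'b::{banach, second_countable_topology}"
    and \<alpha> :: "nat \<Rightarrow> ('b \<Rightarrow>\<^sub>L real) \<times> real" and r :: "nat \<Rightarrow> 'w \<Rightarrow> real"
  assumes W: "W \<in> sets M" "emeasure M W < \<infinity>"
    and y [measurable]: "\<And>n. y n \<in> borel_measurable M" and y0 [measurable]: "y0 \<in> borel_measurable M"
    and biting: "tendsto_biting M y y0"
    and r: "\<And>n. integrable M (r n)"
    and uac: "\<And>\<epsilon>. 0 < \<epsilon> \<Longrightarrow> \<exists>\<eta>>0. \<forall>n. \<forall>A\<in>sets M. emeasure M A \<le> ennreal \<eta> \<longrightarrow>
      (LINT \<omega>:A|M. max (- r n \<omega>) 0) \<le> \<epsilon>"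
    and t [measurable]: "t \<in> borel_measurable M" and tB: "\<And>\<omega>. \<bar>t \<omega>\<bar> \<le> B"
    and minorants: "AE \<omega> in M. \<omega> \<in> W \<longrightarrow> (\<exists>L :: nat. \<forall>R :: nat. \<exists>j m. norm (\<alpha> j) \<le> real L \<and>
      t \<omega> \<le> affine_val (\<alpha> j) (y0 \<omega>) \<and> (\<forall>n\<ge>m. norm (y n \<omega>) \<le> real R \<longrightarrow> affine_val (\<alpha> j) (y n \<omega>) \<le> r n \<omega>))"
    and \<epsilon>: "0 < \<epsilon>"
  shows "\<forall>\<^sub>F n in sequentially. (LINT \<omega>:W|M. t \<omega>) - \<epsilon> \<le> (LINT \<omega>:W|M. r n \<omega>)"
proof -
  have [measurable]: "r n \<in> borel_measurable M" for n using r by (rule borel_measurable_integrable)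
  have Wm [measurable]: "W \<in> sets M" by (rule W(1))
  have W_sub: "\<omega> \<in> space M" if "\<omega> \<in> W" for \<omega> using that sets.sets_into_space[OF W(1)] by auto
  have B: "0 \<le> B" using tB[of undefined] by linarith
  have neg_int: "integrable M (\<lambda>\<omega>. max (- r n \<omega>) 0)" for n using r by simp
  define e where "e = \<epsilon> / 6"
  have e: "0 < e" using \<epsilon> by (simp add: e_def)
  obtain P where P: "incseq P" "range P \<subseteq> sets M" "AE \<omega> in M. \<omega> \<in> (\<Union>k. P k)"
    and weak: "\<And>k. tendsto_weak_L1 (restrict_space M (P k)) y y0"
    using biting unfolding tendsto_biting_def by blast
  have Pm [measurable]: "P k \<in> sets M" for k using P(2) by auto
  define good where "good L R i \<omega> \<longleftrightarrow> (case prod_decode i of (j, m) \<Rightarrow> norm (\<alpha> j) \<le> real L \<and>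
      t \<omega> \<le> affine_val (\<alpha> j) (y0 \<omega>) \<and> (\<forall>n\<ge>m. norm (y n \<omega>) \<le> real R \<longrightarrow> affine_val (\<alpha> j) (y n \<omega>) \<le> r n \<omega>))"
    for L R :: nat and i \<omega>
  have [measurable]: "Measurable.pred M (good L R i)" for L R i
    unfolding good_def by (cases "prod_decode i") (simp, measurable)
  define H where "H L = {\<omega> \<in> space M. \<forall>R. \<exists>i. good L R i \<omega>}" for L
  have Hm [measurable]: "H L \<in> sets M" for L unfolding H_def by measurable
  have good_mono: "good L R i \<omega> \<Longrightarrow> L \<le> L' \<Longrightarrow> good L' R i \<omega>" for L L' R i \<omega>
    unfolding good_def by (auto split: prod.splits)
  have H_mono: "incseq H" unfolding incseq_def H_def using good_mono by blast
  have H_cover: "AE \<omega> in M. \<omega> \<in> W \<longrightarrow> \<omega> \<in> (\<Union>L. H L)"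
    using minorants
  proof eventually_elim
    case (elim \<omega>)
    show ?case
    proof
      assume \<omega>: "\<omega> \<in> W"
      with elim obtain L :: nat where L: "\<And>R :: nat. \<exists>j m. norm (\<alpha> j) \<le> real L \<and>
        t \<omega> \<le> affine_val (\<alpha> j) (y0 \<omega>) \<and> (\<forall>n\<ge>m. norm (y n \<omega>) \<le> real R \<longrightarrow>
          affine_val (\<alpha> j) (y n \<omega>) \<le> r n \<omega>)"
        by blast
      have "\<exists>i. good L R i \<omega>" for R
      proof -
        from L[of R] obtain j m where jm: "norm (\<alpha> j) \<le> real L \<and>
          t \<omega> \<le> affine_val (\<alpha> j) (y0 \<omega>) \<and> (\<forall>n\<ge>m. norm (y n \<omega>) \<le> real R \<longrightarrow>
            affine_val (\<alpha> j) (y n \<omega>) \<le> r n \<omega>)"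
          by blast
        show ?thesis by (rule exI[of _ "prod_encode (j, m)"]) (use jm in \<open>simp add: good_def\<close>)
      qed
      then have "\<omega> \<in> H L" using W_sub[OF \<omega>] by (simp add: H_def)
      then show "\<omega> \<in> (\<Union>L. H L)" by blast
    qed
  qed
  obtain \<eta>1 where \<eta>1: "0 < \<eta>1" "\<And>n A. A \<in> sets M \<Longrightarrow> emeasure M A \<le> ennreal \<eta>1 \<Longrightarrow>
      (LINT \<omega>:A|M. max (- r n \<omega>) 0) \<le> e"
    using uac[OF e] by blast
  define \<eta> where "\<eta> = min \<eta>1 (e / (B + 1))"
  have \<eta>: "0 < \<eta>" "\<eta> \<le> \<eta>1" "B * \<eta> \<le> e"
  proof -
    show "0 < \<eta>" "\<eta> \<le> \<eta>1" using \<eta>1 e B by (auto simp: \<eta>_def)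
    have "B * \<eta> \<le> B * (e / (B + 1))" using B by (intro mult_left_mono) (auto simp: \<eta>_def)
    also have "\<dots> \<le> e" using B e by (simp add: field_simps)
    finally show "B * \<eta> \<le> e" .
  qed
  obtain k where k: "emeasure M (W - (H k \<inter> P k)) \<le> ennreal (\<eta> / 2)"
  proof (rule incseq_cover_emeasure_Diff_small[OF W, of "\<lambda>k. H k \<inter> P k" "\<eta> / 2"])
    show "incseq (\<lambda>k. H k \<inter> P k)" using H_mono P(1) unfolding incseq_def by blast
    show "AE \<omega> in M. \<omega> \<in> W \<longrightarrow> \<omega> \<in> (\<Union>k. H k \<inter> P k)"
      using H_cover P(3)
    proof eventually_elim
      case (elim \<omega>)
      show ?case
      proof
        assume "\<omega> \<in> W"
        with elim obtain a b where "\<omega> \<in> H a" "\<omega> \<in> P b" by blast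
        then have "\<omega> \<in> H (max a b) \<inter> P (max a b)"
          using incseqD[OF H_mono, of a "max a b"] incseqD[OF P(1), of b "max a b"] by auto
        then show "\<omega> \<in> (\<Union>k. H k \<inter> P k)" by blast
      qed
    qed
  qed (use \<eta> in auto)
  define K where "K = real k + 1"
  have K: "1 \<le> K" "real k \<le> K" by (auto simp: K_def)
  \<comment> \<open>the bound on the slopes is fixed before the truncation level of the sequence\<close>
  define \<delta> where "\<delta> = min \<eta>1 (e / K)"
  have \<delta>: "0 < \<delta>" "\<delta> \<le> \<eta>1" "K * \<delta> \<le> e"
  proof -
    show "0 < \<delta>" "\<delta> \<le> \<eta>1" using \<eta>1 e K by (auto simp: \<delta>_def)
    have "K * \<delta> \<le> K * (e / K)" using K by (intro mult_left_mono) (auto simp: \<delta>_def)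
    then show "K * \<delta> \<le> e" using K by simp
  qed
  obtain R :: nat where R: "\<And>n. emeasure M {\<omega> \<in> P k. real R < norm (y n \<omega>)} \<le> ennreal \<delta>"
    "\<And>n A. A \<in> sets M \<Longrightarrow> A \<subseteq> {\<omega> \<in> P k. real R < norm (y n \<omega>)} \<Longrightarrow> (LINT \<omega>:A|M. norm (y n \<omega>)) \<le> \<delta>"
    using tendsto_weak_L1_piece_tails[OF Pm weak y \<delta>(1)] by blast
  define J where "J \<omega> = (LEAST i. good k R i \<omega>)" for \<omega>
  have J [measurable]: "J \<in> measurable M (count_space UNIV)" unfolding J_def by measurable
  have good_J: "good k R (J \<omega>) \<omega>" if "\<omega> \<in> H k" for \<omega>
    unfolding J_def by (rule LeastI_ex) (use that in \<open>auto simp: H_def\<close>)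
  define a where "a \<omega> = \<alpha> (fst (prod_decode (J \<omega>)))" for \<omega>
  define m where "m \<omega> = snd (prod_decode (J \<omega>))" for \<omega>
  have m_meas [measurable]: "m \<in> measurable M (count_space UNIV)"
    unfolding m_def by (rule measurable_compose[OF J]) simp
  have a: "norm (a \<omega>) \<le> real k" "t \<omega> \<le> affine_val (a \<omega>) (y0 \<omega>)"
      "\<And>n. m \<omega> \<le> n \<Longrightarrow> norm (y n \<omega>) \<le> real R \<Longrightarrow> affine_val (a \<omega>) (y n \<omega>) \<le> r n \<omega>" if "\<omega> \<in> H k" for \<omega>
    using good_J[OF that] unfolding good_def a_def m_def by (auto split: prod.splits)
  define W' where "W' = W \<inter> H k \<inter> P k"
  have W'm [measurable]: "W' \<in> sets M" unfolding W'_def by measurable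
  have W'_fin: "emeasure M W' < \<infinity>"
    using emeasure_mono[of W' W M] W by (auto simp: W'_def intro: order_le_less_trans)
  obtain m0 where m0: "emeasure M (W' - {\<omega> \<in> space M. m \<omega> \<le> m0}) \<le> ennreal (\<eta> / 2)"
  proof (rule incseq_cover_emeasure_Diff_small[OF W'm W'_fin, of "\<lambda>m0. {\<omega> \<in> space M. m \<omega> \<le> m0}"
    "\<eta> / 2"])
    show "incseq (\<lambda>m0. {\<omega> \<in> space M. m \<omega> \<le> m0})" by (auto simp: incseq_def)
    show "AE \<omega> in M. \<omega> \<in> W' \<longrightarrow> \<omega> \<in> (\<Union>m0. {\<omega> \<in> space M. m \<omega> \<le> m0})" by (rule AE_I2) auto
  qed (use \<eta> in auto)
  define G where "G = W' \<inter> {\<omega> \<in> space M. m \<omega> \<le> m0}"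
  have Gm [measurable]: "G \<in> sets M" unfolding G_def by measurable
  have G_sub: "G \<subseteq> W" "G \<subseteq> H k" "G \<subseteq> P k" by (auto simp: G_def W'_def)
  have G_fin: "emeasure M G < \<infinity>"
    using emeasure_mono[OF G_sub(1) W(1)] W(2) by (rule order_le_less_trans)
  have WG: "emeasure M (W - G) \<le> ennreal \<eta>"
  proof -
    have "emeasure M (W - G) \<le> emeasure M ((W - (H k \<inter> P k)) \<union> (W' - {\<omega> \<in> space M. m \<omega> \<le> m0}))"
      by (rule emeasure_mono) (auto simp: G_def W'_def)
    also have "\<dots> \<le> emeasure M (W - (H k \<inter> P k)) + emeasure M (W' - {\<omega> \<in> space M. m \<omega> \<le> m0})"
      by (rule emeasure_subadditive) auto
    also have "\<dots> \<le> ennreal (\<eta> / 2) + ennreal (\<eta> / 2)" using k m0 by (rule add_mono)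
    also have "\<dots> = ennreal \<eta>" using \<eta> by (simp flip: ennreal_plus)
    finally show ?thesis .
  qed
  have WG_meas: "measure M (W - G) \<le> \<eta>"
    using WG \<eta>(1) by (simp add: measure_def enn2real_leI)
  define \<psi> where "\<psi> \<omega> = (if \<omega> \<in> G then fst (a \<omega>) else 0)" for \<omega>
  define c where "c \<omega> = (if \<omega> \<in> G then snd (a \<omega>) else 0)" for \<omega>
  have c [measurable]: "c \<in> borel_measurable M"
  proof -
    have "(\<lambda>\<omega>. snd (\<alpha> (fst (prod_decode (J \<omega>))))) \<in> borel_measurable M"
      by (rule measurable_compose[OF J]) simp
    then show ?thesis unfolding c_def a_def by measurable
  qed
  have c_le: "\<bar>c \<omega>\<bar> \<le> K" for \<omega>
    using norm_snd_le[of "snd (a \<omega>)" "fst (a \<omega>)"] a(1)[of \<omega>] G_sub K by (auto simp: c_def)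
  have \<psi>: "bounded_density M K \<psi>"
    unfolding bounded_density_def
  proof (intro conjI allI)
    show "norm (\<psi> \<omega>) \<le> K" for \<omega>
      using norm_fst_le[of "fst (a \<omega>)" "snd (a \<omega>)"] a(1)[of \<omega>] G_sub K by (auto simp: \<psi>_def)
    show "(\<lambda>\<omega>. blinfun_apply (\<psi> \<omega>) b) \<in> borel_measurable M" for b
    proof -
      have meas: "(\<lambda>\<omega>. blinfun_apply (fst (\<alpha> (fst (prod_decode (J \<omega>))))) b) \<in> borel_measurable M"
        by (rule measurable_compose[OF J]) simp
      have "(\<lambda>\<omega>. blinfun_apply (\<psi> \<omega>) b) = (\<lambda>\<omega>. if \<omega> \<in> G then blinfun_apply (fst (\<alpha> (fst (prod_decode
        (J \<omega>))))) b else 0)"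
        by (simp add: \<psi>_def a_def fun_eq_iff)
      also have "\<dots> \<in> borel_measurable M" using meas by measurable
      finally show ?thesis .
    qed
  qed
  have y_int: "set_integrable M G (\<lambda>\<omega>. norm (u \<omega>))" "set_integrable M G (\<lambda>\<omega>. blinfun_apply (\<psi> \<omega>) (u \<omega>))"
    if "set_integrable M (P k) u" for u :: "'w \<Rightarrow> 'b"
  proof -
    have u: "integrable M (\<lambda>\<omega>. indicator G \<omega> *\<^sub>R u \<omega>)"
      using set_integrable_subset[OF that Gm G_sub(3)] by (simp add: set_integrable_def)
    show "set_integrable M G (\<lambda>\<omega>. norm (u \<omega>))"
      using integrable_norm[OF u] by (simp add: set_integrable_def)
    show "set_integrable M G (\<lambda>\<omega>. blinfun_apply (\<psi> \<omega>) (u \<omega>))"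
      using bounded_density_integrable[OF \<psi> u] by (simp add: set_integrable_def blinfun.scaleR_right)
  qed
  note yn_int = y_int[OF tendsto_weak_L1_piece_integrable(1)[OF Pm weak]]
  note y0_int = y_int[OF tendsto_weak_L1_piece_integrable(2)[OF Pm weak]]
  have c_int: "set_integrable M G c"
    by (rule set_integrable_bounded[OF c Gm G_fin c_le])
  have t_int: "set_integrable M W t"
    by (rule set_integrable_bounded[OF t W tB])
  have r_int: "set_integrable M A (r n)" "set_integrable M A (\<lambda>\<omega>. max (- r n \<omega>) 0)" if
    "A \<in> sets M" for A n
    using set_integrable_of_integrable that r neg_int by blast+
  have "(\<lambda>n. LINT \<omega>:G|M. blinfun_apply (\<psi> \<omega>) (y n \<omega>)) \<longlonglongrightarrow> (LINT \<omega>:G|M. blinfun_apply (\<psi> \<omega>) (y0 \<omega>))"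
    by (rule tendsto_weak_L1_piece_density[OF Pm weak \<psi> Gm G_sub(3)])
  then have "\<forall>\<^sub>F n in sequentially. (LINT \<omega>:G|M. blinfun_apply (\<psi> \<omega>) (y0 \<omega>)) - e <
    (LINT \<omega>:G|M. blinfun_apply (\<psi> \<omega>) (y n \<omega>))"
    by (rule order_tendstoD) (use e in simp)
  moreover have "\<forall>\<^sub>F n in sequentially. m0 \<le> n" by (rule eventually_ge_at_top)
  ultimately show ?thesis
  proof eventually_elim
    case (elim n)
    define A where "A = G \<inter> {\<omega> \<in> space M. real R < norm (y n \<omega>)}"
    have Am [measurable]: "A \<in> sets M" unfolding A_def by measurable
    have A_sub: "A \<subseteq> {\<omega> \<in> P k. real R < norm (y n \<omega>)}" "A \<subseteq> G" using G_sub by (auto simp: A_def)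
    have "{\<omega> \<in> P k. real R < norm (y n \<omega>)} = P k \<inter> {\<omega> \<in> space M. real R < norm (y n \<omega>)}"
      using sets.sets_into_space[OF Pm] by auto
    then have "{\<omega> \<in> P k. real R < norm (y n \<omega>)} \<in> sets M" by simp
    from order_trans[OF emeasure_mono[OF A_sub(1) this] R(1)]
    have A_small: "emeasure M A \<le> ennreal \<delta>" .
    have A_meas: "measure M A \<le> \<delta>" using A_small \<delta>(1) by (simp add: measure_def enn2real_leI)
    have A_fin: "emeasure M A < \<infinity>" using A_small by (simp add: order_le_less_trans)
    define err where "err \<omega> = max (- r n \<omega>) 0 + K * norm (y n \<omega>) + K" for \<omega>
    have const_int: "set_integrable M A (\<lambda>_. K)" unfolding set_integrable_def using A_fin by simp
    have yA_int: "set_integrable M A (\<lambda>\<omega>. norm (y n \<omega>))"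
      by (rule set_integrable_subset[OF yn_int(1) Am A_sub(2)])
    have err_int: "set_integrable M A err" unfolding err_def
      by (intro set_integral_add(1) r_int(2) set_integrable_mult_right yA_int const_int Am)
    have ind: "(\<lambda>\<omega>. indicator G \<omega> *\<^sub>R (indicator A \<omega> * err \<omega>)) = (\<lambda>\<omega>. indicator A \<omega> *\<^sub>R err \<omega>)"
      using A_sub(2) by (auto simp: indicator_def fun_eq_iff)
    have errG_int: "set_integrable M G (\<lambda>\<omega>. indicator A \<omega> * err \<omega>)"
      using err_int unfolding set_integrable_def ind .
    have errG: "(LINT \<omega>:G|M. indicator A \<omega> * err \<omega>) = (LINT \<omega>:A|M. err \<omega>)"
      unfolding set_lebesgue_integral_def ind ..
    have "(LINT \<omega>:A|M. err \<omega>) = (LINT \<omega>:A|M. max (- r n \<omega>) 0) + K * (LINT \<omega>:A|M. norm (y n \<omega>))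
      + K * measure M A"
      unfolding err_def using r_int(2)[OF Am] yA_int const_int A_fin
      by (simp add: set_integral_const)
    also have "\<dots> \<le> e + K * \<delta> + K * \<delta>"
      using \<eta>1(2)[OF Am order_trans[OF A_small ennreal_leI[OF \<delta>(2)]], of n] R(2)[OF Am A_sub(1)]
        A_meas K
      by (intro add_mono mult_left_mono) auto
    also have "\<dots> \<le> 3 * e" using \<delta>(3) by simp
    finally have err_le: "(LINT \<omega>:A|M. err \<omega>) \<le> 3 * e" .
    have "(LINT \<omega>:G|M. (blinfun_apply (\<psi> \<omega>) (y n \<omega>) - c \<omega>) - indicator A \<omega> * err \<omega>) \<le>
      (LINT \<omega>:G|M. r n \<omega>)"
    proof (rule set_integral_mono)
      show "set_integrable M G (\<lambda>\<omega>. (blinfun_apply (\<psi> \<omega>) (y n \<omega>) - c \<omega>) - indicator A \<omega> * err \<omega>)"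
        by (intro set_integral_diff(1) yn_int c_int errG_int)
      show "set_integrable M G (r n)" by (rule r_int(1)[OF Gm])
      fix \<omega> assume \<omega>: "\<omega> \<in> G"
      then have \<omega>H: "\<omega> \<in> H k" using G_sub by auto
      have val: "blinfun_apply (\<psi> \<omega>) (y n \<omega>) - c \<omega> = affine_val (a \<omega>) (y n \<omega>)" using \<omega>
        by (simp add: \<psi>_def c_def)
      show "(blinfun_apply (\<psi> \<omega>) (y n \<omega>) - c \<omega>) - indicator A \<omega> * err \<omega> \<le> r n \<omega>"
      proof (cases "norm (y n \<omega>) \<le> real R")
        case True
        then have "\<omega> \<notin> A" by (simp add: A_def)
        moreover have "m \<omega> \<le> n" using \<omega> elim(2) by (simp add: G_def)
        ultimately show ?thesis using a(3)[OF \<omega>H _ True] val by simp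
      next
        case False
        then have "\<omega> \<in> A" using \<omega> W_sub G_sub by (auto simp: A_def)
        moreover have "affine_val (a \<omega>) (y n \<omega>) \<le> K * (norm (y n \<omega>) + 1)"
          using affine_val_le[of "a \<omega>" "y n \<omega>"] a(1)[OF \<omega>H] K mult_right_mono[of "norm (a \<omega>)" K
            "norm (y n \<omega>) + 1"]
          by simp
        ultimately show ?thesis using val by (simp add: err_def algebra_simps)
      qed
    qed
    then have r_G: "(LINT \<omega>:G|M. blinfun_apply (\<psi> \<omega>) (y n \<omega>)) - (LINT \<omega>:G|M. c \<omega>) - 3 * e \<le>
      (LINT \<omega>:G|M. r n \<omega>)"
      using yn_int(2)[of n] c_int errG_int errG err_le by simp
    have WGm: "W - G \<in> sets M" by measurable
    have "- (LINT \<omega>:W - G|M. max (- r n \<omega>) 0) \<le> (LINT \<omega>:W - G|M. r n \<omega>)"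
      unfolding set_integral_uminus[OF r_int(2)[OF WGm], symmetric]
      by (rule set_integral_mono) (use r_int[OF WGm] in \<open>auto simp: set_integrable_def\<close>)
    moreover have "(LINT \<omega>:W - G|M. max (- r n \<omega>) 0) \<le> e"
      by (rule \<eta>1(2)[OF WGm order_trans[OF WG ennreal_leI[OF \<eta>(2)]]])
    ultimately have r_WG: "- e \<le> (LINT \<omega>:W - G|M. r n \<omega>)" by linarith
    have "(LINT \<omega>:G|M. t \<omega>) \<le> (LINT \<omega>:G|M. blinfun_apply (\<psi> \<omega>) (y0 \<omega>) - c \<omega>)"
    proof (rule set_integral_mono)
      show "set_integrable M G t" by (rule set_integrable_subset[OF t_int Gm G_sub(1)])
      show "set_integrable M G (\<lambda>\<omega>. blinfun_apply (\<psi> \<omega>) (y0 \<omega>) - c \<omega>)"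
        by (intro set_integral_diff(1) y0_int c_int)
      show "t \<omega> \<le> blinfun_apply (\<psi> \<omega>) (y0 \<omega>) - c \<omega>" if "\<omega> \<in> G" for \<omega>
        using a(2)[of \<omega>] that G_sub by (auto simp: \<psi>_def c_def)
    qed
    then have t_G: "(LINT \<omega>:G|M. t \<omega>) \<le> (LINT \<omega>:G|M. blinfun_apply (\<psi> \<omega>) (y0 \<omega>)) - (LINT \<omega>:G|M. c \<omega>)"
      using y0_int(2) c_int by simp
    have WG_fin: "emeasure M (W - G) < \<infinity>" using WG by (simp add: order_le_less_trans)
    have "(LINT \<omega>:W - G|M. t \<omega>) \<le> (LINT \<omega>:W - G|M. B)"
    proof (rule set_integral_mono)
      show "set_integrable M (W - G) t" by (rule set_integrable_subset[OF t_int WGm]) auto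
      show "set_integrable M (W - G) (\<lambda>_. B)" unfolding set_integrable_def using WG_fin by simp
      show "t \<omega> \<le> B" for \<omega> using tB[of \<omega>] by linarith
    qed
    also have "\<dots> = B * measure M (W - G)" using WG_fin by (simp add: set_integral_const)
    also have "\<dots> \<le> e" using mult_left_mono[OF WG_meas B] \<eta>(3) by linarith
    finally have t_WG: "(LINT \<omega>:W - G|M. t \<omega>) \<le> e" .
    have "(LINT \<omega>:W|M. t \<omega>) = (LINT \<omega>:G|M. t \<omega>) + (LINT \<omega>:W - G|M. t \<omega>)"
      by (rule set_integral_Diff_split[OF t_int Gm G_sub(1) W(1)])
    moreover have "(LINT \<omega>:W|M. r n \<omega>) = (LINT \<omega>:G|M. r n \<omega>) + (LINT \<omega>:W - G|M. r n \<omega>)"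
      by (rule set_integral_Diff_split[OF r_int(1)[OF W(1)] Gm G_sub(1) W(1)])
    moreover have "\<epsilon> = 6 * e" by (simp add: e_def)
    ultimately show ?case using elim(1) r_G r_WG t_G t_WG by linarith
  qed
qed

section \<open>Affine minorants along a sequence\<close>

lemma reflexive_affine_dense:
  assumes refl: "reflexive_space TYPE('b::{real_normed_vector, second_countable_topology})"
  obtains \<alpha> :: "nat \<Rightarrow> ('b::{real_normed_vector, second_countable_topology} \<Rightarrow>\<^sub>L real) \<times> real"
    where "\<And>p \<delta>. 0 < \<delta> \<Longrightarrow> \<exists>j. dist (\<alpha> j) p < \<delta>"
proof -
  obtain \<phi> :: "nat \<Rightarrow> 'b \<Rightarrow>\<^sub>L real" where \<phi>: "closure (range \<phi>) = UNIV"
    using reflexive_imp_dual_separable[OF refl] by blast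
  let ?\<alpha> = "\<lambda>i. (\<phi> (fst (prod_decode i)), real_of_rat (nat_to_rat_surj (snd (prod_decode i))))"
  show ?thesis
  proof (rule that[of ?\<alpha>])
    fix p :: "('b \<Rightarrow>\<^sub>L real) \<times> real" and \<delta> :: real assume \<delta>: "0 < \<delta>"
    obtain i where i: "dist (\<phi> i) (fst p) < \<delta> / 2"
      using \<phi> \<delta> closure_approachable[of "fst p" "range \<phi>"] by (auto dest: spec[of _ "\<delta> / 2"])
    obtain q where q: "snd p - \<delta> / 2 < real_of_rat q" "real_of_rat q < snd p + \<delta> / 2"
      using of_rat_dense[of "snd p - \<delta> / 2" "snd p + \<delta> / 2"] \<delta> by auto
    obtain k where k: "q = nat_to_rat_surj k" using surj_nat_to_rat_surj by (metis surjD)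
    have "dist (\<phi> i, real_of_rat q) p \<le> dist (\<phi> i) (fst p) + dist (real_of_rat q) (snd p)"
      unfolding dist_prod_def by (simp add: sqrt_sum_squares_le_sum)
    also have "\<dots> < \<delta>" using i q by (simp add: dist_real_def abs_less_iff)
    finally show "\<exists>j. dist (?\<alpha> j) p < \<delta>"
      by (intro exI[of _ "prod_encode (i, k)"]) (simp add: k)
  qed
qed

lemma affine_val_diff_le:
  "\<bar>affine_val a b - affine_val a' b\<bar> \<le> dist a a' * (norm b + 1)"
  using affine_val_le[of "a - a'" b] affine_val_ge[of "a - a'" b]
  by (simp add: blinfun.diff_left dist_norm abs_le_iff)

lemma fenchel_biconj_affine_minorant:
  assumes "ereal t < fenchel_biconj k e"
  obtains \<phi> c where "\<And>b. ereal (blinfun_apply \<phi> b - c) \<le> k b" "t < blinfun_apply \<phi> e - c"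
proof -
  obtain \<phi> where \<phi>: "ereal t < ereal (blinfun_apply \<phi> e) - fenchel_conj k \<phi>"
    using assms unfolding fenchel_biconj_def by (auto simp: less_SUP_iff)
  have "fenchel_conj k \<phi> < ereal (blinfun_apply \<phi> e - t)"
    using \<phi> by (cases "fenchel_conj k \<phi>") auto
  then obtain c where c: "fenchel_conj k \<phi> < ereal c" "ereal c < ereal (blinfun_apply \<phi> e - t)"
    using ereal_dense2 by blast
  show ?thesis
  proof (rule that[of \<phi> c])
    show "t < blinfun_apply \<phi> e - c" using c(2) by simp
    fix b
    have "ereal (blinfun_apply \<phi> b) - k b \<le> fenchel_conj k \<phi>"
      unfolding fenchel_conj_def by (rule SUP_upper) simp
    also note less_imp_le[OF c(1)]
    finally show "ereal (blinfun_apply \<phi> b - c) \<le> k b" by (cases "k b") auto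
  qed
qed

text \<open>Take an affine minorant \<open>(\<phi>, c)\<close> of \<open>h (\<xi>, \<cdot>)\<close> whose value at \<open>\<upsilon>\<close> exceeds \<open>t\<close> by \<open>g > 0\<close>,
  lower it by \<open>g / 2\<close>, and replace it by a member of the dense family that differs by at most
  \<open>g / 4\<close> on the ball of radius \<open>R\<close> and at \<open>\<upsilon>\<close>. If this member exceeded \<open>r n\<close> at \<open>y n\<close> for
  infinitely many \<open>n\<close> in that ball, a weak limit of these \<open>y n\<close> would violate the minorant
  property by lower semicontinuity. The norm of the member is bounded in terms of \<open>\<phi>\<close>, \<open>c\<close> and
  \<open>g\<close>, whatever \<open>R\<close> is.\<close>

lemma eventually_affine_minorants:
  fixes h :: "'e::metric_space \<times> 'b::{real_normed_vector, second_countable_topology} \<Rightarrow> ereal"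
  assumes refl: "reflexive_space TYPE('b)"
    and dense: "\<And>p \<delta>. 0 < \<delta> \<Longrightarrow> \<exists>j. dist (\<alpha> j :: ('b \<Rightarrow>\<^sub>L real) \<times> real) p < \<delta>"
    and lsc: "\<And>b. seq_lsc_at (prod_topology euclidean weak_topology) h (\<xi>, b)"
    and t: "ereal t < fenchel_biconj (\<lambda>b. h (\<xi>, b)) \<upsilon>"
    and x: "x \<longlonglongrightarrow> \<xi>" and r: "\<And>n. h (x n, y n) = ereal (r n)"
  shows "\<exists>L :: nat. \<forall>R :: nat. \<exists>j m. norm (\<alpha> j) \<le> real L \<and> t \<le> affine_val (\<alpha> j) \<upsilon> \<and>
    (\<forall>n\<ge>m. norm (y n) \<le> real R \<longrightarrow> affine_val (\<alpha> j) (y n) \<le> r n)"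
proof -
  obtain \<phi> c where minorant: "\<And>b. ereal (blinfun_apply \<phi> b - c) \<le> h (\<xi>, b)" and gap:
    "t < blinfun_apply \<phi> \<upsilon> - c"
    using fenchel_biconj_affine_minorant[OF t] by blast
  define g where "g = blinfun_apply \<phi> \<upsilon> - c - t"
  have g: "0 < g" using gap by (simp add: g_def)
  define p where "p = (\<phi>, c + g / 2)"
  obtain L :: nat where L: "norm p + 1 \<le> real L" using real_arch_simple by blast
  show ?thesis
  proof (intro exI[of _ L] allI)
    fix R :: nat
    define \<delta> where "\<delta> = min 1 (g / (4 * (norm \<upsilon> + real R + 1)))"
    have pos: "0 < norm \<upsilon> + real R + 1" by (simp add: add_nonneg_pos)
    have \<delta>: "0 < \<delta>" "\<delta> \<le> 1" "\<delta> * (norm \<upsilon> + real R + 1) \<le> g / 4"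
    proof -
      show "0 < \<delta>" "\<delta> \<le> 1" using g pos by (auto simp: \<delta>_def)
      have "\<delta> * (norm \<upsilon> + real R + 1) \<le> g / (4 * (norm \<upsilon> + real R + 1)) * (norm \<upsilon> + real R + 1)"
        using pos by (intro mult_right_mono) (auto simp: \<delta>_def)
      also have "\<dots> = g / 4" using pos by (simp add: field_simps)
      finally show "\<delta> * (norm \<upsilon> + real R + 1) \<le> g / 4" .
    qed
    obtain j where j: "dist (\<alpha> j) p < \<delta>" using dense[OF \<delta>(1)] by blast
    have close: "\<bar>affine_val (\<alpha> j) b - affine_val p b\<bar> \<le> g / 4" if "norm b \<le> norm \<upsilon> + real R" for b
    proof -
      have "\<bar>affine_val (\<alpha> j) b - affine_val p b\<bar> \<le> dist (\<alpha> j) p * (norm b + 1)"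
        by (rule affine_val_diff_le)
      also have "\<dots> \<le> \<delta> * (norm \<upsilon> + real R + 1)" using j \<delta> that by (intro mult_mono) auto
      finally show ?thesis using \<delta>(3) by linarith
    qed
    have p: "affine_val p b = blinfun_apply \<phi> b - c - g / 2" for b by (simp add: p_def)
    have 1: "norm (\<alpha> j) \<le> real L"
      using norm_triangle_sub[of "\<alpha> j" p] j \<delta>(2) L by (simp add: dist_norm)
    have 2: "t \<le> affine_val (\<alpha> j) \<upsilon>"
    proof -
      have "\<bar>affine_val (\<alpha> j) \<upsilon> - affine_val p \<upsilon>\<bar> \<le> g / 4" by (rule close) simp
      moreover have "affine_val p \<upsilon> = t + g / 2" unfolding p g_def by (simp add: field_simps)
      ultimately show ?thesis using g by linarith
    qed
    have 3: "\<exists>m. \<forall>n\<ge>m. norm (y n) \<le> real R \<longrightarrow> affine_val (\<alpha> j) (y n) \<le> r n"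
    proof (rule ccontr)
      assume neg: "\<not> ?thesis"
      define I where "I = {n. norm (y n) \<le> real R \<and> r n < affine_val (\<alpha> j) (y n)}"
      have "infinite I" unfolding infinite_nat_iff_unbounded_le I_def using neg by (auto simp: not_le)
      then obtain q :: "nat \<Rightarrow> nat" where q: "strict_mono q" "\<And>n. q n \<in> I"
        using infinite_enumerate by blast
      have yq: "norm (y (q n)) \<le> real R" "r (q n) < affine_val (\<alpha> j) (y (q n))" for n
        using q(2)[of n] by (auto simp: I_def)
      obtain s l where s: "strict_mono s" and weak: "\<And>\<phi> :: 'b \<Rightarrow>\<^sub>L real. (\<lambda>n. blinfun_apply \<phi> (y (q
        (s n)))) \<longlonglongrightarrow> blinfun_apply \<phi> l"
        using reflexive_bounded_weakly_convergent_subsequence[of "\<lambda>n. y (q n)", OF refl yq(1)] by blast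
      let ?i = "\<lambda>n. q (s n)"
      have sub: "strict_mono ?i" using strict_mono_o[OF q(1) s] by (simp add: o_def)
      have "limitin (prod_topology euclidean weak_topology) (\<lambda>n. (x (?i n), y (?i n))) (\<xi>, l)
        sequentially"
        using LIMSEQ_subseq_LIMSEQ[OF x sub] limitin_weak_topology[OF weak]
        by (simp add: limitin_pairwise o_def)
      moreover have "(x (?i n), y (?i n)) \<in> topspace (prod_topology euclidean weak_topology)" for n
      proof -
        have "topspace (weak_topology :: 'b topology) = UNIV"
          unfolding weak_topology_def topology_generated_by_topspace by (auto intro!: exI[of _ UNIV])
        then show ?thesis by simp
      qed
      ultimately have "h (\<xi>, l) \<le> liminf (\<lambda>n. h (x (?i n), y (?i n)))"
        using lsc[of l, unfolded seq_lsc_at_def, rule_format, of "\<lambda>n. (x (?i n), y (?i n))"] by blast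
      also have "\<dots> \<le> liminf (\<lambda>n. ereal (blinfun_apply \<phi> (y (?i n)) - c - g / 4))"
      proof (rule Liminf_mono, rule always_eventually, rule allI)
        fix n
        have "r (?i n) \<le> blinfun_apply \<phi> (y (?i n)) - c - g / 4"
          using yq[of "s n"] close[of "y (?i n)"] p[of "y (?i n)"] norm_ge_zero[of \<upsilon>] by linarith
        then show "h (x (?i n), y (?i n)) \<le> ereal (blinfun_apply \<phi> (y (?i n)) - c - g / 4)"
          by (simp add: r)
      qed
      also have "\<dots> = ereal (blinfun_apply \<phi> l - c - g / 4)"
        by (intro lim_imp_Liminf tendsto_ereal tendsto_intros weak) simp
      finally have "ereal (blinfun_apply \<phi> l - c) \<le> ereal (blinfun_apply \<phi> l - c - g / 4)"
        using minorant[of l] order_trans by blast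
      then show False using g by simp
    qed
    show "\<exists>j m. norm (\<alpha> j) \<le> real L \<and> t \<le> affine_val (\<alpha> j) \<upsilon> \<and>
      (\<forall>n\<ge>m. norm (y n) \<le> real R \<longrightarrow> affine_val (\<alpha> j) (y n) \<le> r n)"
      using 1 2 3 by blast
  qed
qed

section \<open>Subsequences\<close>

text \<open>The exceptional sets need not be measurable. Measurable supersets with summable measures
  exist because the outer measures tend to zero, and the Borel--Cantelli lemma applies to them.\<close>

lemma tendsto_local_measure_AE_subsequence:
  fixes s :: "nat \<Rightarrow> 'w \<Rightarrow> 'a::metric_space"
  assumes M: "sigma_finite_measure M" and lim: "tendsto_local_measure M s u"
  obtains r where "strict_mono r" "AE \<omega> in M. (\<lambda>n. s (r n) \<omega>) \<longlonglongrightarrow> u \<omega>"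
proof -
  interpret sigma_finite_measure M by fact
  obtain K :: "nat \<Rightarrow> 'w set" where K: "range K \<subseteq> sets M" "(\<Union>i. K i) = space M"
    "\<And>i. emeasure M (K i) \<noteq> \<infinity>" "incseq K"
    using sigma_finite_incseq by metis
  define bad where "bad j n = {\<omega> \<in> K j. (1 / 2) ^ j < dist (s n \<omega>) (u \<omega>)}" for j n
  have ev: "\<forall>\<^sub>F n in sequentially. outer_measure_of M (bad j n) < ennreal ((1 / 2) ^ j)" for j
  proof (rule order_tendstoD(2))
    show "(\<lambda>n. outer_measure_of M (bad j n)) \<longlonglongrightarrow> 0"
      using lim K(1,3) unfolding tendsto_local_measure_def bad_def by (auto simp: less_top)
  qed simp
  have "\<exists>r. \<forall>j. outer_measure_of M (bad j (r j)) < ennreal ((1 / 2) ^ j) \<and> r j < r (Suc j)"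
  proof (rule dependent_nat_choice)
    show "\<exists>n. outer_measure_of M (bad 0 n) < ennreal ((1 / 2) ^ 0)"
      using ev[of 0] by (auto simp: eventually_sequentially)
    show "\<exists>n'. outer_measure_of M (bad (Suc j) n') < ennreal ((1 / 2) ^ Suc j) \<and> n < n'" for n j
      using eventually_conj[OF ev[of "Suc j"] eventually_gt_at_top[of n]]
        by (auto simp: eventually_sequentially)
  qed
  then obtain r :: "nat \<Rightarrow> nat" where r: "\<And>j. outer_measure_of M (bad j (r j)) < ennreal ((1 / 2) ^ j)"
    and mono: "strict_mono r" by (auto simp: strict_mono_Suc_iff)
  have "\<exists>B\<in>sets M. bad j (r j) \<subseteq> B \<and> emeasure M B < ennreal ((1 / 2) ^ j)" for j
    using r[of j] unfolding outer_measure_of_def by (auto simp: INF_less_iff)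
  then obtain B where B: "\<And>j. B j \<in> sets M" "\<And>j. bad j (r j) \<subseteq> B j"
    "\<And>j. emeasure M (B j) < ennreal ((1 / 2) ^ j)"
    by metis
  have "AE \<omega> in M. \<forall>\<^sub>F j in sequentially. \<omega> \<in> space M - B j"
  proof (rule borel_cantelli_AE1[OF B(1)])
    show "emeasure M (B j) < \<infinity>" for j using B(3)[of j] by (auto intro: order.strict_trans)
    show "summable (\<lambda>j. measure M (B j))"
    proof (rule summable_comparison_test')
      show "summable (\<lambda>j. (1 / 2 :: real) ^ j)" by (simp add: summable_geometric)
      show "norm (measure M (B j)) \<le> (1 / 2) ^ j" for j
        using B(3)[of j] by (simp add: measure_def enn2real_leI less_imp_le)
    qed
  qed
  then have "AE \<omega> in M. (\<lambda>n. s (r n) \<omega>) \<longlonglongrightarrow> u \<omega>"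
  proof (rule AE_mp, intro AE_I2 impI)
    fix \<omega> assume \<omega>: "\<omega> \<in> space M" and ev: "\<forall>\<^sub>F j in sequentially. \<omega> \<in> space M - B j"
    obtain i where "\<omega> \<in> K i" using K(2) \<omega> by blast
    then have "\<forall>\<^sub>F j in sequentially. \<omega> \<in> K j"
      using incseqD[OF K(4)] by (intro eventually_sequentiallyI[of i]) blast
    with ev have le: "\<forall>\<^sub>F j in sequentially. dist (s (r j) \<omega>) (u \<omega>) \<le> (1 / 2) ^ j"
    proof eventually_elim
      case (elim j)
      then show ?case using B(2)[of j] by (force simp: bad_def)
    qed
    have "(\<lambda>j. dist (s (r j) \<omega>) (u \<omega>)) \<longlonglongrightarrow> 0"
      by (rule tendsto_sandwich[OF _ le tendsto_const LIMSEQ_power_zero]) auto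
    then show "(\<lambda>n. s (r n) \<omega>) \<longlonglongrightarrow> u \<omega>" by (rule tendsto_dist_iff[THEN iffD2])
  qed
  with mono show ?thesis by (rule that)
qed

lemma tendsto_biting_subsequence:
  assumes "tendsto_biting M s u" "strict_mono r"
  shows "tendsto_biting M (\<lambda>n. s (r n)) u"
proof -
  have "tendsto_weak_L1 N (\<lambda>n. s (r n)) u" if "tendsto_weak_L1 N s u" for N
    using that LIMSEQ_subseq_LIMSEQ[OF _ assms(2)] unfolding tendsto_weak_L1_def o_def by blast
  then show ?thesis using assms(1) unfolding tendsto_biting_def by blast
qed

section \<open>Upper integrals\<close>

lemma upper_integral_eq_integral:
  assumes r: "integrable M r" and v: "AE \<omega> in M. v \<omega> = ereal (r \<omega>)"
  shows "upper_integral M v = ereal (LINT \<omega>|M. r \<omega>)"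
  unfolding upper_integral_def
proof (rule antisym)
  show "(INF u \<in> {u. integrable M u \<and> (AE \<omega> in M. v \<omega> \<le> ereal (u \<omega>))}. ereal (LINT \<omega>|M. u \<omega>)) \<le>
    ereal (LINT \<omega>|M. r \<omega>)"
    by (rule INF_lower) (use r v in \<open>auto elim: eventually_mono\<close>)
  show "ereal (LINT \<omega>|M. r \<omega>) \<le> (INF u \<in> {u. integrable M u \<and>
    (AE \<omega> in M. v \<omega> \<le> ereal (u \<omega>))}. ereal (LINT \<omega>|M. u \<omega>))"
  proof (rule INF_greatest)
    fix u assume "u \<in> {u. integrable M u \<and> (AE \<omega> in M. v \<omega> \<le> ereal (u \<omega>))}"
    then have u: "integrable M u" "AE \<omega> in M. v \<omega> \<le> ereal (u \<omega>)" by auto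
    have "AE \<omega> in M. r \<omega> \<le> u \<omega>" using u(2) v by eventually_elim simp
    then show "ereal (LINT \<omega>|M. r \<omega>) \<le> ereal (LINT \<omega>|M. u \<omega>)"
      using r u(1) by (simp add: integral_mono_AE)
  qed
qed

lemma upper_integral_le:
  "integrable M u \<Longrightarrow> AE \<omega> in M. v \<omega> \<le> ereal (u \<omega>) \<Longrightarrow> upper_integral M v \<le> ereal (LINT \<omega>|M. u \<omega>)"
  unfolding upper_integral_def by (rule INF_lower) auto

lemma upper_integral_finite_majorant:
  assumes "upper_integral M v \<noteq> \<infinity>"
  obtains u where "integrable M u" "AE \<omega> in M. v \<omega> \<le> ereal (u \<omega>)"
  using assms unfolding upper_integral_def by (force simp: INF_eq_const top_ereal_def[symmetric]
    INF_eqI)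

lemma real_representative:
  fixes v :: "'w \<Rightarrow> ereal"
  assumes [measurable]: "v \<in> borel_measurable M"
    and u: "integrable M u" "AE \<omega> in M. v \<omega> \<le> ereal (u \<omega>)"
    and g: "integrable M g" "AE \<omega> in M. - ereal (g \<omega>) \<le> v \<omega>"
  obtains r where "integrable M r" "AE \<omega> in M. v \<omega> = ereal (r \<omega>)"
proof (rule that[of "\<lambda>\<omega>. real_of_ereal (v \<omega>)"])
  show "AE \<omega> in M. v \<omega> = ereal (real_of_ereal (v \<omega>))"
    using u(2) g(2)
  proof eventually_elim
    case (elim \<omega>) then show ?case by (cases "v \<omega>") auto
  qed
  show "integrable M (\<lambda>\<omega>. real_of_ereal (v \<omega>))"
  proof (rule Bochner_Integration.integrable_bound)
    show "integrable M (\<lambda>\<omega>. \<bar>u \<omega>\<bar> + \<bar>g \<omega>\<bar>)" using u(1) g(1) by simp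
    show "AE \<omega> in M. norm (real_of_ereal (v \<omega>)) \<le> norm (\<bar>u \<omega>\<bar> + \<bar>g \<omega>\<bar>)"
      using u(2) g(2)
    proof eventually_elim
      case (elim \<omega>) then show ?case by (cases "v \<omega>") auto
    qed
  qed measurable
qed

text \<open>By \<open>\<sigma>\<close>-finiteness \<open>w\<close> is the supremum of bounded functions supported by sets of finite
  measure. This replaces a possibly infinite integral by a finite one above any prescribed bound.\<close>

lemma integrable_minorant:
  fixes w :: "'w \<Rightarrow> ennreal"
  assumes M: "sigma_finite_measure M" and [measurable]: "w \<in> borel_measurable M"
    and c: "c < (\<integral>\<^sup>+\<omega>. w \<omega> \<partial>M)"
  obtains g :: "'w \<Rightarrow> real" where "integrable M g" "\<And>\<omega>. 0 \<le> g \<omega>" "\<And>\<omega>. ennreal (g \<omega>) \<le> w \<omega>"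
    "c < ennreal (LINT \<omega>|M. g \<omega>)"
proof -
  interpret sigma_finite_measure M by fact
  obtain K :: "nat \<Rightarrow> 'w set" where K: "range K \<subseteq> sets M" "(\<Union>i. K i) = space M"
    "\<And>i. emeasure M (K i) \<noteq> \<infinity>" "incseq K"
    using sigma_finite_incseq by metis
  have [measurable]: "K n \<in> sets M" for n using K(1) by auto
  define h where "h n \<omega> = min (w \<omega>) (of_nat n) * indicator (K n) \<omega>" for n \<omega>
  have h_mono: "h m \<omega> \<le> h n \<omega>" if "m \<le> n" for m n \<omega>
  proof -
    have "K m \<subseteq> K n" by (rule incseqD[OF K(4) that])
    then show ?thesis
      using that unfolding h_def by (intro mult_mono min.mono) (auto simp: indicator_def)
  qed
  have h_meas [measurable]: "h n \<in> borel_measurable M" for n unfolding h_def by measurable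
  have sup: "(SUP n. h n \<omega>) = w \<omega>" if \<omega>: "\<omega> \<in> space M" for \<omega>
  proof (rule antisym)
    show "(SUP n. h n \<omega>) \<le> w \<omega>" by (rule SUP_least) (auto simp: h_def indicator_def)
    obtain i where i: "\<omega> \<in> K i" using K(2) \<omega> by blast
    have "w \<omega> = (SUP n. min (w \<omega>) (of_nat n))"
    proof -
      have "(SUP n. min (w \<omega>) (of_nat n :: ennreal)) = min (w \<omega>) (SUP n. of_nat n)"
        by (simp add: inf_min[symmetric] inf_SUP)
      then show ?thesis by (simp add: ennreal_SUP_of_nat_eq_top)
    qed
    also have "\<dots> \<le> (SUP n. h n \<omega>)"
    proof (rule SUP_mono)
      fix n
      have "\<omega> \<in> K (max i n)" using incseqD[OF K(4), of i "max i n"] i by auto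
      then have "min (w \<omega>) (of_nat n) \<le> h (max i n) \<omega>" 
        by (auto simp: h_def intro: min.coboundedI2 order_trans[OF _ of_nat_mono])
      then show "\<exists>m\<in>UNIV. min (w \<omega>) (of_nat n) \<le> h m \<omega>" by blast
    qed
    finally show "w \<omega> \<le> (SUP n. h n \<omega>)" .
  qed
  have "(\<integral>\<^sup>+\<omega>. w \<omega> \<partial>M) = (\<integral>\<^sup>+\<omega>. (SUP n. h n \<omega>) \<partial>M)"
    by (rule nn_integral_cong) (simp add: sup)
  also have "\<dots> = (SUP n. \<integral>\<^sup>+\<omega>. h n \<omega> \<partial>M)"
    by (rule nn_integral_monotone_convergence_SUP) (auto simp: incseq_def le_fun_def h_mono)
  finally obtain n where n: "c < (\<integral>\<^sup>+\<omega>. h n \<omega> \<partial>M)" using c by (auto simp: less_SUP_iff)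
  define g where "g \<omega> = enn2real (h n \<omega>)" for \<omega>
  have [measurable]: "g \<in> borel_measurable M" unfolding g_def[abs_def] by measurable
  have h_le: "h n \<omega> \<le> of_nat n * indicator (K n) \<omega>" for \<omega>
    unfolding h_def by (intro mult_right_mono) auto
  then have h_top: "h n \<omega> < top" for \<omega>
    by (rule order_le_less_trans) (simp add: indicator_def ennreal_mult_less_top of_nat_less_top)
  have gh: "ennreal (g \<omega>) = h n \<omega>" for \<omega> using h_top by (simp add: g_def)
  have "(\<integral>\<^sup>+\<omega>. h n \<omega> \<partial>M) \<le> (\<integral>\<^sup>+\<omega>. of_nat n * indicator (K n) \<omega> \<partial>M)"
    by (rule nn_integral_mono) (rule h_le)
  also have "\<dots> < \<infinity>" using K(3)[of n] by (simp add: nn_integral_cmult_indicator ennreal_mult_less_top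
    less_top of_nat_less_top)
  finally have fin: "(\<integral>\<^sup>+\<omega>. ennreal (g \<omega>) \<partial>M) < \<infinity>" by (simp add: gh)
  have int: "integrable M g"
    by (rule integrableI_nonneg) (use fin in \<open>auto simp: g_def\<close>)
  show ?thesis
  proof (rule that[OF int])
    show "ennreal (g \<omega>) \<le> w \<omega>" for \<omega> unfolding gh by (auto simp: h_def indicator_def)
    have "(\<integral>\<^sup>+\<omega>. ennreal (g \<omega>) \<partial>M) = ennreal (LINT \<omega>|M. g \<omega>)"
      by (rule nn_integral_eq_integral[OF int]) (simp add: g_def)
    then show "c < ennreal (LINT \<omega>|M. g \<omega>)" using n by (simp add: gh)
  qed (simp add: g_def)
qed

text \<open>If the negative part had infinite integral, subtracting from an integrable majorant larger
  and larger integrable minorants of the negative part would push the upper integral to \<open>-\<infinity>\<close>.\<close>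

lemma upper_integral_finite_imp_integrable:
  assumes M: "sigma_finite_measure M" and v [measurable]: "v \<in> borel_measurable M"
    and fin: "upper_integral M v \<noteq> \<infinity>" "upper_integral M v \<noteq> -\<infinity>"
  obtains r where "integrable M r" "AE \<omega> in M. v \<omega> = ereal (r \<omega>)"
proof -
  obtain u where u: "integrable M u" "AE \<omega> in M. v \<omega> \<le> ereal (u \<omega>)"
    using upper_integral_finite_majorant[OF fin(1)] by blast
  have "(\<integral>\<^sup>+\<omega>. e2ennreal (- v \<omega>) \<partial>M) < \<infinity>"
  proof (rule ccontr)
    assume "\<not> ?thesis"
    then have inf: "(\<integral>\<^sup>+\<omega>. e2ennreal (- v \<omega>) \<partial>M) = \<infinity>"
      by (simp add: less_top[symmetric])
    have le: "upper_integral M v \<le> ereal (- real n)" for n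
    proof -
      let ?U = "LINT \<omega>|M. \<bar>u \<omega>\<bar>"
      obtain g where g: "integrable M g" "\<And>\<omega>. 0 \<le> g \<omega>" "\<And>\<omega>. ennreal (g \<omega>) \<le> e2ennreal (- v \<omega>)"
        "ennreal (?U + real n) < ennreal (LINT \<omega>|M. g \<omega>)"
        by (rule integrable_minorant[OF M, of "\<lambda>\<omega>. e2ennreal (- v \<omega>)" "ennreal (?U + real n)"])
          (auto simp: inf)
      have "AE \<omega> in M. v \<omega> \<le> ereal (\<bar>u \<omega>\<bar> - g \<omega>)"
        using u(2)
      proof eventually_elim
        case (elim \<omega>)
        have "ennreal (g \<omega>) \<le> e2ennreal (- v \<omega>)" by (rule g(3))
        with elim g(2)[of \<omega>] show ?case
          by (cases "v \<omega>") (auto simp: ennreal_neg e2ennreal_neg e2ennreal_ereal ennreal_le_iff2)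
      qed
      then have "upper_integral M v \<le> ereal (LINT \<omega>|M. \<bar>u \<omega>\<bar> - g \<omega>)"
        using u(1) g(1) by (intro upper_integral_le) auto
      also have "\<dots> \<le> ereal (- real n)"
      proof -
        have "0 \<le> ?U + real n" by (intro add_nonneg_nonneg integral_nonneg_AE) auto
        then have "?U + real n < (LINT \<omega>|M. g \<omega>)" using g(4) by (simp only: ennreal_less_iff)
        then show ?thesis using u(1) g(1) by simp
      qed
      finally show ?thesis .
    qed
    have "upper_integral M v = -\<infinity>"
    proof (cases "upper_integral M v")
      case (real c)
      obtain n :: nat where "- c < real n" using reals_Archimedean2 by blast
      moreover have "c \<le> - real n" using le[of n] real by simp
      ultimately show ?thesis by simp
    qed (use fin(1) in auto)
    then show False using fin(2) by simp
  qed
  note neg_fin = this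
  have g_fin: "AE \<omega> in M. e2ennreal (- v \<omega>) \<noteq> \<infinity>"
    by (rule nn_integral_noteq_infinite) (use neg_fin in auto)
  have g_int: "integrable M (\<lambda>\<omega>. enn2real (e2ennreal (- v \<omega>)))"
  proof (rule integrableI_nonneg)
    have "(\<integral>\<^sup>+\<omega>. ennreal (enn2real (e2ennreal (- v \<omega>))) \<partial>M) \<le> (\<integral>\<^sup>+\<omega>. e2ennreal (- v \<omega>) \<partial>M)"
      by (rule nn_integral_mono) (simp add: ennreal_enn2real_if)
    then show "(\<integral>\<^sup>+\<omega>. ennreal (enn2real (e2ennreal (- v \<omega>))) \<partial>M) < \<infinity>"
      using neg_fin by (rule order_le_less_trans)
  qed auto
  have "AE \<omega> in M. - ereal (enn2real (e2ennreal (- v \<omega>))) \<le> v \<omega>"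
    using g_fin
  proof eventually_elim
    case (elim \<omega>)
    have "- enn2real (ennreal (- r)) \<le> r" for r by (cases "r \<le> 0") (auto simp: ennreal_neg)
    with elim show ?case by (cases "v \<omega>") (auto simp: e2ennreal_ereal)
  qed
  then show ?thesis using real_representative[OF v u g_int] that by blast
qed

section \<open>Measurability of superpositions\<close>

text \<open>The first factor is not assumed separable. One countable basis suffices: an open set of the
  product is the union, over the basic sets \<open>b\<close> of the second factor, of the rectangles \<open>U b \<times> b\<close>
  with \<open>U b\<close> as large as possible.\<close>

lemma measurable_Pair_second_countable:
  fixes u :: "'w \<Rightarrow> 'e::topological_space" and v :: "'w \<Rightarrow> 'b::second_countable_topology"
  assumes [measurable]: "u \<in> borel_measurable M" "v \<in> borel_measurable M"
  shows "(\<lambda>\<omega>. (u \<omega>, v \<omega>)) \<in> borel_measurable M"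
proof (rule borel_measurableI)
  fix S :: "('e \<times> 'b) set"
  assume S: "open S"
  obtain B :: "'b set set" where B: "countable B" "topological_basis B"
    using ex_countable_basis by blast
  define U where "U b = \<Union>{A. open A \<and> A \<times> b \<subseteq> S}" for b
  have Uo: "open (U b)" for b by (auto simp: U_def)
  have "S = (\<Union>b\<in>B. U b \<times> b)"
  proof (rule equalityI)
    show "(\<Union>b\<in>B. U b \<times> b) \<subseteq> S" by (auto simp: U_def)
    show "S \<subseteq> (\<Union>b\<in>B. U b \<times> b)"
    proof
      fix p assume "p \<in> S"
      obtain A C where AC: "open A" "open C" "p \<in> A \<times> C" "A \<times> C \<subseteq> S"
        using open_prod_elim[OF S \<open>p \<in> S\<close>] by metis
      obtain b where b: "b \<in> B" "snd p \<in> b" "b \<subseteq> C"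
        using topological_basisE[OF B(2) AC(2)] AC(3) by (metis mem_Times_iff)
      have "A \<times> b \<subseteq> S" using AC(4) b(3) by blast
      then have "fst p \<in> U b" using AC(1,3) by (auto simp: U_def)
      then show "p \<in> (\<Union>b\<in>B. U b \<times> b)" using b by (auto simp: mem_Times_iff)
    qed
  qed
  then have "(\<lambda>\<omega>. (u \<omega>, v \<omega>)) -` S \<inter> space M = (\<Union>b\<in>B. (u -` U b \<inter> space M) \<inter> (v -` b \<inter> space M))"
    by auto
  also have "\<dots> \<in> sets M"
  proof (rule sets.countable_UN''[OF B(1)])
    fix b assume "b \<in> B"
    then have "open b" using topological_basis_open[OF B(2)] by blast
    then show "(u -` U b \<inter> space M) \<inter> (v -` b \<inter> space M) \<in> sets M"
      using Uo[of b] by (intro sets.Int measurable_sets[where A = borel]) auto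
  qed
  finally show "(\<lambda>\<omega>. (u \<omega>, v \<omega>)) -` S \<inter> space M \<in> sets M" .
qed

lemma rep_measurable:
  assumes "c \<in> L0 M"
  shows "rep c \<in> borel_measurable M"
proof -
  from assms obtain u where u: "u \<in> borel_measurable M" "c = ae_rel M `` {u}"
    unfolding L0_def by (auto elim: quotientE)
  then have "u \<in> c" by (auto simp: ae_rel_def)
  then have "rep c \<in> c" unfolding rep_def by (metis someI)
  then show "rep c \<in> borel_measurable M" using u by (auto simp: ae_rel_def)
qed

lemma AE_rep_cls:
  assumes "u \<in> borel_measurable M"
  shows "AE \<omega> in M. rep (cls M u) \<omega> = u \<omega>"
proof -
  have "u \<in> cls M u" using assms by (auto simp: cls_def ae_rel_def)
  then have "rep (cls M u) \<in> cls M u" unfolding rep_def by (metis someI)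
  then show ?thesis by (auto simp: cls_def ae_rel_def elim: eventually_mono)
qed

lemma superpos_measurable:
  fixes f :: "'w \<Rightarrow> 'e::topological_space \<times> 'b::second_countable_topology \<Rightarrow> ereal"
  assumes f: "case_prod f \<in> borel_measurable (M \<Otimes>\<^sub>M borel)" and x: "x \<in> L0 M" and y: "y \<in> L0 M"
  shows "superpos f (x, y) \<in> borel_measurable M"
proof -
  have "(\<lambda>\<omega>. (\<omega>, (rep x \<omega>, rep y \<omega>))) \<in> measurable M (M \<Otimes>\<^sub>M borel)"
    using measurable_Pair_second_countable[OF rep_measurable[OF x] rep_measurable[OF y]] by measurable
  from measurable_compose[OF this f] show ?thesis by (simp add: superpos_def)
qed

section \<open>Uniformly integrable families\<close>

lemma set_nn_integral_abs_eq:
  fixes g :: "'w \<Rightarrow> real"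
  assumes "integrable M g" "A \<in> sets M"
  shows "(\<integral>\<^sup>+\<omega>\<in>A. ennreal \<bar>g \<omega>\<bar> \<partial>M) = ennreal (LINT \<omega>:A|M. \<bar>g \<omega>\<bar>)"
  by (rule nn_set_integral_eq_set_integral) (use assms in auto)

lemma set_integral_mono_set:
  fixes g :: "'w \<Rightarrow> real"
  assumes "set_integrable M B g" "A \<in> sets M" "A \<subseteq> B" "\<And>\<omega>. 0 \<le> g \<omega>"
  shows "(LINT \<omega>:A|M. g \<omega>) \<le> (LINT \<omega>:B|M. g \<omega>)"
proof -
  have "set_integrable M A g" using assms(1-3) by (rule set_integrable_subset)
  then show ?thesis
    using assms unfolding set_lebesgue_integral_def set_integrable_def
    by (intro integral_mono) (auto simp: indicator_def)
qed

lemma unif_integrable_integrable: "unif_integrable M X \<Longrightarrow> u \<in> X \<Longrightarrow> integrable M u"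
  by (simp add: unif_integrable_def)

lemma unif_integrable_bounded:
  assumes X: "unif_integrable M X"
  obtains C where "0 \<le> C" "\<And>u. u \<in> X \<Longrightarrow> (LINT \<omega>|M. \<bar>u \<omega>\<bar>) \<le> C"
proof -
  let ?s = "SUP u\<in>X. \<integral>\<^sup>+\<omega>. ennreal \<bar>u \<omega>\<bar> \<partial>M"
  have fin: "?s < \<infinity>" and int: "\<And>u. u \<in> X \<Longrightarrow> integrable M u" using X by (auto simp: unif_integrable_def)
  show ?thesis
  proof (rule that[of "enn2real ?s"])
    fix u assume u: "u \<in> X"
    have "ennreal (LINT \<omega>|M. \<bar>u \<omega>\<bar>) = (\<integral>\<^sup>+\<omega>. ennreal \<bar>u \<omega>\<bar> \<partial>M)"
      using int[OF u] by (intro nn_integral_eq_integral[symmetric]) auto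
    also have "\<dots> \<le> ?s" using u by (rule SUP_upper)
    also have "\<dots> = ennreal (enn2real ?s)" using fin by simp
    finally show "(LINT \<omega>|M. \<bar>u \<omega>\<bar>) \<le> enn2real ?s" by simp
  qed simp
qed

lemma unif_integrable_small:
  assumes X: "unif_integrable M X" and \<epsilon>: "0 < \<epsilon>"
  obtains \<eta> K where "0 < \<eta>" "K \<in> sets M" "emeasure M K < \<infinity>"
    "\<And>u A. u \<in> X \<Longrightarrow> A \<in> sets M \<Longrightarrow> emeasure M A \<le> ennreal \<eta> \<Longrightarrow> (LINT \<omega>:A|M. \<bar>u \<omega>\<bar>) \<le> \<epsilon>"
    "\<And>u. u \<in> X \<Longrightarrow> (LINT \<omega>:space M - K|M. \<bar>u \<omega>\<bar>) \<le> \<epsilon>"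
proof -
  have int: "integrable M u" if "u \<in> X" for u using X that by (auto simp: unif_integrable_def)
  have le: "(LINT \<omega>:A|M. \<bar>u \<omega>\<bar>) \<le> \<epsilon>"
    if "(SUP u\<in>X. \<integral>\<^sup>+\<omega>\<in>A. ennreal \<bar>u \<omega>\<bar> \<partial>M) < ennreal \<epsilon>" "A \<in> sets M" "u \<in> X" for u A
  proof -
    have "ennreal (LINT \<omega>:A|M. \<bar>u \<omega>\<bar>) = (\<integral>\<^sup>+\<omega>\<in>A. ennreal \<bar>u \<omega>\<bar> \<partial>M)"
      using set_nn_integral_abs_eq[OF int] that by simp
    also have "\<dots> \<le> (SUP u\<in>X. \<integral>\<^sup>+\<omega>\<in>A. ennreal \<bar>u \<omega>\<bar> \<partial>M)" using that(3) by (rule SUP_upper)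
    also note less_imp_le[OF that(1)]
    finally show ?thesis using \<epsilon> by (simp add: ennreal_le_iff)
  qed
  have "\<exists>\<eta>>0. \<exists>K\<in>sets M. emeasure M K < \<infinity> \<and>
        (\<forall>A\<in>sets M. emeasure M A \<le> ennreal \<eta> \<longrightarrow>
           (SUP u\<in>X. \<integral>\<^sup>+\<omega>\<in>A. ennreal \<bar>u \<omega>\<bar> \<partial>M) < ennreal \<epsilon>) \<and>
        (SUP u\<in>X. \<integral>\<^sup>+\<omega>\<in>(space M - K). ennreal \<bar>u \<omega>\<bar> \<partial>M) < ennreal \<epsilon>"
    using X \<epsilon> unfolding unif_integrable_def by blast
  then obtain \<eta> K where "0 < \<eta>" and K: "K \<in> sets M" "emeasure M K < \<infinity>"
    and *: "\<And>A. A \<in> sets M \<Longrightarrow> emeasure M A \<le> ennreal \<eta> \<Longrightarrow> (SUP u\<in>X. \<integral>\<^sup>+\<omega>\<in>A. ennreal \<bar>u \<omega>\<bar> \<partial>M) < ennreal \<epsilon>"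
    and **: "(SUP u\<in>X. \<integral>\<^sup>+\<omega>\<in>(space M - K). ennreal \<bar>u \<omega>\<bar> \<partial>M) < ennreal \<epsilon>" by blast
  have "space M - K \<in> sets M" using K by auto
  from that[OF \<open>0 < \<eta>\<close> K le[OF *] le[OF ** this]] show ?thesis by blast
qed

lemma unif_integrable_tails:
  assumes X: "unif_integrable M X" and \<epsilon>: "0 < \<epsilon>"
    and W: "incseq W" "\<And>j. W j \<in> sets M" "(\<Union>j. W j) = space M"
  obtains j0 where "\<And>u j. u \<in> X \<Longrightarrow> j0 \<le> j \<Longrightarrow> (LINT \<omega>:space M - W j|M. \<bar>u \<omega>\<bar>) \<le> \<epsilon>"
proof -
  obtain \<eta> K where \<eta>: "0 < \<eta>" and K: "K \<in> sets M" "emeasure M K < \<infinity>"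
    and small: "\<And>u A. u \<in> X \<Longrightarrow> A \<in> sets M \<Longrightarrow> emeasure M A \<le> ennreal \<eta> \<Longrightarrow> (LINT \<omega>:A|M. \<bar>u \<omega>\<bar>) \<le> \<epsilon> / 2"
    and tail: "\<And>u. u \<in> X \<Longrightarrow> (LINT \<omega>:space M - K|M. \<bar>u \<omega>\<bar>) \<le> \<epsilon> / 2"
    using unif_integrable_small[OF X, of "\<epsilon> / 2"] \<epsilon> by auto
  have cover: "AE \<omega> in M. \<omega> \<in> K \<longrightarrow> \<omega> \<in> (\<Union>j. W j)" unfolding W(3) by (rule AE_I2) simp
  obtain j0 where j0: "emeasure M (K - W j0) \<le> ennreal \<eta>"
    by (rule incseq_cover_emeasure_Diff_small[OF K W(1,2) cover \<eta>])
  show ?thesis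
  proof (rule that[of j0])
    fix u j assume u: "u \<in> X" and j: "j0 \<le> j"
    have int: "set_integrable M A (\<lambda>\<omega>. \<bar>u \<omega>\<bar>)" if "A \<in> sets M" for A
      using X u that by (intro set_integrable_of_integrable) (auto simp: unif_integrable_def)
    have WjK: "K - W j \<in> sets M" "space M - W j \<in> sets M" "space M - K \<in> sets M" using K W(2) by auto
    have "(LINT \<omega>:space M - W j|M. \<bar>u \<omega>\<bar>) =
        (LINT \<omega>:K - W j|M. \<bar>u \<omega>\<bar>) + (LINT \<omega>:(space M - W j) - (K - W j)|M. \<bar>u \<omega>\<bar>)"
      by (rule set_integral_Diff_split) (use int WjK sets.sets_into_space[OF K(1)] in auto)
    also have "(LINT \<omega>:(space M - W j) - (K - W j)|M. \<bar>u \<omega>\<bar>) \<le> (LINT \<omega>:space M - K|M. \<bar>u \<omega>\<bar>)"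
      by (rule set_integral_mono_set) (use int WjK in auto)
    also have "(LINT \<omega>:space M - K|M. \<bar>u \<omega>\<bar>) \<le> \<epsilon> / 2" by (rule tail[OF u])
    also have "(LINT \<omega>:K - W j|M. \<bar>u \<omega>\<bar>) \<le> \<epsilon> / 2"
    proof (rule small[OF u WjK(1)])
      have "emeasure M (K - W j) \<le> emeasure M (K - W j0)"
        using incseqD[OF W(1) j] K W(2) by (intro emeasure_mono) auto
      then show "emeasure M (K - W j) \<le> ennreal \<eta>" using j0 by (rule order_trans)
    qed
    finally show "(LINT \<omega>:space M - W j|M. \<bar>u \<omega>\<bar>) \<le> \<epsilon>" by simp
  qed
qed

section \<open>Sufficiency of Ioffe's criterion\<close>

lemma liminf_less_subsequence:
  fixes h :: "nat \<Rightarrow> ereal"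
  assumes "liminf h < c"
  obtains q :: "nat \<Rightarrow> nat" where "strict_mono q" "\<And>n. h (q n) < c"
proof -
  have "\<not> (\<forall>\<^sub>F n in sequentially. c \<le> h n)" using assms Liminf_bounded[of c h sequentially] by auto
  then have "infinite {n. h n < c}"
    unfolding infinite_nat_iff_unbounded_le by (auto simp: eventually_sequentially not_le)
  from infinite_enumerate[OF this] that show ?thesis by blast
qed


lemma limitin_compose_strict_mono:
  assumes "limitin X s l sequentially" "strict_mono (q :: nat \<Rightarrow> nat)"
  shows "limitin X (\<lambda>n. s (q n)) l sequentially"
  unfolding limitin_def
proof (intro conjI allI impI)
  show "l \<in> topspace X" using assms(1) by (simp add: limitin_def)
  fix U assume "openin X U \<and> l \<in> U"
  then have "\<forall>\<^sub>F n in sequentially. s n \<in> U" using assms(1) by (simp add: limitin_def)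
  then show "\<forall>\<^sub>F n in sequentially. s (q n) \<in> U" by (rule eventually_subseq[OF assms(2)])
qed

text \<open>The claim \<open>lower\<close> says that the integral over \<open>W\<close> of any bounded \<open>t\<close> below \<open>f (x, y)\<close> is at
  most the bound \<open>C\<close> on the functionals plus the mass \<open>e\<close> of the negative parts off \<open>W\<close>. If the
  positive part of \<open>f (x, y)\<close> has infinite integral, this is absurd already for \<open>t\<close> supported
  where \<open>f (x, y) > 0\<close>, with the crude estimate of \<open>e\<close> by the \<open>L\<^sub>1\<close> bound. Otherwise the
  functional at \<open>(x, y)\<close> is less than \<open>\<infinity>\<close>, the criterion for the constant sequence \<open>(x, y)\<close> shows
  that \<open>f (x, y)\<close> is integrable, and \<open>e\<close> is small for large \<open>W\<close> by uniform integrability.\<close>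

lemma ioffe_criterion_imp_seq_lsc_at:
  fixes M :: "'w measure"
    and S :: "('w \<Rightarrow> 'e::metric_space) set topology"
    and T :: "('w \<Rightarrow> 'f::{banach, second_countable_topology}) set topology"
    and f :: "'w \<Rightarrow> 'e \<times> 'f \<Rightarrow> ereal"
  assumes M: "sigma_finite_measure M" and refl: "reflexive_space TYPE('f)"
    and S_L0: "topspace S \<subseteq> L0 M" and T_L0: "topspace T \<subseteq> L0 M"
    and S_lim: "\<And>u s. u \<in> topspace S \<Longrightarrow> (\<And>n. s n \<in> topspace S) \<Longrightarrow> limitin S s u sequentially \<Longrightarrow>
           tendsto_local_measure M (\<lambda>n. rep (s n)) (rep u)"
    and T_lim: "\<And>v s. v \<in> topspace T \<Longrightarrow> (\<And>n. s n \<in> topspace T) \<Longrightarrow> limitin T s v sequentially \<Longrightarrow>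
           tendsto_biting M (\<lambda>n. rep (s n)) (rep v)"
    and x: "x \<in> topspace S" and y: "y \<in> topspace T"
    and f: "case_prod f \<in> borel_measurable (M \<Otimes>\<^sub>M (borel :: ('e \<times> 'f) measure))"
    and lsc: "AE \<omega> in M. \<forall>e'. seq_lsc_at (prod_topology euclidean weak_topology) (f \<omega>) (rep x \<omega>, e')"
    and biconj: "AE \<omega> in M. partial_biconj f \<omega> (rep x \<omega>, rep y \<omega>) = f \<omega> (rep x \<omega>, rep y \<omega>)"
    and ioffe: "ioffe_criterion M S T f (x, y)"
  shows "seq_lsc_at (prod_topology S T) (int_functional M f) (x, y)"
  unfolding seq_lsc_at_def
proof (intro allI impI)
  fix s assume s: "(\<forall>n. s n \<in> topspace (prod_topology S T)) \<and>
    limitin (prod_topology S T) s (x, y) sequentially"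
  interpret sigma_finite_measure M by fact
  let ?I = "int_functional M f"
  show "?I (x, y) \<le> liminf (\<lambda>n. ?I (s n))"
  proof (rule ccontr)
    assume "\<not> ?thesis"
    then obtain C :: real where C: "liminf (\<lambda>n. ?I (s n)) < ereal C" "ereal C < ?I (x, y)"
      using ereal_dense2 by (auto simp: not_le)
    obtain q :: "nat \<Rightarrow> nat" where q: "strict_mono q" "\<And>n. ?I (s (q n)) < ereal C"
      using liminf_less_subsequence[OF C(1)] by blast
    have sq: "\<And>n. s (q n) \<in> topspace S \<times> topspace T" "limitin (prod_topology S T) (\<lambda>n. s (q n)) (x,
      y) sequentially"
      using s limitin_compose_strict_mono[OF _ q(1)] by auto
    have "\<exists>C :: real. \<forall>n. ?I (s (q n)) \<le> ereal C" using q(2) less_imp_le by blast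
    with sq ioffe[unfolded ioffe_criterion_def, THEN spec, THEN mp, of "\<lambda>n. s (q n)"]
    obtain n0 g where g: "\<And>n. n0 \<le> n \<Longrightarrow> AE \<omega> in M. max (- superpos f (s (q n)) \<omega>) 0 = ereal (g n \<omega>)"
      and ui: "unif_integrable M (g ` {n0..})"
      by auto
    have lims: "limitin S (\<lambda>n. fst (s (q n))) x sequentially"
      "limitin T (\<lambda>n. snd (s (q n))) y sequentially"
      using sq(2) by (simp_all add: limitin_pairwise o_def)
    have "tendsto_local_measure M (\<lambda>n. rep (fst (s (q n)))) (rep x)"
      by (rule S_lim[OF x _ lims(1)]) (use sq(1) in \<open>simp add: mem_Times_iff\<close>)
    then obtain p :: "nat \<Rightarrow> nat" where p: "strict_mono p"
      "AE \<omega> in M. (\<lambda>n. rep (fst (s (q (p n)))) \<omega>) \<longlonglongrightarrow> rep x \<omega>"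
      by (rule tendsto_local_measure_AE_subsequence[OF M])
    define i where "i n = p (n + n0)" for n
    have i: "strict_mono i" "n0 \<le> i n" for n
      using p(1) seq_suble[OF p(1), of "n + n0"] unfolding i_def by (auto simp: strict_mono_def)
    define xs where "xs n = rep (fst (s (q (i n))))" for n
    define ys where "ys n = rep (snd (s (q (i n))))" for n
    define v where "v n = superpos f (s (q (i n)))" for n
    define v0 where "v0 = superpos f (x, y)"
    have in_L0: "fst (s (q n)) \<in> L0 M" "snd (s (q n)) \<in> L0 M" for n
      using sq(1)[of n] S_L0 T_L0 by (auto simp: mem_Times_iff)
    have xy_L0: "x \<in> L0 M" "y \<in> L0 M" using x y S_L0 T_L0 by blast+
    have v_meas [measurable]: "v n \<in> borel_measurable M" for n
      using superpos_measurable[OF f in_L0(1)[of "i n"] in_L0(2)[of "i n"]] by (simp add: v_def)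
    have v0_meas [measurable]: "v0 \<in> borel_measurable M"
      unfolding v0_def by (rule superpos_measurable[OF f xy_L0])
    have ys_meas [measurable]: "ys n \<in> borel_measurable M" for n
      unfolding ys_def by (rule rep_measurable[OF in_L0(2)])
    have y_meas [measurable]: "rep y \<in> borel_measurable M" by (rule rep_measurable[OF xy_L0(2)])
    have xs_lim: "AE \<omega> in M. (\<lambda>n. xs n \<omega>) \<longlonglongrightarrow> rep x \<omega>"
      using p(2)
    proof eventually_elim
      case (elim \<omega>)
      then show ?case unfolding xs_def i_def by (rule LIMSEQ_ignore_initial_segment)
    qed
    have ys_lim: "tendsto_biting M ys (rep y)"
      unfolding ys_def
      using tendsto_biting_subsequence[OF T_lim[OF y _ lims(2)] i(1)] sq(1) by (simp add: mem_Times_iff)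
    have X: "g (i n) \<in> g ` {n0..}" for n using i(2) by auto
    have g_int: "integrable M (g (i n))" for n by (rule unif_integrable_integrable[OF ui X])
    have g_eq: "AE \<omega> in M. max (- v n \<omega>) 0 = ereal (g (i n) \<omega>)" for n
      unfolding v_def by (rule g[OF i(2)])
    have "\<exists>r. integrable M r \<and> (AE \<omega> in M. v n \<omega> = ereal (r \<omega>))" for n
    proof -
      have "upper_integral M (v n) \<noteq> \<infinity>"
        using q(2)[of "i n"] unfolding v_def int_functional_def by auto
      then obtain u where u: "integrable M u" "AE \<omega> in M. v n \<omega> \<le> ereal (u \<omega>)"
        by (rule upper_integral_finite_majorant)
      have "AE \<omega> in M. - ereal (g (i n) \<omega>) \<le> v n \<omega>"
        using g_eq[of n]
      proof eventually_elim
        case (elim \<omega>)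
        then have "- v n \<omega> \<le> ereal (g (i n) \<omega>)" by (metis max.cobounded1)
        then show ?case by (metis ereal_uminus_le_reorder)
      qed
      from real_representative[OF v_meas u g_int this] show ?thesis by blast
    qed
    then have "\<exists>r. \<forall>n. integrable M (r n) \<and> (AE \<omega> in M. v n \<omega> = ereal (r n \<omega>))" by (intro choice allI)
    then obtain r where r_int: "\<And>n. integrable M (r n)" and r_eq:
      "\<And>n. AE \<omega> in M. v n \<omega> = ereal (r n \<omega>)" by blast
    have r_le: "(LINT \<omega>|M. r n \<omega>) \<le> C" for n
      using q(2)[of "i n"] upper_integral_eq_integral[OF r_int r_eq] unfolding v_def
        int_functional_def by simp
    have neg_eq: "AE \<omega> in M. max (- r n \<omega>) 0 = \<bar>g (i n) \<omega>\<bar>" for n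
      using g_eq[of n] r_eq[of n]
    proof eventually_elim
      case (elim \<omega>)
      then show ?case by (auto simp: max_def split: if_splits)
    qed
    have neg_set: "(LINT \<omega>:A|M. max (- r n \<omega>) 0) = (LINT \<omega>:A|M. \<bar>g (i n) \<omega>\<bar>)" if "A \<in> sets M" for A n
      using that neg_eq[of n] borel_measurable_integrable[OF r_int] borel_measurable_integrable[OF
        g_int]
      by (intro set_lebesgue_integral_cong_AE) auto
    have all_r: "AE \<omega> in M. \<forall>n. v n \<omega> = ereal (r n \<omega>)" using r_eq by (simp add: AE_all_countable)
    obtain \<alpha> :: "nat \<Rightarrow> ('f \<Rightarrow>\<^sub>L real) \<times> real" where \<alpha>: "\<And>p \<delta>. 0 < \<delta> \<Longrightarrow> \<exists>j. dist (\<alpha> j) p < \<delta>"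
      using reflexive_affine_dense[OF refl] by blast
    have lower: "(LINT \<omega>:W|M. t \<omega>) \<le> C + e"
      if W: "W \<in> sets M" "emeasure M W < \<infinity>" and t: "t \<in> borel_measurable M" "\<And>\<omega>. \<bar>t \<omega>\<bar> \<le> B"
        and less: "AE \<omega> in M. \<omega> \<in> W \<longrightarrow> ereal (t \<omega>) < v0 \<omega>"
        and err: "\<And>n. (LINT \<omega>:space M - W|M. \<bar>g (i n) \<omega>\<bar>) \<le> e" for W t B e
    proof -
      have minorants: "AE \<omega> in M. \<omega> \<in> W \<longrightarrow> (\<exists>L :: nat. \<forall>R :: nat. \<exists>j m. norm (\<alpha> j) \<le> real L \<and>
        t \<omega> \<le> affine_val (\<alpha> j) (rep y \<omega>) \<and> (\<forall>n\<ge>m. norm (ys n \<omega>) \<le> real R \<longrightarrow>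
          affine_val (\<alpha> j) (ys n \<omega>) \<le> r n \<omega>))"
        using less lsc biconj xs_lim all_r
      proof eventually_elim
        case (elim \<omega>)
        show ?case
        proof
          assume "\<omega> \<in> W"
          with elim(1,3) have tb: "ereal (t \<omega>) < fenchel_biconj (\<lambda>b. f \<omega> (rep x \<omega>, b)) (rep y \<omega>)"
            by (simp add: v0_def superpos_def partial_biconj_def)
          have val: "f \<omega> (xs n \<omega>, ys n \<omega>) = ereal (r n \<omega>)" for n
            using elim(5) by (simp add: v_def superpos_def xs_def ys_def split_beta)
          show "\<exists>L :: nat. \<forall>R :: nat. \<exists>j m. norm (\<alpha> j) \<le> real L \<and>
            t \<omega> \<le> affine_val (\<alpha> j) (rep y \<omega>) \<and> (\<forall>n\<ge>m. norm (ys n \<omega>) \<le> real R \<longrightarrow>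
              affine_val (\<alpha> j) (ys n \<omega>) \<le> r n \<omega>)"
          proof (rule eventually_affine_minorants[where h = "f \<omega>" and x = "\<lambda>n. xs n \<omega>" and y =
            "\<lambda>n. ys n \<omega>"
                and r = "\<lambda>n. r n \<omega>" and \<xi> = "rep x \<omega>" and \<upsilon> = "rep y \<omega>" and t = "t \<omega>" and \<alpha> = \<alpha>])
            show "\<exists>j. dist (\<alpha> j) p < \<delta>" if "0 < \<delta>" for p \<delta> using that by (rule \<alpha>)
            show "seq_lsc_at (prod_topology euclidean weak_topology) (f \<omega>) (rep x \<omega>, b)" for b
              using elim(2) by blast
          qed (fact refl tb elim(4) val)+
        qed
      qed
      have uac: "\<exists>\<eta>>0. \<forall>n. \<forall>A\<in>sets M. emeasure M A \<le> ennreal \<eta> \<longrightarrow> (LINT \<omega>:A|M. max (- r n \<omega>) 0) \<le> \<epsilon>"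
        if \<epsilon>: "0 < \<epsilon>" for \<epsilon>
      proof (rule unif_integrable_small[OF ui \<epsilon>])
        fix \<eta> K assume \<eta>: "0 < \<eta>"
          and small: "\<And>u A. u \<in> g ` {n0..} \<Longrightarrow> A \<in> sets M \<Longrightarrow> emeasure M A \<le> ennreal \<eta> \<Longrightarrow>
            (LINT \<omega>:A|M. \<bar>u \<omega>\<bar>) \<le> \<epsilon>"
        have "(LINT \<omega>:A|M. max (- r n \<omega>) 0) \<le> \<epsilon>" if "A \<in> sets M" "emeasure M A \<le> ennreal \<eta>" for n A
          unfolding neg_set[OF that(1)] by (rule small[OF X that])
        with \<eta> show ?thesis by blast
      qed
      have "(LINT \<omega>:W|M. t \<omega>) \<le> C + e + \<epsilon>" if \<epsilon>: "0 < \<epsilon>" for \<epsilon>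
      proof -
        have "\<forall>\<^sub>F n in sequentially. (LINT \<omega>:W|M. t \<omega>) - \<epsilon> \<le> (LINT \<omega>:W|M. r n \<omega>)"
          by (rule affine_minorants_imp_eventually_set_integral_ge[where r = r and y = ys and \<alpha> = \<alpha>
            and t = t, OF W ys_meas y_meas ys_lim r_int uac t minorants \<epsilon>])
        then obtain n where n: "(LINT \<omega>:W|M. t \<omega>) - \<epsilon> \<le> (LINT \<omega>:W|M. r n \<omega>)"
          by (auto simp: eventually_sequentially)
        have Wc: "space M - W \<in> sets M" using W(1) by auto
        have ints: "set_integrable M A (r n)" "set_integrable M A (\<lambda>\<omega>. max (- r n \<omega>) 0)" if
          "A \<in> sets M" for A
          using that r_int by (auto intro!: set_integrable_of_integrable)
        have "- (LINT \<omega>:space M - W|M. max (- r n \<omega>) 0) \<le> (LINT \<omega>:space M - W|M. r n \<omega>)"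
          unfolding set_integral_uminus[OF ints(2)[OF Wc], symmetric]
          by (rule set_integral_mono) (use ints[OF Wc] in \<open>auto simp: set_integrable_def\<close>)
        moreover have "(LINT \<omega>:space M|M. r n \<omega>) = (LINT \<omega>:W|M. r n \<omega>) + (LINT \<omega>:space M - W|M. r n \<omega>)"
          by (rule set_integral_Diff_split[OF ints(1)[OF sets.top] W(1) sets.sets_into_space[OF
            W(1)] sets.top])
        ultimately show ?thesis
          using n r_le[of n] err[of n] set_integral_space[OF r_int[of n]]
          unfolding neg_set[OF Wc] by linarith
      qed
      then show ?thesis by (rule field_le_epsilon)
    qed
    obtain K :: "nat \<Rightarrow> 'w set" where K: "range K \<subseteq> sets M" "(\<Union>i. K i) = space M"
      "\<And>i. emeasure M (K i) \<noteq> \<infinity>" "incseq K"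
      using sigma_finite_incseq by metis
    have K_meas [measurable]: "K j \<in> sets M" for j using K(1) by auto
    obtain C1 where C1: "0 \<le> C1" "\<And>n. (LINT \<omega>|M. \<bar>g (i n) \<omega>\<bar>) \<le> C1"
    proof (rule unif_integrable_bounded[OF ui])
      fix C1 assume "0 \<le> C1" and le: "\<And>u. u \<in> g ` {n0..} \<Longrightarrow> (LINT \<omega>|M. \<bar>u \<omega>\<bar>) \<le> C1"
      then show thesis using that[of C1] le[OF X] by blast
    qed
    show False
    proof (cases "(\<integral>\<^sup>+\<omega>. e2ennreal (v0 \<omega>) \<partial>M) = \<infinity>")
      case True
      \<comment> \<open>the positive part alone already exceeds every bound\<close>
      define c where "c = 2 * (\<bar>C\<bar> + C1 + 1)"
      obtain h where h: "integrable M h" "\<And>\<omega>. 0 \<le> h \<omega>" "\<And>\<omega>. ennreal (h \<omega>) \<le> e2ennreal (v0 \<omega>)"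
        "ennreal c < ennreal (LINT \<omega>|M. h \<omega>)"
        by (rule integrable_minorant[OF M, of "\<lambda>\<omega>. e2ennreal (v0 \<omega>)" "ennreal c"]) (auto simp: True)
      have [measurable]: "h \<in> borel_measurable M" using h(1) by (rule borel_measurable_integrable)
      define W where "W j = K j \<inter> {\<omega> \<in> space M. 0 < h \<omega> \<and> h \<omega> \<le> real j}" for j
      have W_meas [measurable]: "W j \<in> sets M" for j unfolding W_def by measurable
      have W_mono: "incseq W"
        using incseqD[OF K(4)] unfolding incseq_def W_def by (auto intro: order_trans)
      have W_Un: "(\<Union>j. W j) = {\<omega> \<in> space M. 0 < h \<omega>}"
      proof (intro equalityI subsetI)
        fix \<omega> assume \<omega>: "\<omega> \<in> {\<omega> \<in> space M. 0 < h \<omega>}"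
        then obtain a where a: "\<omega> \<in> K a" using K(2) by blast
        obtain b :: nat where b: "h \<omega> \<le> real b" using real_arch_simple by blast
        have "\<omega> \<in> K (max a b)" using incseqD[OF K(4), of a "max a b"] a by auto
        with \<omega> b have "\<omega> \<in> W (max a b)" by (auto simp: W_def)
        then show "\<omega> \<in> (\<Union>j. W j)" by blast
      qed (auto simp: W_def)
      have bound: "(LINT \<omega>:W j|M. h \<omega>) \<le> 2 * (C + C1)" for j
      proof -
        define t where "t \<omega> = (if \<omega> \<in> W j then h \<omega> / 2 else 0)" for \<omega>
        have "(LINT \<omega>:W j|M. t \<omega>) \<le> C + C1"
        proof (rule lower[OF W_meas, where B = "real j"])
          show "emeasure M (W j) < \<infinity>"
            using K(3)[of j] emeasure_mono[of "W j" "K j" M]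
              by (auto simp: W_def less_top[symmetric] top_unique)
          show "t \<in> borel_measurable M" unfolding t_def[abs_def] by measurable
          show "\<bar>t \<omega>\<bar> \<le> real j" for \<omega> using h(2)[of \<omega>] by (auto simp: t_def W_def)
          show "AE \<omega> in M. \<omega> \<in> W j \<longrightarrow> ereal (t \<omega>) < v0 \<omega>"
          proof (rule AE_I2, rule impI)
            fix \<omega> assume \<omega>: "\<omega> \<in> W j"
            then have "0 < h \<omega>" by (simp add: W_def)
            with h(3)[of \<omega>] \<omega> show "ereal (t \<omega>) < v0 \<omega>"
              by (cases "v0 \<omega>") (auto simp: t_def e2ennreal_ereal e2ennreal_neg ennreal_le_iff2)
          qed
          show "(LINT \<omega>:space M - W j|M. \<bar>g (i n) \<omega>\<bar>) \<le> C1" for n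
          proof -
            have "(LINT \<omega>:space M - W j|M. \<bar>g (i n) \<omega>\<bar>) \<le> (LINT \<omega>:space M|M. \<bar>g (i n) \<omega>\<bar>)"
              by (rule set_integral_mono_set) (use g_int in \<open>auto intro!: set_integrable_of_integrable\<close>)
            then show ?thesis using C1(2)[of n] set_integral_space[OF integrable_abs[OF g_int[of
              n]]] by simp
          qed
        qed
        moreover have "(LINT \<omega>:W j|M. t \<omega>) = (LINT \<omega>:W j|M. h \<omega> / 2)"
          by (rule set_lebesgue_integral_cong) (auto simp: t_def)
        ultimately show ?thesis by simp
      qed
      have "(\<lambda>j. LINT \<omega>:W j|M. h \<omega>) \<longlonglongrightarrow> (LINT \<omega>:(\<Union>j. W j)|M. h \<omega>)"
        by (rule set_integral_cont_up[OF W_meas W_mono]) (use h(1) in \<open>auto intro!: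
          set_integrable_of_integrable\<close>)
      then have "(LINT \<omega>:(\<Union>j. W j)|M. h \<omega>) \<le> 2 * (C + C1)"
        by (rule LIMSEQ_le_const2) (use bound in blast)
      moreover have "(LINT \<omega>:(\<Union>j. W j)|M. h \<omega>) = (LINT \<omega>|M. h \<omega>)"
        unfolding W_Un set_lebesgue_integral_def
        by (rule Bochner_Integration.integral_cong) (use h(2) in \<open>auto simp: indicator_def less_le\<close>)
      moreover have "c < (LINT \<omega>|M. h \<omega>)"
        using h(4) C1(1) by (subst (asm) ennreal_less_iff) (auto simp: c_def)
      ultimately show False by (simp add: c_def)
    next
      case False
      then have pos_fin: "(\<integral>\<^sup>+\<omega>. e2ennreal (v0 \<omega>) \<partial>M) < \<infinity>" by (simp add: less_top[symmetric])
      define u where "u \<omega> = enn2real (e2ennreal (v0 \<omega>))" for \<omega>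
      have u_int: "integrable M u"
      proof (rule integrableI_nonneg)
        show "u \<in> borel_measurable M" unfolding u_def[abs_def] by measurable
        have "(\<integral>\<^sup>+\<omega>. ennreal (u \<omega>) \<partial>M) \<le> (\<integral>\<^sup>+\<omega>. e2ennreal (v0 \<omega>) \<partial>M)"
          unfolding u_def by (rule nn_integral_mono) (simp add: ennreal_enn2real_if)
        then show "(\<integral>\<^sup>+\<omega>. ennreal (u \<omega>) \<partial>M) < \<infinity>" using pos_fin by (rule order_le_less_trans)
      qed (auto simp: u_def)
      have "AE \<omega> in M. e2ennreal (v0 \<omega>) \<noteq> \<infinity>"
        by (rule nn_integral_noteq_infinite) (use pos_fin in auto)
      then have u_ge: "AE \<omega> in M. v0 \<omega> \<le> ereal (u \<omega>)"
      proof eventually_elim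
        case (elim \<omega>)
        have "c \<le> enn2real (ennreal c)" for c by (cases "0 \<le> c") (auto simp: ennreal_neg)
        with elim show ?case by (cases "v0 \<omega>") (auto simp: u_def e2ennreal_ereal)
      qed
      have "?I (x, y) \<le> ereal (LINT \<omega>|M. u \<omega>)"
        unfolding int_functional_def using upper_integral_le[OF u_int] u_ge by (simp add: v0_def)
      then have "\<exists>C :: real. \<forall>n :: nat. ?I (x, y) \<le> ereal C" by blast
      then have "\<exists>(n0 :: nat) g. (\<forall>n\<ge>n0. AE \<omega> in M. max (- v0 \<omega>) 0 = ereal (g n \<omega>)) \<and>
        unif_integrable M (g ` {n0..})"
        using x y ioffe[unfolded ioffe_criterion_def, THEN spec, THEN mp, of "\<lambda>_. (x, y)"]
        unfolding v0_def by simp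
      then obtain n1 :: nat and g' where g': "\<And>n. n1 \<le> n \<Longrightarrow> AE \<omega> in M. max (- v0 \<omega>) 0 = ereal (g' n \<omega>)"
        and ui': "unif_integrable M (g' ` {n1..})"
        by blast
      have g'_int: "integrable M (g' n1)" by (rule unif_integrable_integrable[OF ui']) auto
      have "AE \<omega> in M. - ereal (g' n1 \<omega>) \<le> v0 \<omega>"
        using g'[OF order_refl]
      proof eventually_elim
        case (elim \<omega>)
        then have "- v0 \<omega> \<le> ereal (g' n1 \<omega>)" by (metis max.cobounded1)
        then show ?case by (metis ereal_uminus_le_reorder)
      qed
      then obtain r0 where r0_int: "integrable M r0" and r0_eq: "AE \<omega> in M. v0 \<omega> = ereal (r0 \<omega>)"
        by (rule real_representative[OF v0_meas u_int u_ge g'_int])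
      have [measurable]: "r0 \<in> borel_measurable M" using r0_int by (rule borel_measurable_integrable)
      have C_less: "C < (LINT \<omega>|M. r0 \<omega>)"
        using C(2) upper_integral_eq_integral[OF r0_int r0_eq] by (simp add: int_functional_def v0_def)
      define e where "e = ((LINT \<omega>|M. r0 \<omega>) - C) / 4"
      have e: "0 < e" using C_less by (simp add: e_def)
      define W where "W j = K j \<inter> {\<omega> \<in> space M. \<bar>r0 \<omega>\<bar> \<le> real j}" for j
      have W_meas [measurable]: "W j \<in> sets M" for j unfolding W_def by measurable
      have W_mono: "incseq W"
        using incseqD[OF K(4)] unfolding incseq_def W_def by (auto intro: order_trans)
      have W_Un: "(\<Union>j. W j) = space M"
      proof (intro equalityI subsetI)
        fix \<omega> assume \<omega>: "\<omega> \<in> space M"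
        then obtain a where a: "\<omega> \<in> K a" using K(2) by blast
        obtain b :: nat where b: "\<bar>r0 \<omega>\<bar> \<le> real b" using real_arch_simple by blast
        have "\<omega> \<in> K (max a b)" using incseqD[OF K(4), of a "max a b"] a by auto
        with \<omega> b have "\<omega> \<in> W (max a b)" by (auto simp: W_def)
        then show "\<omega> \<in> (\<Union>j. W j)" by blast
      qed (auto simp: W_def)
      obtain j0 where j0: "\<And>u j. u \<in> g ` {n0..} \<Longrightarrow> j0 \<le> j \<Longrightarrow> (LINT \<omega>:space M - W j|M. \<bar>u \<omega>\<bar>) \<le> e"
        using unif_integrable_tails[OF ui e W_mono W_meas W_Un] by blast
      have "(\<lambda>j. LINT \<omega>:W j|M. r0 \<omega>) \<longlonglongrightarrow> (LINT \<omega>:(\<Union>j. W j)|M. r0 \<omega>)"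
        by (rule set_integral_cont_up[OF W_meas W_mono]) (use r0_int in \<open>auto intro!:
          set_integrable_of_integrable\<close>)
      then have "(\<lambda>j. LINT \<omega>:W j|M. r0 \<omega>) \<longlonglongrightarrow> (LINT \<omega>|M. r0 \<omega>)"
        by (simp add: W_Un set_integral_space[OF r0_int])
      then have "\<forall>\<^sub>F j in sequentially. (LINT \<omega>|M. r0 \<omega>) - e < (LINT \<omega>:W j|M. r0 \<omega>)"
        by (rule order_tendstoD) (use e in simp)
      then have "\<forall>\<^sub>F j in sequentially. (LINT \<omega>|M. r0 \<omega>) - e < (LINT \<omega>:W j|M. r0 \<omega>) \<and> j0 \<le> j"
        by (rule eventually_conj) (rule eventually_ge_at_top)
      then obtain j where j: "(LINT \<omega>|M. r0 \<omega>) - e < (LINT \<omega>:W j|M. r0 \<omega>)" "j0 \<le> j"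
        by (auto simp: eventually_sequentially)
      define \<delta> where "\<delta> = e / (measure M (W j) + 1)"
      have \<delta>: "0 < \<delta>" "\<delta> * measure M (W j) \<le> e"
        using e by (auto simp: \<delta>_def field_simps add_pos_nonneg)
      have W_fin: "emeasure M (W j) < \<infinity>"
        using K(3)[of j] emeasure_mono[of "W j" "K j" M]
          by (auto simp: W_def less_top[symmetric] top_unique)
      define t where "t \<omega> = (if \<omega> \<in> W j then r0 \<omega> - \<delta> else 0)" for \<omega>
      have "(LINT \<omega>:W j|M. t \<omega>) \<le> C + e"
      proof (rule lower[OF W_meas W_fin, where B = "real j + \<delta>"])
        show "t \<in> borel_measurable M" unfolding t_def[abs_def] by measurable
        show "\<bar>t \<omega>\<bar> \<le> real j + \<delta>" for \<omega> using \<delta>(1) by (auto simp: t_def W_def)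
        show "AE \<omega> in M. \<omega> \<in> W j \<longrightarrow> ereal (t \<omega>) < v0 \<omega>"
          using r0_eq by eventually_elim (use \<delta>(1) in \<open>auto simp: t_def\<close>)
        show "(LINT \<omega>:space M - W j|M. \<bar>g (i n) \<omega>\<bar>) \<le> e" for n by (rule j0[OF X j(2)])
      qed
      moreover have "(LINT \<omega>:W j|M. t \<omega>) = (LINT \<omega>:W j|M. r0 \<omega> - \<delta>)"
        by (rule set_lebesgue_integral_cong) (auto simp: t_def)
      moreover have "(LINT \<omega>:W j|M. r0 \<omega> - \<delta>) = (LINT \<omega>:W j|M. r0 \<omega>) - \<delta> * measure M (W j)"
      proof -
        have "set_integrable M (W j) (\<lambda>_. \<delta>)" unfolding set_integrable_def using W_fin by simp
        then show ?thesis
          using set_integrable_of_integrable[OF r0_int W_meas[of j]] W_fin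
            by (simp add: set_integral_const)
      qed
      moreover have "(LINT \<omega>|M. r0 \<omega>) = C + 4 * e" by (simp add: e_def field_simps)
      ultimately show False using j(1) \<delta>(2) e by linarith
    qed
  qed
qed

section \<open>Atomless measures\<close>

text \<open>Splitting a set into two parts of positive measure and keeping the smaller one halves the
  measure.\<close>

lemma atomless_small_subset:
  assumes atomless: "atomless M" and B: "B \<in> sets M" "0 < emeasure M B" "emeasure M B < \<infinity>" and \<eta>:
    "0 < \<eta>"
  obtains C where "C \<in> sets M" "C \<subseteq> B" "0 < emeasure M C" "emeasure M C \<le> ennreal \<eta>"
proof -
  have halve: "\<exists>C\<in>sets M. C \<subseteq> B \<and> 0 < emeasure M C \<and> measure M C \<le> measure M B / 2 ^ k" for k
  proof (induction k)
    case 0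
    then show ?case using B by auto
  next
    case (Suc k)
    then obtain C where C: "C \<in> sets M" "C \<subseteq> B" "0 < emeasure M C"
      "measure M C \<le> measure M B / 2 ^ k" by blast
    have C_fin: "emeasure M C \<noteq> \<infinity>" using emeasure_mono[OF C(2) B(1)] B(3) by (auto simp: top_unique)
    obtain D where D: "D \<in> sets M" "D \<subseteq> C" "emeasure M D \<noteq> 0" "emeasure M (C - D) \<noteq> 0"
      using atomless C unfolding atomless_def by blast
    have "measure M C = measure M D + measure M (C - D)"
      using measure_Diff[of M C D] D(1,2) C(1) C_fin by simp
    then have "measure M D \<le> measure M C / 2 \<or> measure M (C - D) \<le> measure M C / 2" by linarith
    moreover have "measure M C / 2 \<le> measure M B / 2 ^ Suc k" using C(4) by simp
    ultimately have "measure M D \<le> measure M B / 2 ^ Suc k \<or> measure M (C - D) \<le>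
      measure M B / 2 ^ Suc k" by linarith
    then show ?case
    proof
      assume "measure M D \<le> measure M B / 2 ^ Suc k"
      then show ?thesis using D C(2) by (intro bexI[of _ D]) (auto simp: zero_less_iff_neq_zero)
    next
      assume "measure M (C - D) \<le> measure M B / 2 ^ Suc k"
      then show ?thesis using D C by (intro bexI[of _ "C - D"]) (auto simp: zero_less_iff_neq_zero)
    qed
  qed
  obtain k :: nat where k: "measure M B / \<eta> < 2 ^ k" using real_arch_pow[of 2 "measure M B / \<eta>"] by auto
  then have le: "measure M B / 2 ^ k \<le> \<eta>" using \<eta> by (simp add: field_simps)
  from halve[of k] obtain C where C: "C \<in> sets M" "C \<subseteq> B" "0 < emeasure M C"
    "measure M C \<le> measure M B / 2 ^ k" by blast
  have "emeasure M C = ennreal (measure M C)"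
    using emeasure_mono[OF C(2) B(1)] B(3) by (intro emeasure_eq_ennreal_measure) (auto simp:
      top_unique)
  then have "emeasure M C \<le> ennreal \<eta>" using C(4) le by (simp add: ennreal_leI)
  with C show ?thesis using that by blast
qed

text \<open>Exhaustion: among the finite unions of sets of measure at most \<open>\<eta>\<close> inside \<open>K\<close> there is one
  whose rest \<open>K - H\<close> has the least measure, because the tail of an increasing union is again such
  a small set. A rest of positive measure would contain another small set.\<close>

lemma atomless_finite_cover:
  assumes atomless: "atomless M" and K: "K \<in> sets M" "emeasure M K < \<infinity>" and \<eta>: "0 < \<eta>"
  obtains \<C> where "finite \<C>" "\<C> \<subseteq> sets M" "\<And>C. C \<in> \<C> \<Longrightarrow> emeasure M C \<le> ennreal \<eta>" "K = \<Union>\<C>"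
proof -
  define good where "good B \<longleftrightarrow> (\<exists>\<C>. finite \<C> \<and> \<C> \<subseteq> sets M \<and> (\<forall>C\<in>\<C>. emeasure M C \<le> ennreal \<eta>) \<and>
    B = \<Union>\<C>)" for B
  have good_sets: "B \<in> sets M" if "good B" for B
    using that unfolding good_def by (auto intro: sets.finite_Union)
  have good_small: "good B" if "B \<in> sets M" "emeasure M B \<le> ennreal \<eta>" for B
    unfolding good_def using that by (intro exI[of _ "{B}"]) auto
  have good_Un: "good (B \<union> D)" if "good B" "good D" for B D
  proof -
    from that obtain \<C> \<D> where "finite \<C> \<and> \<C> \<subseteq> sets M \<and> (\<forall>C\<in>\<C>. emeasure M C \<le> ennreal \<eta>) \<and> B = \<Union>\<C>"
      "finite \<D> \<and> \<D> \<subseteq> sets M \<and> (\<forall>C\<in>\<D>. emeasure M C \<le> ennreal \<eta>) \<and> D = \<Union>\<D>"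
      unfolding good_def by blast
    then show ?thesis unfolding good_def by (intro exI[of _ "\<C> \<union> \<D>"]) auto
  qed
  have fin: "emeasure M B < \<infinity>" if "B \<subseteq> K" for B
    using emeasure_mono[OF that K(1)] K(2) by (rule order_le_less_trans)
  define V where "V = (\<lambda>G. measure M (K - G)) ` {G. good G \<and> G \<subseteq> K}"
  have V_ne: "V \<noteq> {}" using good_small[of "{}"] by (auto simp: V_def intro!: exI[of _ "{}"])
  have V_bdd: "bdd_below V" by (auto simp: V_def intro!: bdd_belowI[of _ 0])
  have V_le: "Inf V \<le> measure M (K - G)" if "good G" "G \<subseteq> K" for G
    by (rule cInf_lower[OF _ V_bdd]) (use that in \<open>auto simp: V_def\<close>)
  have "\<exists>G. good G \<and> G \<subseteq> K \<and> measure M (K - G) < Inf V + 1 / real (Suc j)" for j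
  proof -
    have "Inf V < Inf V + 1 / real (Suc j)" by simp
    then obtain v where "v \<in> V" "v < Inf V + 1 / real (Suc j)" using cInf_lessD[OF V_ne] by blast
    then show ?thesis by (auto simp: V_def)
  qed
  then obtain G where G: "\<And>j. good (G j)" "\<And>j. G j \<subseteq> K"
    "\<And>j. measure M (K - G j) < Inf V + 1 / real (Suc j)"
    by metis
  define U where "U n = (\<Union>j\<le>n. G j)" for n
  have U_good: "good (U n)" for n
  proof (induction n)
    case (Suc n)
    then show ?case using good_Un[OF Suc G(1)[of "Suc n"]] by (simp add: U_def atMost_Suc Un_commute)
  qed (simp add: U_def G(1))
  define H where "H = (\<Union>j. G j)"
  have H_sets: "H \<in> sets M" unfolding H_def using good_sets[OF G(1)] by blast
  have H_sub: "H \<subseteq> K" using G(2) by (auto simp: H_def)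
  have H_good: "good H"
  proof -
    obtain n where n: "emeasure M (H - U n) \<le> ennreal \<eta>"
    proof (rule incseq_cover_emeasure_Diff_small[OF H_sets fin[OF H_sub], of U])
      show "incseq U" by (auto simp: incseq_def U_def intro: order_trans)
      show "U k \<in> sets M" for k by (rule good_sets[OF U_good])
      show "AE \<omega> in M. \<omega> \<in> H \<longrightarrow> \<omega> \<in> (\<Union>k. U k)" by (rule AE_I2) (auto simp: H_def U_def)
    qed (rule \<eta>)
    have "good (H - U n)" using n H_sets good_sets[OF U_good] by (intro good_small) auto
    moreover have "H = U n \<union> (H - U n)" by (auto simp: H_def U_def)
    ultimately show ?thesis using good_Un[OF U_good] by metis
  qed
  have "measure M (K - H) \<le> Inf V + 1 / real (Suc j)" for j
  proof -
    have "measure M (K - H) \<le> measure M (K - G j)"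
      using K(1) good_sets[OF G(1)] H_sets fin[of "K - G j"]
      by (intro measure_mono_fmeasurable) (auto simp: H_def fmeasurable_def)
    then show ?thesis using G(3)[of j] by linarith
  qed
  then have "measure M (K - H) \<le> Inf V"
  proof -
    assume le: "\<And>j. measure M (K - H) \<le> Inf V + 1 / real (Suc j)"
    have "(\<lambda>j. Inf V + 1 / real (Suc j)) \<longlonglongrightarrow> Inf V + 0"
      by (intro tendsto_add tendsto_const LIMSEQ_Suc[OF lim_const_over_n])
    then show ?thesis using le LIMSEQ_le_const[of _ "Inf V + 0"] by auto
  qed
  note H_inf = this
  have "emeasure M (K - H) = 0"
  proof (rule ccontr)
    assume "emeasure M (K - H) \<noteq> 0"
    then have pos: "0 < emeasure M (K - H)" by (simp add: zero_less_iff_neq_zero)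
    have KH: "K - H \<in> sets M" using K(1) H_sets by auto
    obtain C where C: "C \<in> sets M" "C \<subseteq> K - H" "0 < emeasure M C" "emeasure M C \<le> ennreal \<eta>"
      using atomless_small_subset[OF atomless KH pos fin[OF Diff_subset] \<eta>] by blast
    have C_pos: "0 < measure M C"
    proof -
      have "C \<subseteq> K" using C(2) by blast
      then show ?thesis using C(3) fin[of C] by (simp add: measure_def enn2real_positive_iff)
    qed
    have "Inf V \<le> measure M (K - (H \<union> C))"
      using C(2) H_sub by (intro V_le good_Un H_good good_small C) auto
    also have "K - (H \<union> C) = (K - H) - C" by auto
    also have "measure M ((K - H) - C) = measure M (K - H) - measure M C"
      using C KH fin[of "K - H"] by (intro measure_Diff) auto
    finally show False using H_inf C_pos by linarith
  qed
  then have "good (K - H)" using K(1) H_sets by (intro good_small) auto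
  then have "good K" using good_Un[OF H_good] H_sub by (metis Diff_partition)
  then show ?thesis using that unfolding good_def by blast
qed

section \<open>Smallness on locally small sets\<close>

text \<open>The two conditions on small sets and on the complement of a set of finite measure in one: a
  set \<open>A\<close> is small when its part inside \<open>K\<close> is. Boundedness in \<open>L\<^sub>1\<close> is not included. The
  functions may take the value \<open>\<infinity>\<close>, as negative parts of integrands do.\<close>

definition equi_small :: "'w measure \<Rightarrow> real \<Rightarrow> ('w \<Rightarrow> ennreal) set \<Rightarrow> bool" where
  "equi_small M \<epsilon> X \<longleftrightarrow> (\<exists>\<eta>>0. \<exists>K\<in>sets M. emeasure M K < \<infinity> \<and>
     (\<forall>w\<in>X. \<forall>A\<in>sets M. emeasure M (A \<inter> K) \<le> ennreal \<eta> \<longrightarrow> (\<integral>\<^sup>+\<omega>\<in>A. w \<omega> \<partial>M) \<le> ennreal \<epsilon>))"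

lemma equi_small_Un:
  assumes "equi_small M \<epsilon> X" "equi_small M \<epsilon> Y"
  shows "equi_small M \<epsilon> (X \<union> Y)"
proof -
  obtain \<eta>1 K1 where 1: "0 < \<eta>1" "K1 \<in> sets M" "emeasure M K1 < \<infinity>"
    "\<And>w A. w \<in> X \<Longrightarrow> A \<in> sets M \<Longrightarrow> emeasure M (A \<inter> K1) \<le> ennreal \<eta>1 \<Longrightarrow> (\<integral>\<^sup>+\<omega>\<in>A. w \<omega> \<partial>M) \<le> ennreal \<epsilon>"
    using assms(1) unfolding equi_small_def by blast
  obtain \<eta>2 K2 where 2: "0 < \<eta>2" "K2 \<in> sets M" "emeasure M K2 < \<infinity>"
    "\<And>w A. w \<in> Y \<Longrightarrow> A \<in> sets M \<Longrightarrow> emeasure M (A \<inter> K2) \<le> ennreal \<eta>2 \<Longrightarrow> (\<integral>\<^sup>+\<omega>\<in>A. w \<omega> \<partial>M) \<le> ennreal \<epsilon>"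
    using assms(2) unfolding equi_small_def by blast
  show ?thesis unfolding equi_small_def
  proof (intro exI[of _ "min \<eta>1 \<eta>2"] conjI bexI[of _ "K1 \<union> K2"] ballI impI)
    have "emeasure M (K1 \<union> K2) \<le> emeasure M K1 + emeasure M K2"
      by (rule emeasure_subadditive) (use 1 2 in auto)
    then show "emeasure M (K1 \<union> K2) < \<infinity>" using 1(3) 2(3) by (auto intro: order_le_less_trans)
    fix w A assume w: "w \<in> X \<union> Y" and A: "A \<in> sets M" and small:
      "emeasure M (A \<inter> (K1 \<union> K2)) \<le> ennreal (min \<eta>1 \<eta>2)"
    have "emeasure M (A \<inter> K1) \<le> emeasure M (A \<inter> (K1 \<union> K2))"
      "emeasure M (A \<inter> K2) \<le> emeasure M (A \<inter> (K1 \<union> K2))"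
      using A 1(2) 2(2) by (auto intro!: emeasure_mono)
    moreover have "ennreal (min \<eta>1 \<eta>2) \<le> ennreal \<eta>1" "ennreal (min \<eta>1 \<eta>2) \<le> ennreal \<eta>2"
      by (auto intro!: ennreal_leI)
    ultimately have "emeasure M (A \<inter> K1) \<le> ennreal \<eta>1" "emeasure M (A \<inter> K2) \<le> ennreal \<eta>2"
      using small by (meson order_trans)+
    then show "(\<integral>\<^sup>+\<omega>\<in>A. w \<omega> \<partial>M) \<le> ennreal \<epsilon>" using w A 1(4) 2(4) by blast
  qed (use 1 2 in auto)
qed

lemma set_integral_space_Diff_tendsto_0:
  fixes g :: "'w \<Rightarrow> real"
  assumes g: "integrable M g" and W: "incseq W" "\<And>j. W j \<in> sets M" "(\<Union>j. W j) = space M"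
  shows "(\<lambda>j. LINT \<omega>:space M - W j|M. g \<omega>) \<longlonglongrightarrow> 0"
proof -
  have "(\<lambda>j. LINT \<omega>:W j|M. g \<omega>) \<longlonglongrightarrow> (LINT \<omega>:(\<Union>j. W j)|M. g \<omega>)"
    by (rule set_integral_cont_up[OF W(2,1)]) (simp add: W(3) set_integrable_of_integrable[OF g])
  then have "(\<lambda>j. (LINT \<omega>|M. g \<omega>) - (LINT \<omega>:W j|M. g \<omega>)) \<longlonglongrightarrow> (LINT \<omega>|M. g \<omega>) - (LINT \<omega>|M. g \<omega>)"
    by (intro tendsto_intros) (simp add: W(3) set_integral_space[OF g])
  moreover have "(LINT \<omega>:space M - W j|M. g \<omega>) = (LINT \<omega>|M. g \<omega>) - (LINT \<omega>:W j|M. g \<omega>)" for j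
    using set_integral_Diff_split[OF set_integrable_of_integrable[OF g sets.top] W(2)
      sets.sets_into_space[OF W(2)] sets.top, of j]
    by (simp add: set_integral_space[OF g])
  ultimately show ?thesis by simp
qed

lemma integrable_small_off_finite_set:
  fixes g :: "'w \<Rightarrow> real"
  assumes M: "sigma_finite_measure M" and g: "integrable M g" and \<epsilon>: "0 < \<epsilon>"
  obtains \<eta> K where "0 < \<eta>" "K \<in> sets M" "emeasure M K < \<infinity>"
    "\<And>A. A \<in> sets M \<Longrightarrow> emeasure M (A \<inter> K) \<le> ennreal \<eta> \<Longrightarrow> (LINT \<omega>:A|M. \<bar>g \<omega>\<bar>) \<le> \<epsilon>"
proof -
  interpret sigma_finite_measure M by fact
  obtain K :: "nat \<Rightarrow> 'w set" where K: "range K \<subseteq> sets M" "(\<Union>i. K i) = space M"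
    "\<And>i. emeasure M (K i) \<noteq> \<infinity>" "incseq K"
    using sigma_finite_incseq by metis
  have K_meas: "K j \<in> sets M" for j using K(1) by auto
  have "\<forall>\<^sub>F j in sequentially. (LINT \<omega>:space M - K j|M. \<bar>g \<omega>\<bar>) < \<epsilon> / 2"
    using set_integral_space_Diff_tendsto_0[OF integrable_abs[OF g] K(4) K_meas K(2)] \<epsilon>
    by (intro order_tendstoD) auto
  then obtain j where j: "(LINT \<omega>:space M - K j|M. \<bar>g \<omega>\<bar>) < \<epsilon> / 2"
    by (auto simp: eventually_sequentially)
  obtain \<eta> where \<eta>: "0 < \<eta>" "\<And>A. A \<in> sets M \<Longrightarrow> emeasure M A \<le> ennreal \<eta> \<Longrightarrow> (LINT \<omega>:A|M. \<bar>g \<omega>\<bar>) \<le> \<epsilon> / 2"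
    by (rule integral_absolutely_continuous[OF integrable_abs[OF g], of "\<epsilon> / 2"]) (use \<epsilon> in auto)
  show ?thesis
  proof (rule that[OF \<eta>(1) K_meas[of j]])
    show "emeasure M (K j) < \<infinity>" using K(3)[of j] by (simp add: less_top)
    fix A assume A: "A \<in> sets M" and small: "emeasure M (A \<inter> K j) \<le> ennreal \<eta>"
    note int = set_integrable_of_integrable[OF integrable_abs[OF g]]
    have "(LINT \<omega>:A|M. \<bar>g \<omega>\<bar>) = (LINT \<omega>:A \<inter> K j|M. \<bar>g \<omega>\<bar>) + (LINT \<omega>:A - (A \<inter> K j)|M. \<bar>g \<omega>\<bar>)"
      by (rule set_integral_Diff_split[OF int]) (use A K_meas in auto)
    also have "(LINT \<omega>:A \<inter> K j|M. \<bar>g \<omega>\<bar>) \<le> \<epsilon> / 2" using A K_meas small by (intro \<eta>(2)) auto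
    also have "(LINT \<omega>:A - (A \<inter> K j)|M. \<bar>g \<omega>\<bar>) \<le> (LINT \<omega>:space M - K j|M. \<bar>g \<omega>\<bar>)"
      by (rule set_integral_mono_set[OF int]) (use A K_meas sets.sets_into_space[OF A] in auto)
    also note j
    finally show "(LINT \<omega>:A|M. \<bar>g \<omega>\<bar>) \<le> \<epsilon>" by simp
  qed
qed

lemma equi_small_integrable:
  fixes g :: "'w \<Rightarrow> real"
  assumes M: "sigma_finite_measure M" and g: "integrable M g" and \<epsilon>: "0 < \<epsilon>"
  shows "equi_small M \<epsilon> {\<lambda>\<omega>. ennreal \<bar>g \<omega>\<bar>}"
proof -
  obtain \<eta> K where "0 < \<eta>" "K \<in> sets M" "emeasure M K < \<infinity>"
    and small: "\<And>A. A \<in> sets M \<Longrightarrow> emeasure M (A \<inter> K) \<le> ennreal \<eta> \<Longrightarrow> (LINT \<omega>:A|M. \<bar>g \<omega>\<bar>) \<le> \<epsilon>"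
    using integrable_small_off_finite_set[OF M g \<epsilon>] by blast
  then show ?thesis
    unfolding equi_small_def by (intro exI[of _ \<eta>] conjI bexI[of _ K]) (auto simp:
      set_nn_integral_abs_eq[OF g] ennreal_leI)
qed

lemma set_integral_tendsto_0_local:
  fixes g :: "'w \<Rightarrow> real"
  assumes M: "sigma_finite_measure M" and g: "integrable M g" and A: "\<And>n. A n \<in> sets M"
    and local: "\<And>B. B \<in> sets M \<Longrightarrow> emeasure M B < \<infinity> \<Longrightarrow> (\<lambda>n. emeasure M (B \<inter> A n)) \<longlonglongrightarrow> 0"
  shows "(\<lambda>n. LINT \<omega>:A n|M. g \<omega>) \<longlonglongrightarrow> 0"
proof (rule LIMSEQ_I)
  fix \<epsilon> :: real assume \<epsilon>: "0 < \<epsilon>"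
  then have "0 < \<epsilon> / 2" by simp
  from integrable_small_off_finite_set[OF M g this]
  obtain \<eta> K where \<eta>: "0 < \<eta>" and K: "K \<in> sets M" "emeasure M K < \<infinity>"
    and small: "\<And>A. A \<in> sets M \<Longrightarrow> emeasure M (A \<inter> K) \<le> ennreal \<eta> \<Longrightarrow> (LINT \<omega>:A|M. \<bar>g \<omega>\<bar>) \<le> \<epsilon> / 2" by blast
  have "\<forall>\<^sub>F n in sequentially. emeasure M (K \<inter> A n) < ennreal \<eta>"
    using local[OF K] \<eta> by (intro order_tendstoD) auto
  then obtain n0 where n0: "\<And>n. n0 \<le> n \<Longrightarrow> emeasure M (K \<inter> A n) < ennreal \<eta>"
    by (auto simp: eventually_sequentially)
  have "norm ((LINT \<omega>:A n|M. g \<omega>) - 0) < \<epsilon>" if "n0 \<le> n" for n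
  proof -
    have "norm (LINT \<omega>:A n|M. g \<omega>) \<le> (LINT \<omega>:A n|M. norm (g \<omega>))"
      by (rule set_integral_norm_bound[OF set_integrable_of_integrable[OF g A]])
    also have "\<dots> \<le> \<epsilon> / 2" using small[OF A, of n] n0[OF that] by (simp add: Int_commute less_imp_le)
    finally show ?thesis using \<epsilon> by simp
  qed
  then show "\<exists>n0. \<forall>n\<ge>n0. norm ((LINT \<omega>:A n|M. g \<omega>) - 0) < \<epsilon>" by blast
qed

lemma equi_small_UNION:
  assumes "finite I" "0 < \<epsilon>" "\<And>i. i \<in> I \<Longrightarrow> equi_small M \<epsilon> (X i)"
  shows "equi_small M \<epsilon> (\<Union>i\<in>I. X i)"
  using assms(1,3)
proof (induction I rule: finite_induct)
  case empty
  show ?case unfolding equi_small_def by (intro exI[of _ 1] conjI bexI[of _ "{}"]) auto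
next
  case (insert i I)
  then show ?case by (auto intro: equi_small_Un)
qed

text \<open>Equi-smallness for a given \<open>\<epsilon>\<close> is only known from some index on that depends on \<open>\<epsilon>\<close>. The
  finitely many integrable functions in between are small individually.\<close>

lemma equi_small_imp_unif_integrable:
  assumes M: "sigma_finite_measure M" and g: "\<And>n. n0 \<le> n \<Longrightarrow> integrable M (g n)"
    and bound: "\<And>n. n0 \<le> n \<Longrightarrow> (\<integral>\<^sup>+\<omega>. ennreal \<bar>g n \<omega>\<bar> \<partial>M) \<le> ennreal C"
    and tail: "\<And>\<epsilon>. 0 < \<epsilon> \<Longrightarrow> \<exists>n1. equi_small M \<epsilon> ((\<lambda>n \<omega>. ennreal \<bar>g n \<omega>\<bar>) ` {n1..})"
  shows "unif_integrable M (g ` {n0 :: nat..})"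
  unfolding unif_integrable_def
proof (intro conjI ballI allI impI)
  show "integrable M u" if "u \<in> g ` {n0..}" for u using that g by auto
  have "(SUP u\<in>g ` {n0..}. \<integral>\<^sup>+\<omega>. ennreal \<bar>u \<omega>\<bar> \<partial>M) \<le> ennreal C"
    using bound by (intro SUP_least) auto
  then show "(SUP u\<in>g ` {n0..}. \<integral>\<^sup>+\<omega>. ennreal \<bar>u \<omega>\<bar> \<partial>M) < \<infinity>" by (simp add: order_le_less_trans)
  fix \<epsilon> :: real assume \<epsilon>: "0 < \<epsilon>"
  let ?w = "\<lambda>n \<omega>. ennreal \<bar>g n \<omega>\<bar>"
  obtain n1 where n1: "equi_small M (\<epsilon> / 2) (?w ` {n1..})" using tail[of "\<epsilon> / 2"] \<epsilon> by auto
  \<comment> \<open>the finitely many functions before \<open>n1\<close> are small one by one\<close>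
  have "equi_small M (\<epsilon> / 2) (\<Union>n\<in>{n0..<n1}. {?w n})"
    using \<epsilon> by (intro equi_small_UNION equi_small_integrable[OF M g]) auto
  moreover define X where "X = (\<Union>n\<in>{n0..<n1}. {?w n}) \<union> ?w ` {n1..}"
  ultimately have "equi_small M (\<epsilon> / 2) X" using n1 by (simp only: equi_small_Un)
  then obtain \<eta> K where \<eta>: "0 < \<eta>" and K: "K \<in> sets M" "emeasure M K < \<infinity>"
    and small: "\<And>w A. w \<in> X \<Longrightarrow> A \<in> sets M \<Longrightarrow>
      emeasure M (A \<inter> K) \<le> ennreal \<eta> \<Longrightarrow> (\<integral>\<^sup>+\<omega>\<in>A. w \<omega> \<partial>M) \<le> ennreal (\<epsilon> / 2)"
    unfolding equi_small_def by blast
  have mem: "?w n \<in> X" if "n0 \<le> n" for n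
    using that unfolding X_def by (cases "n < n1") auto
  have SUP_less: "(SUP u\<in>g ` {n0..}. \<integral>\<^sup>+\<omega>\<in>A. ennreal \<bar>u \<omega>\<bar> \<partial>M) < ennreal \<epsilon>"
    if "A \<in> sets M" "emeasure M (A \<inter> K) \<le> ennreal \<eta>" for A
  proof -
    have "(SUP u\<in>g ` {n0..}. \<integral>\<^sup>+\<omega>\<in>A. ennreal \<bar>u \<omega>\<bar> \<partial>M) \<le> ennreal (\<epsilon> / 2)"
      using small[OF mem that] by (intro SUP_least) auto
    also have "\<dots> < ennreal \<epsilon>" using \<epsilon> by (simp add: ennreal_less_iff)
    finally show ?thesis .
  qed
  show "\<exists>\<eta>>0. \<exists>K\<in>sets M. emeasure M K < \<infinity> \<and>
        (\<forall>A\<in>sets M. emeasure M A \<le> ennreal \<eta> \<longrightarrow> (SUP u\<in>g ` {n0..}. \<integral>\<^sup>+\<omega>\<in>A. ennreal \<bar>u \<omega>\<bar> \<partial>M) <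
          ennreal \<epsilon>) \<and>
        (SUP u\<in>g ` {n0..}. \<integral>\<^sup>+\<omega>\<in>(space M - K). ennreal \<bar>u \<omega>\<bar> \<partial>M) < ennreal \<epsilon>"
  proof (intro exI[of _ \<eta>] conjI \<eta> bexI[of _ K] K ballI impI)
    show "(SUP u\<in>g ` {n0..}. \<integral>\<^sup>+\<omega>\<in>A. ennreal \<bar>u \<omega>\<bar> \<partial>M) < ennreal \<epsilon>"
      if A: "A \<in> sets M" "emeasure M A \<le> ennreal \<eta>" for A
      by (rule SUP_less[OF A(1) order_trans[OF emeasure_mono A(2)]]) (use A in auto)
    have "(space M - K) \<inter> K = {}" by auto
    then show "(SUP u\<in>g ` {n0..}. \<integral>\<^sup>+\<omega>\<in>(space M - K). ennreal \<bar>u \<omega>\<bar> \<partial>M) < ennreal \<epsilon>"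
      using K by (intro SUP_less) auto
  qed
qed

text \<open>A finite cover of \<open>K\<close> by small sets bounds the integral by the number of these sets plus one
  for the complement of \<open>K\<close>.\<close>

lemma equi_small_atomless_bounded:
  assumes atomless: "atomless M" and small: "equi_small M 1 X" and meas: "\<And>w. w \<in> X \<Longrightarrow>
    w \<in> borel_measurable M"
  obtains C :: real where "\<And>w. w \<in> X \<Longrightarrow> (\<integral>\<^sup>+\<omega>. w \<omega> \<partial>M) \<le> ennreal C"
proof -
  obtain \<eta> K where \<eta>: "0 < \<eta>" and K: "K \<in> sets M" "emeasure M K < \<infinity>"
    and small: "\<And>w A. w \<in> X \<Longrightarrow> A \<in> sets M \<Longrightarrow> emeasure M (A \<inter> K) \<le> ennreal \<eta> \<Longrightarrow>
      (\<integral>\<^sup>+\<omega>\<in>A. w \<omega> \<partial>M) \<le> ennreal 1"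
    using small unfolding equi_small_def by blast
  obtain \<C> where \<C>: "finite \<C>" "\<C> \<subseteq> sets M" "\<And>C. C \<in> \<C> \<Longrightarrow> emeasure M C \<le> ennreal \<eta>" "K = \<Union>\<C>"
    using atomless_finite_cover[OF atomless K \<eta>] by blast
  show ?thesis
  proof (rule that[of "real (card \<C>) + 1"])
    fix w assume w: "w \<in> X"
    have [measurable]: "w \<in> borel_measurable M" by (rule meas[OF w])
    have C_sets: "C \<in> sets M" if "C \<in> \<C>" for C using that \<C>(2) by blast
    have "(\<integral>\<^sup>+\<omega>. w \<omega> \<partial>M) \<le> (\<integral>\<^sup>+\<omega>. (\<Sum>C\<in>\<C>. w \<omega> * indicator C \<omega>) + w \<omega> * indicator (space M - K) \<omega> \<partial>M)"
    proof (rule nn_integral_mono)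
      fix \<omega> assume \<omega>: "\<omega> \<in> space M"
      show "w \<omega> \<le> (\<Sum>C\<in>\<C>. w \<omega> * indicator C \<omega>) + w \<omega> * indicator (space M - K) \<omega>"
      proof (cases "\<omega> \<in> K")
        case True
        then obtain C where C: "C \<in> \<C>" "\<omega> \<in> C" using \<C>(4) by blast
        have "w \<omega> * indicator C \<omega> \<le> (\<Sum>C\<in>\<C>. w \<omega> * indicator C \<omega>)"
          by (rule member_le_sum[OF C(1) _ \<C>(1)]) auto
        with C(2) True show ?thesis by simp
      next
        case False with \<omega> show ?thesis by simp
      qed
    qed
    also have "\<dots> = (\<Sum>C\<in>\<C>. \<integral>\<^sup>+\<omega>\<in>C. w \<omega> \<partial>M) + (\<integral>\<^sup>+\<omega>\<in>(space M - K). w \<omega> \<partial>M)"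
      using C_sets K by (subst nn_integral_add) (auto simp: nn_integral_sum intro!:
        borel_measurable_sum borel_measurable_times_ennreal)
    also have "\<dots> \<le> (\<Sum>C\<in>\<C>. ennreal 1) + ennreal 1"
    proof (intro add_mono sum_mono small[OF w])
      show "emeasure M (C \<inter> K) \<le> ennreal \<eta>" if "C \<in> \<C>" for C
        using \<C>(3)[OF that] emeasure_mono[of "C \<inter> K" C M] C_sets[OF that] by (auto intro: order_trans)
      have "(space M - K) \<inter> K = {}" by auto
      then show "emeasure M ((space M - K) \<inter> K) \<le> ennreal \<eta>" by simp
    qed (use C_sets K in auto)
    also have "\<dots> = ennreal (real (card \<C>) + 1)" by (simp add: ennreal_of_nat_eq_real_of_nat
      ennreal_plus)
    finally show "(\<integral>\<^sup>+\<omega>. w \<omega> \<partial>M) \<le> ennreal (real (card \<C>) + 1)" .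
  qed
qed

text \<open>Exhaust the space by sets \<open>K j\<close> of finite measure and use the failure for \<open>K j\<close> and
  \<open>\<eta> = 1 / (j + 1)\<close>: the part of a set \<open>B\<close> of finite measure in \<open>A j\<close> is then covered by \<open>B - K j\<close>
  and a set of measure at most \<open>1 / (j + 1)\<close>.\<close>

lemma not_equi_small_witnesses:
  fixes w :: "nat \<Rightarrow> 'w \<Rightarrow> ennreal"
  assumes M: "sigma_finite_measure M" and not: "\<And>n. \<not> equi_small M \<delta> (w ` {n..})"
  obtains m A where "strict_mono m" "\<And>j. A j \<in> sets M" "\<And>j. ennreal \<delta> < (\<integral>\<^sup>+\<omega>\<in>A j. w (m j) \<omega> \<partial>M)"
    "\<And>B. B \<in> sets M \<Longrightarrow> emeasure M B < \<infinity> \<Longrightarrow> (\<lambda>j. emeasure M (B \<inter> A j)) \<longlonglongrightarrow> 0"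
proof -
  interpret sigma_finite_measure M by fact
  obtain K :: "nat \<Rightarrow> 'w set" where K: "range K \<subseteq> sets M" "(\<Union>i. K i) = space M"
    "\<And>i. emeasure M (K i) \<noteq> \<infinity>" "incseq K"
    using sigma_finite_incseq by metis
  have K_meas [measurable]: "K j \<in> sets M" for j using K(1) by auto
  define bad where "bad j F \<longleftrightarrow> snd F \<in> sets M \<and> emeasure M (snd F \<inter> K j) \<le> ennreal (1 / real (Suc j)) \<and>
    ennreal \<delta> < (\<integral>\<^sup>+\<omega>\<in>snd F. w (fst F) \<omega> \<partial>M)" for j and F :: "nat \<times> 'w set"
  have ex: "\<exists>F. bad j F \<and> n \<le> fst F" for j n
  proof (rule ccontr)
    assume none: "\<not> ?thesis"
    have "equi_small M \<delta> (w ` {n..})" unfolding equi_small_def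
    proof (intro exI[of _ "1 / real (Suc j)"] conjI bexI[of _ "K j"] ballI impI)
      show "emeasure M (K j) < \<infinity>" using K(3)[of j] by (simp add: less_top)
      fix u A assume "u \<in> w ` {n..}" and A: "A \<in> sets M"
        "emeasure M (A \<inter> K j) \<le> ennreal (1 / real (Suc j))"
      then obtain k where "n \<le> k" "u = w k" by auto
      with none A show "(\<integral>\<^sup>+\<omega>\<in>A. u \<omega> \<partial>M) \<le> ennreal \<delta>" by (auto simp: bad_def not_less)
    qed auto
    with not show False by blast
  qed
  have "\<exists>F. \<forall>j. bad j (F j) \<and> fst (F j) < fst (F (Suc j))"
  proof (rule dependent_nat_choice)
    show "\<exists>F. bad 0 F" using ex by blast
    show "\<exists>F'. bad (Suc j) F' \<and> fst F < fst F'" for F j using ex[of "Suc j" "Suc (fst F)"]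
      by (auto simp: Suc_le_eq)
  qed
  then obtain F where bad: "\<And>j. bad j (F j)" and mono: "\<And>j. fst (F j) < fst (F (Suc j))" by blast
  show ?thesis
  proof (rule that[of "\<lambda>j. fst (F j)" "\<lambda>j. snd (F j)"])
    show "strict_mono (\<lambda>j. fst (F j))" using mono by (simp add: strict_mono_Suc_iff)
    show "snd (F j) \<in> sets M" "ennreal \<delta> < (\<integral>\<^sup>+\<omega>\<in>snd (F j). w (fst (F j)) \<omega> \<partial>M)" for j
      using bad[of j] by (auto simp: bad_def)
    have F_meas [measurable]: "snd (F j) \<in> sets M" for j using bad[of j] by (simp add: bad_def)
    fix B assume B [measurable]: "B \<in> sets M" and B_fin: "emeasure M B < \<infinity>"
    have lim: "(\<lambda>j. emeasure M (B - K j) + ennreal (1 / real (Suc j))) \<longlonglongrightarrow> 0 + ennreal 0"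
    proof (intro tendsto_add tendsto_ennrealI)
      have "(\<lambda>j. emeasure M (B - K j)) \<longlonglongrightarrow> emeasure M (\<Inter>j. B - K j)"
      proof (rule Lim_emeasure_decseq)
        show "decseq (\<lambda>j. B - K j)" using K(4) by (auto simp: incseq_def decseq_def)
        show "emeasure M (B - K j) \<noteq> \<infinity>" for j
          using emeasure_mono[of "B - K j" B M] B B_fin by (auto simp: top_unique)
      qed auto
      moreover have "(\<Inter>j. B - K j) = {}" using K(2) sets.sets_into_space[OF B] by auto
      ultimately show "(\<lambda>j. emeasure M (B - K j)) \<longlonglongrightarrow> 0" by (simp only: emeasure_empty)
      show "(\<lambda>j. 1 / real (Suc j)) \<longlonglongrightarrow> 0" by (rule LIMSEQ_Suc[OF lim_const_over_n])
    qed
    show "(\<lambda>j. emeasure M (B \<inter> snd (F j))) \<longlonglongrightarrow> 0"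
    proof (rule tendsto_sandwich[OF _ _ tendsto_const])
      show "\<forall>\<^sub>F j in sequentially. emeasure M (B \<inter> snd (F j)) \<le>
        emeasure M (B - K j) + ennreal (1 / real (Suc j))"
      proof (rule always_eventually, rule allI)
        fix j
        have "emeasure M (B \<inter> snd (F j)) \<le> emeasure M ((B - K j) \<union> (snd (F j) \<inter> K j))"
          by (rule emeasure_mono) auto
        also have "\<dots> \<le> emeasure M (B - K j) + emeasure M (snd (F j) \<inter> K j)"
          by (rule emeasure_subadditive) auto
        also have "\<dots> \<le> emeasure M (B - K j) + ennreal (1 / real (Suc j))"
          using bad[of j] by (intro add_left_mono) (simp add: bad_def)
        finally show "emeasure M (B \<inter> snd (F j)) \<le> emeasure M (B - K j) + ennreal (1 / real (Suc j))" .
      qed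
    qed (use lim in auto)
  qed
qed

section \<open>Necessity of Ioffe's criterion\<close>

lemma superpos_glue_AE:
  fixes u u' :: "('w \<Rightarrow> 'e::topological_space) set" and v v' :: "('w \<Rightarrow> 'b::topological_space) set"
  assumes [measurable]: "A \<in> sets M" and L0: "u \<in> L0 M" "u' \<in> L0 M" "v \<in> L0 M" "v' \<in> L0 M"
  shows "AE \<omega> in M. superpos f (glue M A u u', glue M A v v') \<omega> =
    (if \<omega> \<in> A then superpos f (u, v) \<omega> else superpos f (u', v') \<omega>)"
proof -
  note [measurable] = rep_measurable[OF L0(1)] rep_measurable[OF L0(2)] rep_measurable[OF L0(3)]
    rep_measurable[OF L0(4)]
  have "AE \<omega> in M. rep (glue M A u u') \<omega> = (if \<omega> \<in> A then rep u \<omega> else rep u' \<omega>)"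
    unfolding glue_def by (rule AE_rep_cls) measurable
  moreover have "AE \<omega> in M. rep (glue M A v v') \<omega> = (if \<omega> \<in> A then rep v \<omega> else rep v' \<omega>)"
    unfolding glue_def by (rule AE_rep_cls) measurable
  ultimately show ?thesis by eventually_elim (simp add: superpos_def)
qed

text \<open>Lower semicontinuity bounds the functional at \<open>(x, y)\<close> by the bound along the sequence, so
  \<open>f (x, y)\<close> is integrable. The claim \<open>tail\<close> is the competitor argument: pasting \<open>s (m j)\<close> into
  \<open>(x, y)\<close> on \<open>D j\<close> costs only the integral of \<open>f (x, y)\<close> over \<open>D j\<close>, which tends to zero, and
  gains at least \<open>\<delta>\<close>.\<close>

lemma seq_lsc_at_imp_ioffe_criterion:
  fixes M :: "'w measure"
    and S :: "('w \<Rightarrow> 'e::metric_space) set topology"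
    and T :: "('w \<Rightarrow> 'f::{banach, second_countable_topology}) set topology"
    and f :: "'w \<Rightarrow> 'e \<times> 'f \<Rightarrow> ereal"
  assumes M: "sigma_finite_measure M"
    and S_L0: "topspace S \<subseteq> L0 M" and T_L0: "topspace T \<subseteq> L0 M"
    and x: "x \<in> topspace S" and y: "y \<in> topspace T"
    and f: "case_prod f \<in> borel_measurable (M \<Otimes>\<^sub>M (borel :: ('e \<times> 'f) measure))"
    and atomless: "atomless M" and not_minf: "int_functional M f (x, y) \<noteq> -\<infinity>"
    and dec: "decomposable M (topspace S)" "decomposable M (topspace T)"
    and glue_lim: "\<And>A xs ys. (\<And>n :: nat. A n \<in> sets M) \<Longrightarrow>
      (\<And>B. B \<in> sets M \<Longrightarrow> emeasure M B < \<infinity> \<Longrightarrow> (\<lambda>n. emeasure M (B \<inter> A n)) \<longlonglongrightarrow> 0) \<Longrightarrow>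
      (\<And>n. xs n \<in> topspace S) \<Longrightarrow> (\<And>n. ys n \<in> topspace T) \<Longrightarrow>
      limitin (prod_topology S T) (\<lambda>n. (xs n, ys n)) (x, y) sequentially \<Longrightarrow>
      limitin (prod_topology S T) (\<lambda>n. (glue M (A n) (xs n) x, glue M (A n) (ys n) y)) (x, y)
        sequentially"
    and lsc: "seq_lsc_at (prod_topology S T) (int_functional M f) (x, y)"
  shows "ioffe_criterion M S T f (x, y)"
  unfolding ioffe_criterion_def
proof (intro allI impI, elim conjE exE)
  fix s and C :: real
  assume s_in: "\<forall>n. s n \<in> topspace S \<times> topspace T"
    and s_lim: "limitin (prod_topology S T) s (x, y) sequentially"
    and s_bound: "\<forall>n. int_functional M f (s n) \<le> ereal C"
  let ?I = "int_functional M f"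
  define v where "v n = superpos f (s n)" for n
  define v0 where "v0 = superpos f (x, y)"
  have s_mem: "fst (s n) \<in> topspace S" "snd (s n) \<in> topspace T" for n
    using s_in by (auto simp: mem_Times_iff)
  have xy_L0: "x \<in> L0 M" "y \<in> L0 M" and s_L0: "fst (s n) \<in> L0 M" "snd (s n) \<in> L0 M" for n
    using x y s_mem S_L0 T_L0 by blast+
  have v_meas [measurable]: "v n \<in> borel_measurable M" for n
    using superpos_measurable[OF f s_L0(1)[of n] s_L0(2)[of n]] by (simp add: v_def)
  have v0_meas [measurable]: "v0 \<in> borel_measurable M"
    unfolding v0_def by (rule superpos_measurable[OF f xy_L0])
  have lsc': "?I (x, y) \<le> liminf (\<lambda>n. ?I (p n))"
    if "\<And>n. p n \<in> topspace S \<times> topspace T" "limitin (prod_topology S T) p (x, y) sequentially" for p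
    using lsc that unfolding seq_lsc_at_def by simp
  have "?I (x, y) \<le> liminf (\<lambda>n. ?I (s n))" using s_in s_lim by (intro lsc') auto
  also have "\<dots> \<le> liminf (\<lambda>n. ereal C)" using s_bound by (intro Liminf_mono) auto
  also have "\<dots> = ereal C" by (simp add: Liminf_const)
  finally have "?I (x, y) \<noteq> \<infinity>" by auto
  then obtain r0 where r0_int: "integrable M r0" and r0_eq: "AE \<omega> in M. v0 \<omega> = ereal (r0 \<omega>)"
    using upper_integral_finite_imp_integrable[OF M v0_meas] not_minf
    unfolding int_functional_def v0_def by blast
  have I_eq: "?I (x, y) = ereal (LINT \<omega>|M. r0 \<omega>)"
    using upper_integral_eq_integral[OF r0_int r0_eq] by (simp add: int_functional_def v0_def)
  define w where "w n \<omega> = e2ennreal (- v n \<omega>)" for n \<omega>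
  have w_meas [measurable]: "w n \<in> borel_measurable M" for n unfolding w_def[abs_def] by measurable
  have tail: "\<exists>n. equi_small M \<delta> (w ` {n..})" if \<delta>: "0 < \<delta>" for \<delta>
  proof (rule ccontr)
    assume "\<not> ?thesis"
    then have not: "\<And>n. \<not> equi_small M \<delta> (w ` {n..})" by blast
    obtain m A where m: "strict_mono m" and A_sets: "\<And>j. A j \<in> sets M"
      and A_large: "\<And>j. ennreal \<delta> < (\<integral>\<^sup>+\<omega>\<in>A j. w (m j) \<omega> \<partial>M)"
      and A_local: "\<And>B. B \<in> sets M \<Longrightarrow> emeasure M B < \<infinity> \<Longrightarrow> (\<lambda>j. emeasure M (B \<inter> A j)) \<longlonglongrightarrow> 0"
      using not_equi_small_witnesses[OF M not] by blast
    note [measurable] = A_sets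
    \<comment> \<open>only the part where the integrand is negative matters\<close>
    define D where "D j = A j \<inter> {\<omega> \<in> space M. v (m j) \<omega> < 0}" for j
    have D_sets [measurable]: "D j \<in> sets M" for j unfolding D_def by measurable
    have D_local: "(\<lambda>j. emeasure M (B \<inter> D j)) \<longlonglongrightarrow> 0" if B: "B \<in> sets M" "emeasure M B < \<infinity>" for B
    proof (rule tendsto_sandwich[OF _ _ tendsto_const A_local[OF B]])
      show "\<forall>\<^sub>F j in sequentially. emeasure M (B \<inter> D j) \<le> emeasure M (B \<inter> A j)"
        using B A_sets by (intro always_eventually allI emeasure_mono) (auto simp: D_def)
    qed auto
    define p where "p j = (glue M (D j) (fst (s (m j))) x, glue M (D j) (snd (s (m j))) y)" for j
    have "limitin (prod_topology S T) p (x, y) sequentially"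
      unfolding p_def
    proof (rule glue_lim[OF D_sets D_local])
      show "limitin (prod_topology S T) (\<lambda>n. (fst (s (m n)), snd (s (m n)))) (x, y) sequentially"
        using limitin_compose_strict_mono[OF s_lim m] by simp
    qed (auto simp: s_mem)
    moreover have "p j \<in> topspace S \<times> topspace T" for j
      using dec s_mem[of "m j"] x y D_sets[of j] unfolding p_def decomposable_def by simp
    ultimately have I_le: "?I (x, y) \<le> liminf (\<lambda>j. ?I (p j))" by (intro lsc') auto
    have p_le: "?I (p j) \<le> ereal ((LINT \<omega>|M. r0 \<omega>) - (LINT \<omega>:D j|M. r0 \<omega>) - \<delta>)" for j
    proof -
      have "(\<integral>\<^sup>+\<omega>\<in>A j. w (m j) \<omega> \<partial>M) = (\<integral>\<^sup>+\<omega>\<in>D j. w (m j) \<omega> \<partial>M)"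
        by (rule nn_integral_cong) (auto simp: D_def w_def indicator_def e2ennreal_neg not_less
          ereal_uminus_le_0_iff)
      with A_large[of j] have large: "ennreal \<delta> < (\<integral>\<^sup>+\<omega>. w (m j) \<omega> * indicator (D j) \<omega> \<partial>M)" by simp
      have meas: "(\<lambda>\<omega>. w (m j) \<omega> * indicator (D j) \<omega>) \<in> borel_measurable M" by measurable
      obtain g where g: "integrable M g" "\<And>\<omega>. 0 \<le> g \<omega>" "\<And>\<omega>. ennreal (g \<omega>) \<le>
        w (m j) \<omega> * indicator (D j) \<omega>"
        "ennreal \<delta> < ennreal (LINT \<omega>|M. g \<omega>)"
        using integrable_minorant[OF M meas large] by blast
      have g_large: "\<delta> \<le> (LINT \<omega>|M. g \<omega>)" using g(4) \<delta> by (simp add: ennreal_less_iff)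
      have r0_D: "integrable M (\<lambda>\<omega>. indicator (D j) \<omega> *\<^sub>R r0 \<omega>)"
        by (rule integrable_mult_indicator[OF D_sets r0_int])
      have "AE \<omega> in M. superpos f (p j) \<omega> = (if \<omega> \<in> D j then v (m j) \<omega> else v0 \<omega>)"
        using superpos_glue_AE[OF D_sets s_L0(1) xy_L0(1) s_L0(2) xy_L0(2), where f = f, of j "m j"
          "m j"]
        unfolding p_def v_def v0_def prod.collapse .
      then have "AE \<omega> in M. superpos f (p j) \<omega> \<le> ereal (r0 \<omega> - indicator (D j) \<omega> *\<^sub>R r0 \<omega> - g \<omega>)"
        using r0_eq
      proof eventually_elim
        case (elim \<omega>)
        show ?case
        proof (cases "\<omega> \<in> D j")
          case True
          have "ennreal (g \<omega>) \<le> e2ennreal (- v (m j) \<omega>)" using g(3)[of \<omega>] True by (simp add: w_def)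
          moreover have "v (m j) \<omega> < 0" using True by (simp add: D_def)
          ultimately have "v (m j) \<omega> \<le> ereal (- g \<omega>)"
            using g(2)[of \<omega>] by (cases "v (m j) \<omega>") (auto simp: e2ennreal_ereal ennreal_le_iff2)
          with True elim show ?thesis by simp
        next
          case False
          then have "ennreal (g \<omega>) \<le> 0" using g(3)[of \<omega>] by simp
          then have "g \<omega> = 0" using g(2)[of \<omega>] by (simp add: ennreal_eq_0_iff)
          with False elim show ?thesis by simp
        qed
      qed
      then have "?I (p j) \<le> ereal (LINT \<omega>|M. r0 \<omega> - indicator (D j) \<omega> *\<^sub>R r0 \<omega> - g \<omega>)"
        unfolding int_functional_def using r0_int r0_D g(1) by (intro upper_integral_le) auto
      also have "(LINT \<omega>|M. r0 \<omega> - indicator (D j) \<omega> *\<^sub>R r0 \<omega> - g \<omega>) =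
        (LINT \<omega>|M. r0 \<omega>) - (LINT \<omega>:D j|M. r0 \<omega>) - (LINT \<omega>|M. g \<omega>)"
        using r0_int r0_D g(1) by (simp add: set_lebesgue_integral_def)
      finally show ?thesis using g_large by (auto elim: order_trans)
    qed
    have "liminf (\<lambda>j. ?I (p j)) \<le> liminf (\<lambda>j. ereal ((LINT \<omega>|M. r0 \<omega>) - (LINT \<omega>:D j|M. r0 \<omega>) - \<delta>))"
      using p_le by (intro Liminf_mono always_eventually allI)
    also have "\<dots> = ereal ((LINT \<omega>|M. r0 \<omega>) - 0 - \<delta>)"
      by (intro lim_imp_Liminf tendsto_ereal tendsto_intros set_integral_tendsto_0_local[OF M r0_int
        D_sets D_local]) auto
    finally have "liminf (\<lambda>j. ?I (p j)) \<le> ereal ((LINT \<omega>|M. r0 \<omega>) - 0 - \<delta>)" .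
    with I_le have "ereal (LINT \<omega>|M. r0 \<omega>) \<le> ereal ((LINT \<omega>|M. r0 \<omega>) - 0 - \<delta>)"
      unfolding I_eq by (rule order_trans)
    then show False using \<delta> by simp
  qed
  obtain n0 where n0: "equi_small M 1 (w ` {n0..})" using tail[of 1] by auto
  obtain B :: real where "\<And>u. u \<in> w ` {n0..} \<Longrightarrow> (\<integral>\<^sup>+\<omega>. u \<omega> \<partial>M) \<le> ennreal B"
    using equi_small_atomless_bounded[OF atomless n0] w_meas by blast
  then have B: "(\<integral>\<^sup>+\<omega>. w n \<omega> \<partial>M) \<le> ennreal B" if "n0 \<le> n" for n using that by auto
  define g where "g n \<omega> = enn2real (w n \<omega>)" for n \<omega>
  have g_meas [measurable]: "g n \<in> borel_measurable M" for n unfolding g_def[abs_def] by measurable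
  have g_le: "ennreal \<bar>g n \<omega>\<bar> \<le> w n \<omega>" for n \<omega> by (simp add: g_def ennreal_enn2real_if)
  have g_bound: "(\<integral>\<^sup>+\<omega>. ennreal \<bar>g n \<omega>\<bar> \<partial>M) \<le> ennreal B" if "n0 \<le> n" for n
    using nn_integral_mono[of M "\<lambda>\<omega>. ennreal \<bar>g n \<omega>\<bar>" "w n"] g_le B[OF that]
      by (blast intro: order_trans)
  show "\<exists>n0 g. (\<forall>n\<ge>n0. AE \<omega> in M. max (- superpos f (s n) \<omega>) 0 = ereal (g n \<omega>)) \<and>
    unif_integrable M (g ` {n0..})"
  proof (intro exI[of _ n0] exI[of _ g] conjI allI impI)
    fix n assume n: "n0 \<le> n"
    have "AE \<omega> in M. w n \<omega> \<noteq> \<infinity>"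
      by (rule nn_integral_noteq_infinite) (use B[OF n] in \<open>auto simp: top_unique\<close>)
    then show "AE \<omega> in M. max (- superpos f (s n) \<omega>) 0 = ereal (g n \<omega>)"
    proof eventually_elim
      case (elim \<omega>)
      have "enn2real (ennreal (- c)) = (if 0 \<le> c then 0 else - c)" for c by (auto simp: ennreal_neg)
      with elim show ?case
        by (cases "v n \<omega>") (auto simp: g_def w_def v_def e2ennreal_ereal e2ennreal_neg max_def)
    qed
  next
    show "unif_integrable M (g ` {n0..})"
    proof (rule equi_small_imp_unif_integrable[OF M _ g_bound])
      show "integrable M (g n)" if "n0 \<le> n" for n
        using g_bound[OF that] by (intro integrableI_bounded) (auto intro: order_le_less_trans)
      fix \<epsilon> :: real assume "0 < \<epsilon>"
      then obtain n1 where n1: "equi_small M \<epsilon> (w ` {n1..})" using tail by blast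
      define X where "X = w ` {n1..}"
      have "equi_small M \<epsilon> X" using n1 by (simp only: X_def)
      then obtain \<eta> K where "0 < \<eta>" "K \<in> sets M" "emeasure M K < \<infinity>"
        and small: "\<And>u A. u \<in> X \<Longrightarrow> A \<in> sets M \<Longrightarrow> emeasure M (A \<inter> K) \<le> ennreal \<eta> \<Longrightarrow>
          (\<integral>\<^sup>+\<omega>\<in>A. u \<omega> \<partial>M) \<le> ennreal \<epsilon>"
        unfolding equi_small_def by blast
      moreover have "(\<integral>\<^sup>+\<omega>\<in>A. ennreal \<bar>g n \<omega>\<bar> \<partial>M) \<le> ennreal \<epsilon>"
        if "n1 \<le> n" "A \<in> sets M" "emeasure M (A \<inter> K) \<le> ennreal \<eta>" for n A
      proof -
        have "(\<integral>\<^sup>+\<omega>\<in>A. ennreal \<bar>g n \<omega>\<bar> \<partial>M) \<le> (\<integral>\<^sup>+\<omega>\<in>A. w n \<omega> \<partial>M)"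
          by (intro nn_integral_mono mult_right_mono g_le) auto
        also have "\<dots> \<le> ennreal \<epsilon>" using that by (intro small) (auto simp: X_def)
        finally show ?thesis .
      qed
      ultimately show "\<exists>n1. equi_small M \<epsilon> ((\<lambda>n \<omega>. ennreal \<bar>g n \<omega>\<bar>) ` {n1..})"
        unfolding equi_small_def
        by (intro exI[of _ n1] exI[of _ \<eta>] conjI bexI[of _ K]) auto
    qed
  qed
qed

section \<open>Ioffe's criterion and lower semicontinuity\<close>

theorem corollary7p6:
  fixes M :: "'w measure"
    and S :: "('w \<Rightarrow> 'e::metric_space) set topology"
    and T :: "('w \<Rightarrow> 'f::{banach, second_countable_topology}) set topology"
    and x :: "('w \<Rightarrow> 'e) set" and y :: "('w \<Rightarrow> 'f) set"
    and f :: "'w \<Rightarrow> 'e \<times> 'f \<Rightarrow> ereal"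
  assumes "sigma_finite_measure M" and "complete_measure M"
    and "reflexive_space TYPE('f)"
    and "topspace S \<subseteq> L0 M" and "topspace T \<subseteq> L0 M"
    and "\<And>u s. u \<in> topspace S \<Longrightarrow> (\<And>n. s n \<in> topspace S) \<Longrightarrow> limitin S s u sequentially \<Longrightarrow>
           tendsto_local_measure M (\<lambda>n. rep (s n)) (rep u)"
    and "\<And>v s. v \<in> topspace T \<Longrightarrow> (\<And>n. s n \<in> topspace T) \<Longrightarrow> limitin T s v sequentially \<Longrightarrow>
           tendsto_biting M (\<lambda>n. rep (s n)) (rep v)"
    and "x \<in> topspace S" and "y \<in> topspace T"
    and "case_prod f \<in> borel_measurable (M \<Otimes>\<^sub>M (borel :: ('e \<times> 'f) measure))"
    and "AE \<omega> in M. \<forall>e'. seq_lsc_at (prod_topology euclidean weak_topology) (f \<omega>) (rep x \<omega>, e')"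
    and "AE \<omega> in M. partial_biconj f \<omega> (rep x \<omega>, rep y \<omega>) = f \<omega> (rep x \<omega>, rep y \<omega>)"
  shows "(ioffe_criterion M S T f (x, y) \<longrightarrow>
            seq_lsc_at (prod_topology S T) (int_functional M f) (x, y)) \<and>
         (atomless M \<and>
          int_functional M f (x, y) \<noteq> -\<infinity> \<and>
          decomposable M (topspace S) \<and> decomposable M (topspace T) \<and>
          (\<forall>A xs ys x' y'.
             (\<forall>n :: nat. A n \<in> sets M) \<and>
             (\<forall>B\<in>sets M. emeasure M B < \<infinity> \<longrightarrow> (\<lambda>n. emeasure M (B \<inter> A n)) \<longlonglongrightarrow> 0) \<and>
             (\<forall>n. xs n \<in> topspace S \<and> ys n \<in> topspace T) \<and>
             x' \<in> topspace S \<and> y' \<in> topspace T \<and>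
             limitin (prod_topology S T) (\<lambda>n. (xs n, ys n)) (x', y') sequentially \<longrightarrow>
             limitin (prod_topology S T)
               (\<lambda>n. (glue M (A n) (xs n) x', glue M (A n) (ys n) y')) (x', y') sequentially)
          \<longrightarrow>
          (seq_lsc_at (prod_topology S T) (int_functional M f) (x, y) \<longrightarrow>
             ioffe_criterion M S T f (x, y)))"
proof (intro conjI impI, goal_cases)
  case 1
  show ?case
  proof (rule ioffe_criterion_imp_seq_lsc_at[OF assms(1,3-5) _ _ assms(8-12) 1])
    show "tendsto_local_measure M (\<lambda>n. rep (s n)) (rep u)"
      if "u \<in> topspace S" "\<And>n. s n \<in> topspace S" "limitin S s u sequentially" for u s
      using that by (rule assms(6))
    show "tendsto_biting M (\<lambda>n. rep (s n)) (rep v)"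
      if "v \<in> topspace T" "\<And>n. s n \<in> topspace T" "limitin T s v sequentially" for v s
      using that by (rule assms(7))
  qed
next
  case 2
  then have lsc: "seq_lsc_at (prod_topology S T) (int_functional M f) (x, y)" by simp
  note glue = 2(1)[THEN conjunct2, THEN conjunct2, THEN conjunct2, THEN conjunct2]
  show ?case
  proof (rule seq_lsc_at_imp_ioffe_criterion[OF assms(1,4,5,8,9,10) _ _ _ _ _ lsc])
    fix A :: "nat \<Rightarrow> 'w set" and xs ys
    assume *: "\<And>n. A n \<in> sets M"
      "\<And>B. B \<in> sets M \<Longrightarrow> emeasure M B < \<infinity> \<Longrightarrow> (\<lambda>n. emeasure M (B \<inter> A n)) \<longlonglongrightarrow> 0"
      "\<And>n. xs n \<in> topspace S" "\<And>n. ys n \<in> topspace T"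
      "limitin (prod_topology S T) (\<lambda>n. (xs n, ys n)) (x, y) sequentially"
    show "limitin (prod_topology S T) (\<lambda>n. (glue M (A n) (xs n) x, glue M (A n) (ys n) y)) (x, y)
      sequentially"
      by (rule glue[THEN spec, THEN spec, THEN spec, THEN spec, THEN spec, THEN mp])
        (use * assms(8,9) in \<open>intro conjI allI ballI impI; simp\<close>)
  qed (simp_all add: 2)
qed

end
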